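(* Let $\mathfrak g=\mathfrak{gl}(2|2)$ with the distinguished Borel subalgebra, and write its positive odd roots as $$\alpha=\varepsilon_2-\delta_1,\quad \beta=\varepsilon_1-\delta_1,\quad \gamma=\varepsilon_2-\delta_2,\quad \delta=\varepsilon_1-\delta_2.$$ Let $\lambda\in\mathfrak h^*$ be a weight with degree of atypicality $1$. Then, up to a shift of $\mu^\lambda$ by $(t,t|t,t)$ for some $t\in\mathbb C$, we have the following options. (1) $\mu^\lambda=(0,a|b,0)$ with $a,b\in\mathbb C$ such that $a\neq b$ and $ab\neq 0$. Then $\mathcal S(\lambda)=\{\{\delta\},\emptyset\}$. (2) $\mu^\lambda=(0,a|0,b)$ with $a,b\in\mathbb C$ such that $a\neq b$ and $a\neq 0$. If $b\notin\mathbb Z_{\ge 0}$, then $\mathcal S(\lambda)=\{\{\beta\},\emptyset\}$. If $b\in\mathbb Z_{\ge 0}$, then $\mathcal S(\lambda)=\{\{\beta\},\{\delta\},\emptyset\}$. (3) $\mu^\lambda=(a,0|b,0)$ with $a,b\in\mathbb C$ such that $a\neq b$ and $b\neq 0$. If $a\notin\mathbb Z_{\ge 0}$, then $\mathcal S(\lambda)=\{\{\gamma\},\emptyset\}$. If $a\in\mathbb Z_{\ge 0}$, then $\mathcal S(\lambda)=\{\{\gamma\},\{\delta\},\emptyset\}$. (4) $\mu^\lambda=(a,0|0,b)$ with $a,b\in\mathbb C$ such that $a\neq b$. If $b\notin\mathbb Z_{\ge 0}$ and $a\notin\mathbb Z_{\ge 0}$, then $\mathcal S(\lambda)=\{\{\alpha\},\emptyset\}$.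 If $b\in\mathbb Z_{\ge 0}$ but $a\notin\mathbb Z_{\ge 0}$, then $\mathcal S(\lambda)=\{\{\gamma\},\{\alpha\},\emptyset\}$. If $a\in\mathbb Z_{\ge 0}$ but $b\notin\mathbb Z_{\ge 0}$, then $\mathcal S(\lambda)=\{\{\beta\},\{\alpha\},\emptyset\}$. If $a\in\mathbb Z_{\ge 0}$ and $b\in\mathbb Z_{\ge 0}$, then $\mathcal S(\lambda)=\{\{\delta\},\{\gamma\},\{\beta\},\{\alpha\},\emptyset\}$.
   Context: Work over $\mathbb C$. $\mathfrak g=\mathfrak{gl}(2|2)$; $\mathfrak h$ is the diagonal Cartan subalgebra, $\mathfrak h^*$ has the standard basis $\varepsilon_1,\varepsilon_2,\delta_1,\delta_2$ and the form $(\varepsilon_i,\varepsilon_i)=1$, $(\delta_j,\delta_j)=-1$, all other pairings of basis vectors being $0$. The distinguished Borel subalgebra $\mathfrak b$ has positive even roots $\varepsilon_1-\varepsilon_2$, $\delta_1-\delta_2$ and positive odd roots $\varepsilon_i-\delta_j$. $\rho$ is half the sum of the positive even roots minus half the sum of the positive odd roots. The bijection $\mathfrak h^*\to\mathbb C^{2|2}$, $\lambda\mapsto\mu^\lambda$, is defined by $\mu^\lambda_i=(\lambda+d,\varepsilon_i)$, $\mu^\lambda_{2+j}=(\lambda+d,\delta_j)$ where $d=-\varepsilon_1-2\varepsilon_2+2\delta_1+\delta_2$ ($d-\rho$ is orthogonal to all roots); we write $\mu^\lambda=(\mu_1^\lambda,\mu_2^\lambda|\mu_3^\lambda,\mu_4^\lambda)$.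 The degree of atypicality of $\lambda$ is the maximal number of mutually orthogonal positive odd roots $\eta$ with $(\lambda+\rho,\eta)=0$. $M(\lambda)=U(\mathfrak g)\otimes_{U(\mathfrak b)}\mathbb C_\lambda$ is the Verma module. Let $X=\{x\in\mathfrak g_{\bar 1}\mid [x,x]=0\}$, and for a $\mathfrak g$-module $M$ let $X_M=\{x\in X\mid xM\neq\ker(x|_M)\}$. Let $\mathcal S$ be the set of all subsets $S$ (including $\emptyset$) of mutually orthogonal, linearly independent odd isotropic roots; for $S=\{\alpha_1,\dots,\alpha_k\}\in\mathcal S$ let $x_S=x_1+\dots+x_k$ with $0\neq x_i\in\mathfrak g_{\alpha_i}$, whose orbit $\Phi(S)=B_{\bar 0}x_S$ under the Borel subgroup $B_{\bar 0}$ (with Lie algebra $\mathfrak b\cap \mathfrak g_{\bar 0}$) is independent of choices. Then $\mathcal S(\lambda)=\{S\in\mathcal S\mid \Phi(S)\subset X_{M(\lambda)}\}$. *)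

theory Defs
  imports "HOL-Analysis.Analysis" "HOL-Library.Poly_Mapping"
begin

section \<open>The Lie superalgebra gl(2|2)\<close>

text \<open>
  Elements of gl(2|2) are complex 4x4 matrices; the indices 1, 2 are even and 3, 4 are odd.
  Weights are coordinate vectors with respect to the basis
  \<open>\<epsilon>\<^sub>1, \<epsilon>\<^sub>2, \<delta>\<^sub>1, \<delta>\<^sub>2\<close> of the dual of the diagonal Cartan subalgebra.
  Beware that in the numeral type \<open>4\<close> we have \<open>4 = 0\<close>, so its order is not the order
  1, 2, 3, 4 of the indices; it is never used below.
\<close>

type_synonym gl22 = "complex^4^4"
type_synonym weight = "complex^4"

definition par :: "4 \<Rightarrow> nat" where
  "par i = (if i = 3 \<or> i = 4 then 1 else 0)"

definition gl_part :: "nat \<Rightarrow> gl22 set" where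
  "gl_part p = {x. \<forall>i j. (par i + par j) mod 2 \<noteq> p \<longrightarrow> x $ i $ j = 0}"

definition even_proj :: "gl22 \<Rightarrow> gl22" where
  "even_proj x = (\<chi> i j. if par i = par j then x $ i $ j else 0)"

definition odd_proj :: "gl22 \<Rightarrow> gl22" where
  "odd_proj x = (\<chi> i j. if par i \<noteq> par j then x $ i $ j else 0)"

text \<open>The bilinear extension of \<open>[x, y] = x y - (-1)\<^bsup>|x||y|\<^esup> y x\<close>.\<close>

definition sbracket :: "gl22 \<Rightarrow> gl22 \<Rightarrow> gl22" where
  "sbracket x y = x ** y -
     (even_proj y ** even_proj x + even_proj y ** odd_proj x
      + odd_proj y ** even_proj x - odd_proj y ** odd_proj x)"

lemma sbracket_homogeneous:
  assumes "x \<in> gl_part p" "y \<in> gl_part q" "p < 2" "q < 2"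
  shows "sbracket x y = x ** y - mat ((-1) ^ (p * q)) ** (y ** x)"
proof -
  have e: "even_proj z = (if r = 0 then z else 0) \<and> odd_proj z = (if r = 0 then 0 else z)"
    if "z \<in> gl_part r" "r < 2" for z r
    using that by (auto simp: gl_part_def even_proj_def odd_proj_def par_def vec_eq_iff forall_4
        less_2_cases_iff)
  have m: "mat (- 1) ** z = - (z :: gl22)" for z
    by (simp add: vec_eq_iff matrix_matrix_mult_def mat_def forall_4 sum_4)
  consider "p = 0" | "q = 0" | "p = 1" "q = 1"
    using assms(3,4) by linarith
  then show ?thesis
    by cases (use e[OF assms(1,3)] e[OF assms(2,4)] in \<open>auto simp: sbracket_def m\<close>)
qed

definition cartan :: "gl22 set" where
  "cartan = {h. \<forall>i j. i \<noteq> j \<longrightarrow> h $ i $ j = 0}"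

definition weight_at :: "weight \<Rightarrow> gl22 \<Rightarrow> complex" where
  "weight_at lam h = (\<Sum>i\<in>UNIV. lam $ i * h $ i $ i)"

abbreviation eps1 :: weight where "eps1 \<equiv> axis 1 1"
abbreviation eps2 :: weight where "eps2 \<equiv> axis 2 1"
abbreviation del1 :: weight where "del1 \<equiv> axis 3 1"
abbreviation del2 :: weight where "del2 \<equiv> axis 4 1"

definition wform :: "weight \<Rightarrow> weight \<Rightarrow> complex" where
  "wform lam nu = (\<Sum>i\<in>UNIV. (-1) ^ par i * lam $ i * nu $ i)"

definition pos_even_roots :: "weight set" where
  "pos_even_roots = {eps1 - eps2, del1 - del2}"

definition pos_odd_roots :: "weight set" where
  "pos_odd_roots = {eps1 - del1, eps1 - del2, eps2 - del1, eps2 - del2}"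

definition rho :: weight where
  "rho = (1/2) *s (\<Sum>r\<in>pos_even_roots. r) - (1/2) *s (\<Sum>r\<in>pos_odd_roots. r)"

definition dshift :: weight where
  "dshift = - eps1 - 2 *s eps2 + 2 *s del1 + del2"

definition mu :: "weight \<Rightarrow> complex^4" where
  "mu lam = vector [wform (lam + dshift) eps1, wform (lam + dshift) eps2,
                    wform (lam + dshift) del1, wform (lam + dshift) del2]"

definition mutually_orthogonal :: "weight set \<Rightarrow> bool" where
  "mutually_orthogonal A \<longleftrightarrow> (\<forall>r\<in>A. \<forall>s\<in>A. r \<noteq> s \<longrightarrow> wform r s = 0)"

definition atypicality :: "weight \<Rightarrow> nat" where
  "atypicality lam = Max {card A | A. A \<subseteq> pos_odd_roots \<and> mutually_orthogonal A \<and>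
                                   (\<forall>r\<in>A. wform (lam + rho) r = 0)}"

text \<open>
  The root space of \<open>axis i 1 - axis j 1\<close> is spanned by the matrix unit in position \<open>(i, j)\<close>,
  so the distinguished Borel subalgebra, being the sum of the Cartan subalgebra and the positive
  root spaces, consists of the following matrices.
\<close>

definition borel_sub :: "gl22 set" where
  "borel_sub = {x. \<forall>i j. i \<noteq> j \<and> axis i 1 - axis j 1 \<notin> pos_even_roots \<union> pos_odd_roots
                    \<longrightarrow> x $ i $ j = 0}"

definition root_space :: "weight \<Rightarrow> gl22 set" where
  "root_space r = {x. \<forall>h\<in>cartan. sbracket h x = mat (weight_at r h) ** x}"

definition odd_isotropic_roots :: "weight set" where
  "odd_isotropic_roots =
     {r. r \<noteq> 0 \<and> wform r r = 0 \<and> (\<exists>x\<in>root_space r \<inter> gl_part 1. x \<noteq> 0)}"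


section \<open>The universal enveloping algebra\<close>

text \<open>
  \<open>'a free_mon\<close> is the free monoid on \<open>'a\<close>, so that the monoid algebra
  \<open>(4 \<times> 4) free_mon \<Rightarrow>\<^sub>0 complex\<close> with the convolution product is the free associative algebra
  on the 16 matrix units, that is, the tensor algebra of gl(2|2).
\<close>

datatype 'a free_mon = Letters "'a list"

instantiation free_mon :: (type) monoid_add
begin

definition zero_free_mon :: "'a free_mon" where
  "0 = Letters []"

fun plus_free_mon :: "'a free_mon \<Rightarrow> 'a free_mon \<Rightarrow> 'a free_mon" where
  "Letters u + Letters v = Letters (u @ v)"

instance
proof
  fix a b c :: "'a free_mon"
  show "a + b + c = a + (b + c)" by (cases a; cases b; cases c) simp
  show "0 + a = a" by (cases a) (simp add: zero_free_mon_def)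
  show "a + 0 = a" by (cases a) (simp add: zero_free_mon_def)
qed

end

type_synonym tensor_gl22 = "(4 \<times> 4) free_mon \<Rightarrow>\<^sub>0 complex"

definition tensor_of :: "gl22 \<Rightarrow> tensor_gl22" where
  "tensor_of x = (\<Sum>i\<in>UNIV. \<Sum>j\<in>UNIV. Poly_Mapping.single (Letters [(i, j)]) (x $ i $ j))"

inductive_set env_ideal :: "tensor_gl22 set" where
  zero: "0 \<in> env_ideal"
| add: "s \<in> env_ideal \<Longrightarrow> t \<in> env_ideal \<Longrightarrow> s + t \<in> env_ideal"
| rel: "\<lbrakk>x \<in> gl_part p; y \<in> gl_part q; p < 2; q < 2\<rbrakk> \<Longrightarrow>
        u * (tensor_of x * tensor_of y - (-1) ^ (p * q) * (tensor_of y * tensor_of x)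
             - tensor_of (sbracket x y)) * v \<in> env_ideal"

lemma env_ideal_mult:
  assumes "s \<in> env_ideal" shows "a * s * b \<in> env_ideal"
  using assms
proof induction
  case zero
  show ?case by (simp add: env_ideal.zero)
next
  case (add s t)
  then show ?case by (simp add: distrib_left distrib_right env_ideal.add)
next
  case (rel x p y q u v)
  from env_ideal.rel[OF this, of "a * u" "v * b"] show ?case
    by (simp only: mult.assoc)
qed

lemma env_ideal_mult_left: "s \<in> env_ideal \<Longrightarrow> a * s \<in> env_ideal"
  using env_ideal_mult[of s a 1] by simp

lemma env_ideal_mult_right: "s \<in> env_ideal \<Longrightarrow> s * b \<in> env_ideal"
  using env_ideal_mult[of s 1 b] by simp

lemma env_ideal_uminus: "s \<in> env_ideal \<Longrightarrow> - s \<in> env_ideal"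
  using env_ideal_mult_left[of s "- 1"] by simp

lemma env_ideal_diff: "s \<in> env_ideal \<Longrightarrow> t \<in> env_ideal \<Longrightarrow> s - t \<in> env_ideal"
  using env_ideal.add[of s "- t"] env_ideal_uminus by simp

definition env_eq :: "tensor_gl22 \<Rightarrow> tensor_gl22 \<Rightarrow> bool" where
  "env_eq s t \<longleftrightarrow> s - t \<in> env_ideal"

lemma env_eq_refl: "env_eq s s"
  by (simp add: env_eq_def env_ideal.zero)

text \<open>The augmentation, needed only for \<open>0 \<noteq> 1\<close> in the enveloping algebra.\<close>

lemma lookup_times_zero:
  fixes s t :: tensor_gl22
  shows "Poly_Mapping.lookup (s * t) 0 = Poly_Mapping.lookup s 0 * Poly_Mapping.lookup t 0"
proof -
  have eq: "0 = l + q \<longleftrightarrow> l = 0 \<and> q = 0" for l q :: "(4 \<times> 4) free_mon"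
    by (cases l; cases q) (simp add: zero_free_mon_def)
  have "Sum_any (\<lambda>q. Poly_Mapping.lookup t q when 0 = l + q) = (Poly_Mapping.lookup t 0 when l = 0)"
    for l
    by (cases "l = 0") (simp_all add: eq)
  then show ?thesis
    by (simp add: lookup_mult mult_when)
qed

lemma lookup_tensor_of_zero: "Poly_Mapping.lookup (tensor_of x) 0 = 0"
  by (simp add: tensor_of_def lookup_sum lookup_single zero_free_mon_def)

lemma lookup_env_ideal_zero: "s \<in> env_ideal \<Longrightarrow> Poly_Mapping.lookup s 0 = 0"
  by (induction rule: env_ideal.induct)
    (simp_all add: lookup_add lookup_minus lookup_times_zero lookup_tensor_of_zero)

quotient_type env_gl22 = tensor_gl22 / env_eq
proof (rule equivpI)
  show "reflp env_eq"
    by (auto intro!: reflpI simp: env_eq_refl)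
  show "symp env_eq"
  proof (rule sympI)
    fix s t assume "env_eq s t"
    then show "env_eq t s"
      using env_ideal_uminus[of "s - t"] by (simp add: env_eq_def)
  qed
  show "transp env_eq"
  proof (rule transpI)
    fix r s t assume "env_eq r s" "env_eq s t"
    then show "env_eq r t"
      using env_ideal.add[of "r - s" "s - t"] by (simp add: env_eq_def)
  qed
qed

instantiation env_gl22 :: ring_1
begin

lift_definition zero_env_gl22 :: env_gl22 is 0 .

lift_definition one_env_gl22 :: env_gl22 is 1 .

lift_definition plus_env_gl22 :: "env_gl22 \<Rightarrow> env_gl22 \<Rightarrow> env_gl22" is "(+)"
proof -
  fix a b c d :: tensor_gl22
  assume "env_eq a b" "env_eq c d"
  then have "(a - b) + (c - d) \<in> env_ideal"
    unfolding env_eq_def by (rule env_ideal.add)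
  then show "env_eq (a + c) (b + d)"
    by (simp add: env_eq_def algebra_simps)
qed

lift_definition uminus_env_gl22 :: "env_gl22 \<Rightarrow> env_gl22" is uminus
proof -
  fix a b :: tensor_gl22
  assume "env_eq a b"
  then show "env_eq (- a) (- b)"
    using env_ideal_uminus[of "a - b"] by (simp add: env_eq_def)
qed

lift_definition minus_env_gl22 :: "env_gl22 \<Rightarrow> env_gl22 \<Rightarrow> env_gl22" is "(-)"
proof -
  fix a b c d :: tensor_gl22
  assume "env_eq a b" "env_eq c d"
  then have "(a - b) - (c - d) \<in> env_ideal"
    unfolding env_eq_def by (rule env_ideal_diff)
  then show "env_eq (a - c) (b - d)"
    by (simp add: env_eq_def algebra_simps)
qed

lift_definition times_env_gl22 :: "env_gl22 \<Rightarrow> env_gl22 \<Rightarrow> env_gl22" is "(*)"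
proof -
  fix a b c d :: tensor_gl22
  assume "env_eq a b" "env_eq c d"
  then have "(a - b) * c + b * (c - d) \<in> env_ideal"
    unfolding env_eq_def by (intro env_ideal.add env_ideal_mult_left env_ideal_mult_right)
  then show "env_eq (a * c) (b * d)"
    by (simp add: env_eq_def algebra_simps)
qed

instance
proof
  fix a b c :: env_gl22
  show "a + b + c = a + (b + c)" by transfer (simp add: add.assoc env_eq_refl)
  show "a + b = b + a" by transfer (simp add: add.commute env_eq_refl)
  show "0 + a = a" by transfer (simp add: env_eq_refl)
  show "- a + a = 0" by transfer (simp add: env_eq_refl)
  show "a - b = a + - b" by transfer (simp add: env_eq_refl)
  show "a * b * c = a * (b * c)" by transfer (simp add: mult.assoc env_eq_refl)
  show "1 * a = a" by transfer (simp add: env_eq_refl)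
  show "a * 1 = a" by transfer (simp add: env_eq_refl)
  show "(a + b) * c = a * c + b * c" by transfer (simp add: distrib_right env_eq_refl)
  show "a * (b + c) = a * b + a * c" by transfer (simp add: distrib_left env_eq_refl)
  show "(0 :: env_gl22) \<noteq> 1"
    by transfer (use lookup_env_ideal_zero[of "- 1"] in \<open>auto simp: env_eq_def\<close>)
qed

end

lift_definition env_of :: "gl22 \<Rightarrow> env_gl22" is tensor_of .

lift_definition env_scalar :: "complex \<Rightarrow> env_gl22" is "Poly_Mapping.single 0" .


section \<open>Verma modules\<close>

text \<open>
  Let \<open>\<bb>\<close> act on the line \<open>\<complex>\<^sub>\<lambda>\<close> by \<open>weight_at \<lambda>\<close>, which reads off the diagonal entries and hence
  vanishes on the nilradical. Identifying \<open>u \<otimes> c\<close> with \<open>c u\<close>, the tensor product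
  \<open>U(\<gg>) \<otimes>\<^bsub>U(\<bb>)\<^esub> \<complex>\<^sub>\<lambda>\<close> is the quotient of \<open>U(\<gg>)\<close> by the balancing relations
  \<open>u b \<otimes> 1 = u \<otimes> b 1\<close>. It suffices to impose them for \<open>b \<in> \<bb>\<close>, as \<open>\<bb>\<close> generates \<open>U(\<bb>)\<close>.
\<close>

inductive_set verma_rel :: "weight \<Rightarrow> env_gl22 set" for lam :: weight where
  zero: "0 \<in> verma_rel lam"
| add: "s \<in> verma_rel lam \<Longrightarrow> t \<in> verma_rel lam \<Longrightarrow> s + t \<in> verma_rel lam"
| rel: "b \<in> borel_sub \<Longrightarrow> u * env_of b - u * env_scalar (weight_at lam b) \<in> verma_rel lam"

definition verma_eq :: "weight \<Rightarrow> (env_gl22 \<times> env_gl22) set" where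
  "verma_eq lam = {(u, v). u - v \<in> verma_rel lam}"

definition verma :: "weight \<Rightarrow> env_gl22 set set" where
  "verma lam = UNIV // verma_eq lam"

definition verma_zero :: "weight \<Rightarrow> env_gl22 set" where
  "verma_zero lam = verma_eq lam `` {0}"

definition verma_act :: "weight \<Rightarrow> gl22 \<Rightarrow> env_gl22 set \<Rightarrow> env_gl22 set" where
  "verma_act lam x C = (\<Union>u\<in>C. verma_eq lam `` {env_of x * u})"

lemma verma_rel_mult_left: "s \<in> verma_rel lam \<Longrightarrow> a * s \<in> verma_rel lam"
proof (induction rule: verma_rel.induct)
  case zero
  show ?case by (simp add: verma_rel.zero)
next
  case (add s t)
  then show ?case by (simp add: distrib_left verma_rel.add)
next
  case (rel b u)
  from verma_rel.rel[OF this, of "a * u"] show ?case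
    by (simp add: right_diff_distrib mult.assoc)
qed

lemma equiv_verma_eq: "equiv UNIV (verma_eq lam)"
proof (rule equivI)
  show "refl (verma_eq lam)"
    by (simp add: refl_on_def verma_eq_def verma_rel.zero)
  show "sym (verma_eq lam)"
  proof (rule symI)
    fix u v assume "(u, v) \<in> verma_eq lam"
    then show "(v, u) \<in> verma_eq lam"
      using verma_rel_mult_left[of "u - v" lam "- 1"] by (simp add: verma_eq_def)
  qed
  show "trans (verma_eq lam)"
  proof (rule transI)
    fix u v w assume "(u, v) \<in> verma_eq lam" "(v, w) \<in> verma_eq lam"
    then show "(u, w) \<in> verma_eq lam"
      using verma_rel.add[of "u - v" lam "v - w"] by (simp add: verma_eq_def)
  qed
qed simp

lemma verma_act_class:
  "verma_act lam x (verma_eq lam `` {u}) = verma_eq lam `` {env_of x * u}"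
  unfolding verma_act_def
proof (rule UN_equiv_class[OF equiv_verma_eq])
  show "(\<lambda>u. verma_eq lam `` {env_of x * u}) respects verma_eq lam"
  proof (rule congruentI)
    fix u v assume "(u, v) \<in> verma_eq lam"
    then have "(env_of x * u, env_of x * v) \<in> verma_eq lam"
      using verma_rel_mult_left[of "u - v" lam "env_of x"]
      by (simp add: verma_eq_def right_diff_distrib)
    then show "verma_eq lam `` {env_of x * u} = verma_eq lam `` {env_of x * v}"
      by (rule equiv_class_eq[OF equiv_verma_eq])
  qed
qed simp


section \<open>Associated varieties and the sets of roots attached to a weight\<close>

definition self_commuting :: "gl22 set" where
  "self_commuting = {x \<in> gl_part 1. sbracket x x = 0}"

text \<open>A module enters through its carrier, its zero and the action.\<close>

definition assoc_variety :: "'m set \<Rightarrow> 'm \<Rightarrow> (gl22 \<Rightarrow> 'm \<Rightarrow> 'm) \<Rightarrow> gl22 set" where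
  "assoc_variety M z act = {x \<in> self_commuting. act x ` M \<noteq> {m \<in> M. act x m = z}}"

definition root_sets :: "weight set set" where
  "root_sets = {S. S \<subseteq> odd_isotropic_roots \<and> mutually_orthogonal S \<and> vec.independent S}"

definition borel_group_even :: "gl22 set" where
  "borel_group_even = {g \<in> borel_sub \<inter> gl_part 0. invertible g}"

text \<open>The orbit \<open>orbit_of S\<close> does not depend on the choice of the root vectors.\<close>

definition root_vector :: "weight \<Rightarrow> gl22" where
  "root_vector r = (SOME x. x \<in> root_space r \<and> x \<noteq> 0)"

definition orbit_of :: "weight set \<Rightarrow> gl22 set" where
  "orbit_of S = {g ** (\<Sum>r\<in>S. root_vector r) ** matrix_inv g | g. g \<in> borel_group_even}"

definition root_sets_of :: "weight \<Rightarrow> weight set set" where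
  "root_sets_of lam =
     {S \<in> root_sets. orbit_of S \<subseteq> assoc_variety (verma lam) (verma_zero lam) (verma_act lam)}"

end

theory Submission
  imports Defs "HOL-Library.Function_Algebras"
begin

text \<open>
  The Verma module is \<open>\<Lambda>(\<gg>\<^sub>-\<^sub>1) \<otimes> M\<^sub>0\<close> with \<open>M\<^sub>0 = \<complex>[z, w]\<close> the even Verma module, \<open>z\<close> and \<open>w\<close> being
  multiplication by \<open>E\<^sub>2\<^sub>1\<close> and \<open>E\<^sub>4\<^sub>3\<close>. Write \<open>\<psi>\<^sub>k\<^sub>l\<close> for the annihilation operator of \<open>E\<^sub>k\<^sub>l\<close>. The root vector
  \<open>x = E\<^sub>l\<^sub>k\<close> of a positive odd root acts as \<open>h \<psi>\<^sub>k\<^sub>l + P \<psi>\<^sub>k\<^sub>l\<^sub>' + Q \<psi>\<^sub>k\<^sub>'\<^sub>l\<close> plus a nilpotent cubic term, where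
  \<open>h\<close> is the action of the coroot, \<open>P\<close> acts on \<open>\<complex>[z]\<close> and \<open>Q\<close> on \<open>\<complex>[w]\<close>, each being either multiplication
  by the variable or the operator \<open>z\<^sup>i \<mapsto> i (a - i) z\<^sup>i\<^sup>-\<^sup>1\<close> coming from \<open>E\<^sub>1\<^sub>2\<close> or \<open>E\<^sub>3\<^sub>4\<close>. So \<open>ker x = im x\<close> unless
  the Koszul complex of \<open>P\<close> and \<open>Q\<close> has homology on the kernel of \<open>h\<close>, and its homology is
  spanned by monomials. For the negative odd roots \<open>x\<close> is a creation operator, hence \<open>ker x = im x\<close>. For a
  pair of orthogonal roots some odd \<open>y\<close> satisfies \<open>[x, y] = 1\<close>, and the identity matrix acts by
  \<open>\<mu>\<^sub>1 + \<mu>\<^sub>2 - \<mu>\<^sub>3 - \<mu>\<^sub>4\<close>, which is nonzero if the atypicality is one.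
  Finally, conjugation by an element of the Borel group is an automorphism that preserves the
  relations of the Verma module, so it suffices to look at one point of each orbit.
\<close>

section \<open>Matrix units in the enveloping algebra\<close>

lemma poly_mapping_single_add_induct [case_names zero single add]:
  fixes t :: "'a \<Rightarrow>\<^sub>0 'b::ab_group_add"
  assumes "P 0" "\<And>k c. P (Poly_Mapping.single k c)" "\<And>s t. P s \<Longrightarrow> P t \<Longrightarrow> P (s + t)"
  shows "P t"
proof -
  have "P (\<Sum>k\<in>A. Poly_Mapping.single k (Poly_Mapping.lookup t k))" for A
    by (induction A rule: infinite_finite_induct) (use assms in auto)
  moreover have "t = (\<Sum>k\<in>Poly_Mapping.keys t. Poly_Mapping.single k (Poly_Mapping.lookup t k))"
    by (rule poly_mapping_eqI)
      (auto simp: lookup_sum lookup_single when_def sum.delta in_keys_iff)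
  ultimately show ?thesis by metis
qed

definition munit :: "4 \<Rightarrow> 4 \<Rightarrow> gl22" where
  "munit i j = (\<chi> k l. if k = i \<and> l = j then 1 else 0)"

lemma munit_nth [simp]: "munit i j $ k $ l = (if k = i \<and> l = j then 1 else 0)"
  by (simp add: munit_def)

abbreviation smul :: "complex \<Rightarrow> gl22 \<Rightarrow> gl22" where "smul c x \<equiv> mat c ** x"

lemma mat_mult_nth [simp]: "(smul c x) $ i $ j = c * x $ i $ j"
  by (simp add: matrix_matrix_mult_def mat_def if_distrib[of "\<lambda>t. t * _"] cong: if_cong)

lemma tensor_of_add: "tensor_of (x + y) = tensor_of x + tensor_of y"
  by (simp add: tensor_of_def single_add sum.distrib)

lemma tensor_of_smul: "tensor_of (smul c x) = Poly_Mapping.single 0 c * tensor_of x"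
  by (simp add: tensor_of_def sum_distrib_left mult_single)

lemma tensor_of_munit: "tensor_of (munit i j) = Poly_Mapping.single (Letters [(i, j)]) 1"
proof -
  have "tensor_of (munit i j) = (\<Sum>k\<in>UNIV. \<Sum>l\<in>UNIV. if k = i \<and> l = j then Poly_Mapping.single (Letters [(i, j)]) 1 else 0)"
    unfolding tensor_of_def by (intro sum.cong refl) auto
  also have "\<dots> = (\<Sum>k\<in>UNIV. if k = i then Poly_Mapping.single (Letters [(i, j)]) 1 else 0)"
    by (intro sum.cong refl) auto
  finally show ?thesis by simp
qed

lemma env_of_add: "env_of (x + y) = env_of x + env_of y"
  by transfer (simp add: tensor_of_add env_eq_refl)

lemma env_of_smul: "env_of (smul c x) = env_scalar c * env_of x"
  by transfer (simp add: tensor_of_smul env_eq_refl)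

lemma env_of_zero [simp]: "env_of 0 = 0"
  using env_of_add[of 0 0] by simp

lemma env_of_minus: "env_of (- x) = - env_of x"
  using env_of_add[of x "- x"] by (simp add: eq_neg_iff_add_eq_0 add.commute)

lemma env_of_diff: "env_of (x - y) = env_of x - env_of y"
  using env_of_add[of x "- y"] by (simp add: env_of_minus)

lemma env_of_sum: "env_of (sum f A) = (\<Sum>a\<in>A. env_of (f a))"
  by (induction A rule: infinite_finite_induct) (auto simp: env_of_add)

lemma env_scalar_add: "env_scalar (c + d) = env_scalar c + env_scalar d"
  by transfer (simp add: single_add env_eq_refl)

lemma env_scalar_mult: "env_scalar (c * d) = env_scalar c * env_scalar d"
  by transfer (simp add: mult_single env_eq_refl)

lemma env_scalar_0 [simp]: "env_scalar 0 = 0"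
  by transfer (simp add: env_eq_refl)

lemma env_scalar_1 [simp]: "env_scalar 1 = 1"
  by transfer (simp add: env_eq_refl)

lemma env_scalar_minus: "env_scalar (- c) = - env_scalar c"
  using env_scalar_add[of c "- c"] by (simp add: eq_neg_iff_add_eq_0 add.commute)

lemma single_0_central: "Poly_Mapping.single 0 c * t = t * Poly_Mapping.single 0 (c :: complex)"
  for t :: tensor_gl22
  by (induction t rule: poly_mapping_single_add_induct) (simp_all add: mult_single distrib_left distrib_right mult.commute)

lemma env_scalar_central: "env_scalar c * u = u * env_scalar c"
  by transfer (simp add: single_0_central env_eq_refl)

lemma env_scalar_left_commute: "u * (env_scalar c * v) = env_scalar c * (u * v)"
  by (metis env_scalar_central mult.assoc)

lemma env_bracket:
  assumes "x \<in> gl_part p" "y \<in> gl_part q" "p < 2" "q < 2"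
  shows "env_of x * env_of y = (-1) ^ (p * q) * (env_of y * env_of x) + env_of (sbracket x y)"
proof -
  have *: "env_of x * env_of y - ((if even (p * q) then 1 else - 1) * (env_of y * env_of x) + env_of (sbracket x y)) = 0"
    using assms
  proof transfer
    fix x y :: gl22 and p q :: nat
    assume "x \<in> gl_part p" "y \<in> gl_part q" "p < 2" "q < 2"
    from env_ideal.rel[OF this, of 1 1]
    show "env_eq (tensor_of x * tensor_of y - ((if even (p * q) then 1 else - 1) * (tensor_of y * tensor_of x) + tensor_of (sbracket x y))) 0"
      by (cases "even (p * q)") (simp_all add: env_eq_def algebra_simps)
  qed
  moreover have "(-1) ^ (p * q) = (if even (p * q) then 1 else (- 1 :: env_gl22))" by simp
  ultimately show ?thesis by (simp only: right_minus_eq)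
qed

lemma munit_part: "munit i j \<in> gl_part ((par i + par j) mod 2)"
  by (auto simp: gl_part_def)

lemma munit_mult: "munit i j ** munit k l = (if j = k then munit i l else 0)"
  by (auto simp: vec_eq_iff matrix_matrix_mult_def if_distrib[of "\<lambda>t. t * _"] if_distrib[of "\<lambda>t. _ * t"] sum.If_cases cong: if_cong)

text \<open>The sign in the bracket of two matrix units, complex valued so that it can serve as a
  scalar on matrices and on the model.\<close>

definition psign :: "4 \<Rightarrow> 4 \<Rightarrow> 4 \<Rightarrow> 4 \<Rightarrow> complex" where
  "psign i j k l = (if par i \<noteq> par j \<and> par k \<noteq> par l then -1 else 1)"

lemma sbracket_munit:
  "sbracket (munit i j) (munit k l) =
     (if j = k then munit i l else 0) - smul (psign i j k l) (if l = i then munit k j else 0)"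
proof -
  have "(-1) ^ ((par i + par j) mod 2 * ((par k + par l) mod 2)) = psign i j k l"
    by (auto simp: psign_def par_def)
  then show ?thesis
    by (simp add: sbracket_homogeneous[OF munit_part munit_part] munit_mult)
qed

abbreviation eu :: "4 \<Rightarrow> 4 \<Rightarrow> env_gl22" where "eu i j \<equiv> env_of (munit i j)"

lemma eu_bracket:
  "eu i j * eu k l = (if par i \<noteq> par j \<and> par k \<noteq> par l then -1 else 1) * (eu k l * eu i j) +
     (if j = k then eu i l else 0) - (if par i \<noteq> par j \<and> par k \<noteq> par l then -1 else 1) * (if l = i then eu k j else 0)"
proof -
  have "(-1) ^ ((par i + par j) mod 2 * ((par k + par l) mod 2)) = 
    (if par i \<noteq> par j \<and> par k \<noteq> par l then -1 else 1 :: env_gl22)"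
    by (auto simp: par_def)
  then show ?thesis
    using env_bracket[OF munit_part[of i j] munit_part[of k l]]
    by (simp add: sbracket_munit env_of_diff env_of_smul psign_def env_scalar_minus)
qed

text \<open>Words in the matrix units span the free algebra, hence its quotient. Letters are peeled
  off on the left because the arguments below concern left modules and left ideals.\<close>

lemma env_induct [consumes 0, case_names add letter scalar]:
  assumes add: "\<And>u v. P u \<Longrightarrow> P v \<Longrightarrow> P (u + v)"
    and letter: "\<And>i j u. P u \<Longrightarrow> P (eu i j * u)"
    and scalar: "\<And>c. P (env_scalar c)"
  shows "P u"
proof -
  have word: "P (abs_env_gl22 (Poly_Mapping.single (Letters ws) c))" for ws c
  proof (induction ws)
    case Nil
    show ?case using scalar[of c] by (simp add: env_scalar.abs_eq zero_free_mon_def)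
  next
    case (Cons w ws)
    have "abs_env_gl22 (Poly_Mapping.single (Letters (w # ws)) c)
        = eu (fst w) (snd w) * abs_env_gl22 (Poly_Mapping.single (Letters ws) c)"
      by (simp add: env_of.abs_eq times_env_gl22.abs_eq tensor_of_munit mult_single)
    then show ?case using letter[OF Cons] by simp
  qed
  have "P (abs_env_gl22 t)" for t
  proof (induction t rule: poly_mapping_single_add_induct)
    case (single k c)
    then show ?case using word by (cases k) auto
  next
    case zero
    then show ?case using scalar[of 0] by (simp add: zero_env_gl22.abs_eq)
  next
    case (add f g)
    then show ?case using assms(1)[of "abs_env_gl22 f" "abs_env_gl22 g"]
      by (simp add: plus_env_gl22.abs_eq)
  qed
  then show ?thesis by (induction u rule: env_gl22.abs_induct)
qed

section \<open>Representations of gl(2|2)\<close>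

text \<open>This packages the universal property of the enveloping algebra: a representation of the
  superalgebra extends to \<open>env_act\<close>. It is instantiated twice, by the concrete model of
  the Verma module and, in \<open>env_conj\<close>, by the enveloping algebra acting on itself
  through conjugated matrices. Linearity in the matrix is required as \<open>act_expand\<close>,
  which reduces everything to matrix units.\<close>

locale gl_rep = vector_space scale
  for scale :: "complex \<Rightarrow> 'v::ab_group_add \<Rightarrow> 'v" +
  fixes act :: "gl22 \<Rightarrow> 'v \<Rightarrow> 'v"
  assumes act_add: "act x (v + w) = act x v + act x w"
    and act_scale: "act x (scale c v) = scale c (act x v)"
    and act_expand: "act x v = (\<Sum>i\<in>UNIV. \<Sum>j\<in>UNIV. scale (x $ i $ j) (act (munit i j) v))"
    and act_bracket: "\<lbrakk>x \<in> gl_part p; y \<in> gl_part q; p < 2; q < 2\<rbrakk> \<Longrightarrow>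
      act x (act y v) = scale ((-1) ^ (p * q)) (act y (act x v)) + act (sbracket x y) v"
begin

fun word_act :: "(4 \<times> 4) free_mon \<Rightarrow> 'v \<Rightarrow> 'v" where
  "word_act (Letters ws) v = foldr (\<lambda>(i, j). act (munit i j)) ws v"

definition tensor_act :: "tensor_gl22 \<Rightarrow> 'v \<Rightarrow> 'v" where
  "tensor_act t v = (\<Sum>k\<in>Poly_Mapping.keys t. scale (Poly_Mapping.lookup t k) (word_act k v))"

lemma act_zero [simp]: "act x 0 = 0"
  using act_add[of x 0 0] by simp

lemma word_act_add: "word_act k (v + w) = word_act k v + word_act k w"
proof (cases k)
  case (Letters ws)
  have "foldr (\<lambda>(i, j). act (munit i j)) ws (v + w) =
    foldr (\<lambda>(i, j). act (munit i j)) ws v + foldr (\<lambda>(i, j). act (munit i j)) ws w"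
    by (induction ws) (auto simp: act_add)
  then show ?thesis using Letters by simp
qed

lemma word_act_scale: "word_act k (scale c v) = scale c (word_act k v)"
proof (cases k)
  case (Letters ws)
  have "foldr (\<lambda>(i, j). act (munit i j)) ws (scale c v) = scale c (foldr (\<lambda>(i, j). act (munit i j)) ws v)"
    by (induction ws) (auto simp: act_scale)
  then show ?thesis using Letters by simp
qed

lemma word_act_plus: "word_act (k + l) v = word_act k (word_act l v)"
  by (cases k; cases l) simp

lemma tensor_act_superset:
  assumes "finite A" "Poly_Mapping.keys t \<subseteq> A"
  shows "tensor_act t v = (\<Sum>k\<in>A. scale (Poly_Mapping.lookup t k) (word_act k v))"
  unfolding tensor_act_def
  by (rule sum.mono_neutral_left) (use assms in \<open>auto simp: in_keys_iff\<close>)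

lemma tensor_act_zero [simp]: "tensor_act 0 v = 0"
  by (simp add: tensor_act_def)

lemma tensor_act_single [simp]: "tensor_act (Poly_Mapping.single k c) v = scale c (word_act k v)"
  by (subst tensor_act_superset[of "{k}"]) auto

lemma tensor_act_plus: "tensor_act (s + t) v = tensor_act s v + tensor_act t v"
proof -
  let ?A = "Poly_Mapping.keys s \<union> Poly_Mapping.keys t"
  have "Poly_Mapping.keys (s + t) \<subseteq> ?A" by (rule Poly_Mapping.keys_add)
  then show ?thesis
    by (simp add: tensor_act_superset[of ?A] lookup_add scale_left_distrib sum.distrib)
qed

lemma tensor_act_minus: "tensor_act (s - t) v = tensor_act s v - tensor_act t v"
  using tensor_act_plus[of "s - t" t v] by simp

lemma tensor_act_sum: "tensor_act (sum f A) v = (\<Sum>a\<in>A. tensor_act (f a) v)"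
  by (induction A rule: infinite_finite_induct) (auto simp: tensor_act_plus)

lemma tensor_act_add: "tensor_act t (v + w) = tensor_act t v + tensor_act t w"
  by (simp add: tensor_act_def word_act_add scale_right_distrib sum.distrib)

lemma tensor_act_scale: "tensor_act t (scale c v) = scale c (tensor_act t v)"
  by (simp add: tensor_act_def word_act_scale scale_sum_right mult.commute)

lemma tensor_act_0 [simp]: "tensor_act t 0 = 0"
  using tensor_act_add[of t 0 0] by simp

lemma tensor_act_times: "tensor_act (s * t) v = tensor_act s (tensor_act t v)"
proof (induction s rule: poly_mapping_single_add_induct)
  case (single k c)
  show ?case
    by (induction t rule: poly_mapping_single_add_induct)
      (simp_all add: mult_single word_act_plus word_act_scale word_act_add distrib_left
        tensor_act_plus scale_right_distrib tensor_act_scale)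
qed (simp_all add: distrib_right tensor_act_plus)

lemma tensor_act_tensor_of: "tensor_act (tensor_of x) v = act x v"
  by (simp add: tensor_of_def tensor_act_sum act_expand[of x])

lemma tensor_act_one [simp]: "tensor_act 1 v = v"
  by (simp add: zero_free_mon_def flip: single_one)

text \<open>\<open>act_bracket\<close>, applied to the vector produced by the right factor of a
  relator, says that the middle factor acts by zero.\<close>

lemma tensor_act_env_ideal: "t \<in> env_ideal \<Longrightarrow> tensor_act t v = 0"
proof (induction arbitrary: v rule: env_ideal.induct)
  case (rel x p y q u w)
  have sgn: "(- 1) ^ n = Poly_Mapping.single 0 ((-1) ^ n :: complex)" for n :: nat and t :: tensor_gl22
    by (cases "even n") (simp_all add: single_uminus)
  show ?case
    using act_bracket[OF rel, of "tensor_act w v"]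
    by (simp add: tensor_act_times tensor_act_minus tensor_act_tensor_of sgn zero_free_mon_def)
qed (simp_all add: tensor_act_plus)

text \<open>Evaluated on a chosen representative; \<open>env_act_abs\<close> shows independence of
  the choice, because the ideal acts by zero.\<close>

definition env_act :: "env_gl22 \<Rightarrow> 'v \<Rightarrow> 'v" where
  "env_act u = tensor_act (rep_env_gl22 u)"

lemma env_act_abs: "env_act (abs_env_gl22 t) v = tensor_act t v"
proof -
  have "env_eq (rep_env_gl22 (abs_env_gl22 t)) t"
    using Quotient3_env_gl22 by (simp add: Quotient3_def env_eq_refl)
  then show ?thesis
    using tensor_act_env_ideal[of "rep_env_gl22 (abs_env_gl22 t) - t" v]
    by (simp add: env_act_def env_eq_def tensor_act_minus)
qed

lemma env_act_plus: "env_act (u + u') v = env_act u v + env_act u' v"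
  by (induction u rule: env_gl22.abs_induct; induction u' rule: env_gl22.abs_induct)
    (simp add: plus_env_gl22.abs_eq env_act_abs tensor_act_plus)

lemma env_act_zero: "env_act 0 v = 0"
  using env_act_plus[of 0 0 v] by simp

lemma env_act_minus: "env_act (u - u') v = env_act u v - env_act u' v"
  using env_act_plus[of "u - u'" u' v] by simp

lemma env_act_times: "env_act (u * u') v = env_act u (env_act u' v)"
  by (induction u rule: env_gl22.abs_induct; induction u' rule: env_gl22.abs_induct)
    (simp add: times_env_gl22.abs_eq env_act_abs tensor_act_times)

lemma env_act_env_of: "env_act (env_of x) v = act x v"
  by (simp add: env_of.abs_eq env_act_abs tensor_act_tensor_of)

lemma env_act_scalar: "env_act (env_scalar c) v = scale c v"
  by (simp add: env_scalar.abs_eq env_act_abs zero_free_mon_def)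

lemma env_act_one [simp]: "env_act 1 v = v"
  using env_act_scalar[of 1 v] by simp

text \<open>Each generator of the left ideal kills a vector on which the Borel subalgebra acts
  through \<open>lam\<close>. This is the universal property of the Verma module.\<close>

lemma env_act_verma_rel:
  assumes "\<And>b. b \<in> borel_sub \<Longrightarrow> act b v = scale (weight_at lam b) v"
  shows "u \<in> verma_rel lam \<Longrightarrow> env_act u v = 0"
  by (induction rule: verma_rel.induct)
    (simp_all add: env_act_zero env_act_plus env_act_minus env_act_times env_act_env_of env_act_scalar assms)

end

section \<open>A concrete model of the Verma module\<close>

text \<open>The value \<open>f i j p q r s\<close> is the coefficient of
  \<open>E\<^sub>3\<^sub>1\<^sup>p E\<^sub>3\<^sub>2\<^sup>q E\<^sub>4\<^sub>1\<^sup>r E\<^sub>4\<^sub>2\<^sup>s E\<^sub>2\<^sub>1\<^sup>i E\<^sub>4\<^sub>3\<^sup>j v\<close>, where \<open>v\<close> is the highest weight vector. All formulas make sense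
  without finiteness of the support.\<close>

type_synonym vfun = "nat \<Rightarrow> nat \<Rightarrow> bool \<Rightarrow> bool \<Rightarrow> bool \<Rightarrow> bool \<Rightarrow> complex"

definition vscale :: "complex \<Rightarrow> vfun \<Rightarrow> vfun" where
  "vscale c f = (\<lambda>i j p q r s. c * f i j p q r s)"

lemma vscale_apply [simp]: "vscale c f i j p q r s = c * f i j p q r s"
  by (simp add: vscale_def)

definition sg :: "bool \<Rightarrow> complex" where "sg b = (if b then -1 else 1)"
definition nb :: "bool \<Rightarrow> complex" where "nb b = (if b then 1 else 0)"

lemma sg_simps [simp]: "sg True = -1" "sg False = 1" by (simp_all add: sg_def)
lemma nb_simps [simp]: "nb True = 1" "nb False = 0" by (simp_all add: nb_def)

text \<open>Exterior multiplication and contraction for the four odd generators in the order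
  \<open>31\<close>, \<open>32\<close>, \<open>41\<close>, \<open>42\<close>. Each sign counts the
  occupied generators standing to the left, which makes the operators of different generators
  anticommute.\<close>

definition cr31 :: "vfun \<Rightarrow> vfun" where
  "cr31 f i j p q r s = (if p then f i j False q r s else 0)"
definition an31 :: "vfun \<Rightarrow> vfun" where
  "an31 f i j p q r s = (if p then 0 else f i j True q r s)"
definition cr32 :: "vfun \<Rightarrow> vfun" where
  "cr32 f i j p q r s = (if q then sg p * f i j p False r s else 0)"
definition an32 :: "vfun \<Rightarrow> vfun" where
  "an32 f i j p q r s = (if q then 0 else sg p * f i j p True r s)"
definition cr41 :: "vfun \<Rightarrow> vfun" where
  "cr41 f i j p q r s = (if r then sg p * sg q * f i j p q False s else 0)"
definition an41 :: "vfun \<Rightarrow> vfun" where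
  "an41 f i j p q r s = (if r then 0 else sg p * sg q * f i j p q True s)"
definition cr42 :: "vfun \<Rightarrow> vfun" where
  "cr42 f i j p q r s = (if s then sg p * sg q * sg r * f i j p q r False else 0)"
definition an42 :: "vfun \<Rightarrow> vfun" where
  "an42 f i j p q r s = (if s then 0 else sg p * sg q * sg r * f i j p q r True)"

lemma cr_an_simps [simp]:
  "cr31 f i j True q r s = f i j False q r s" "cr31 f i j False q r s = 0"
  "an31 f i j False q r s = f i j True q r s" "an31 f i j True q r s = 0"
  "cr32 f i j p True r s = sg p * f i j p False r s" "cr32 f i j p False r s = 0"
  "an32 f i j p False r s = sg p * f i j p True r s" "an32 f i j p True r s = 0"
  "cr41 f i j p q True s = sg p * sg q * f i j p q False s" "cr41 f i j p q False s = 0"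
  "an41 f i j p q False s = sg p * sg q * f i j p q True s" "an41 f i j p q True s = 0"
  "cr42 f i j p q r True = sg p * sg q * sg r * f i j p q r False" "cr42 f i j p q r False = 0"
  "an42 f i j p q r False = sg p * sg q * sg r * f i j p q r True" "an42 f i j p q r True = 0"
  by (simp_all add: cr31_def an31_def cr32_def an32_def cr41_def an41_def cr42_def an42_def)

definition zm :: "vfun \<Rightarrow> vfun" where
  "zm f i j p q r s = (case i of 0 \<Rightarrow> 0 | Suc k \<Rightarrow> f k j p q r s)"
definition wm :: "vfun \<Rightarrow> vfun" where
  "wm f i j p q r s = (case j of 0 \<Rightarrow> 0 | Suc k \<Rightarrow> f i k p q r s)"
text \<open>The sl(2) formula: applied to \<open>E_21^(i+1) v\<close>, the matrix unit
  \<open>E_12\<close> gives \<open>E_21^i v\<close> times \<open>(i+1) (lam_1 - lam_2 - i)\<close>.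
  Likewise \<open>wd\<close> describes \<open>E_34\<close> on powers of \<open>E_43\<close>.\<close>

definition zd :: "weight \<Rightarrow> vfun \<Rightarrow> vfun" where
  "zd lam f i j p q r s = (of_nat i + 1) * (lam $ 1 - lam $ 2 - of_nat i) * f (Suc i) j p q r s"
definition wd :: "weight \<Rightarrow> vfun \<Rightarrow> vfun" where
  "wd lam f i j p q r s = (of_nat j + 1) * (lam $ 3 - lam $ 4 - of_nat j) * f i (Suc j) p q r s"

lemma zm_wm_simps [simp]:
  "zm f 0 j p q r s = 0" "zm f (Suc i) j p q r s = f i j p q r s"
  "wm f i 0 p q r s = 0" "wm f i (Suc j) p q r s = f i j p q r s"
  by (simp_all add: zm_def wm_def)

text \<open>The \<open>k\<close>-th coordinate of the weight of a basis monomial: a factor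
  \<open>E_ab\<close> adds 1 to coordinate \<open>a\<close> and subtracts 1 from coordinate
  \<open>b\<close>.\<close>

definition wt :: "weight \<Rightarrow> 4 \<Rightarrow> nat \<Rightarrow> nat \<Rightarrow> bool \<Rightarrow> bool \<Rightarrow> bool \<Rightarrow> bool \<Rightarrow> complex" where
  "wt lam k i j p q r s =
    (if k = 1 then lam $ 1 - of_nat i - nb p - nb r
     else if k = 2 then lam $ 2 + of_nat i - nb q - nb s
     else if k = 3 then lam $ 3 - of_nat j + nb p + nb q
     else lam $ 4 + of_nat j + nb r + nb s)"

definition dg :: "weight \<Rightarrow> 4 \<Rightarrow> vfun \<Rightarrow> vfun" where
  "dg lam k f i j p q r s = wt lam k i j p q r s * f i j p q r s"

text \<open>The formulas for the even matrix units are the adjoint action on the exterior algebra plus the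
  action on \<open>M\<^sub>0\<close>; those for \<open>E\<^sub>l\<^sub>k\<close> with \<open>l < k\<close> odd result from commuting \<open>E\<^sub>l\<^sub>k\<close> through the odd creation operators.\<close>

definition vop :: "weight \<Rightarrow> 4 \<Rightarrow> 4 \<Rightarrow> vfun \<Rightarrow> vfun" where
  "vop lam k l f =
    (if k = l then dg lam k f
     else if k = 3 \<and> l = 1 then cr31 f
     else if k = 3 \<and> l = 2 then cr32 f
     else if k = 4 \<and> l = 1 then cr41 f
     else if k = 4 \<and> l = 2 then cr42 f
     else if k = 1 \<and> l = 2 then zd lam f - cr32 (an31 f) - cr42 (an41 f)
     else if k = 2 \<and> l = 1 then zm f - cr31 (an32 f) - cr41 (an42 f)
     else if k = 3 \<and> l = 4 then wd lam f + cr31 (an41 f) + cr32 (an42 f)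
     else if k = 4 \<and> l = 3 then wm f + cr41 (an31 f) + cr42 (an32 f)
     else if k = 1 \<and> l = 3 then dg lam 1 (an31 f) + dg lam 3 (an31 f) + zd lam (an32 f) + wm (an41 f) - cr42 (an41 (an32 f))
     else if k = 1 \<and> l = 4 then dg lam 1 (an41 f) + dg lam 4 (an41 f) + zd lam (an42 f) + wd lam (an31 f) - cr32 (an31 (an42 f))
     else if k = 2 \<and> l = 3 then dg lam 2 (an32 f) + dg lam 3 (an32 f) + zm (an31 f) + wm (an42 f) - cr41 (an42 (an31 f))
     else dg lam 2 (an42 f) + dg lam 4 (an42 f) + zm (an41 f) + wd lam (an32 f) - cr31 (an32 (an41 f)))"

lemma vop_simps:
  "vop lam k k f = dg lam k f"
  "vop lam 3 1 f = cr31 f" "vop lam 3 2 f = cr32 f" "vop lam 4 1 f = cr41 f" "vop lam 4 2 f = cr42 f"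
  "vop lam 1 2 f = zd lam f - cr32 (an31 f) - cr42 (an41 f)"
  "vop lam 2 1 f = zm f - cr31 (an32 f) - cr41 (an42 f)"
  "vop lam 3 4 f = wd lam f + cr31 (an41 f) + cr32 (an42 f)"
  "vop lam 4 3 f = wm f + cr41 (an31 f) + cr42 (an32 f)"
  "vop lam 1 3 f = dg lam 1 (an31 f) + dg lam 3 (an31 f) + zd lam (an32 f) + wm (an41 f) - cr42 (an41 (an32 f))"
  "vop lam 1 4 f = dg lam 1 (an41 f) + dg lam 4 (an41 f) + zd lam (an42 f) + wd lam (an31 f) - cr32 (an31 (an42 f))"
  "vop lam 2 3 f = dg lam 2 (an32 f) + dg lam 3 (an32 f) + zm (an31 f) + wm (an42 f) - cr41 (an42 (an31 f))"
  "vop lam 2 4 f = dg lam 2 (an42 f) + dg lam 4 (an42 f) + zm (an41 f) + wd lam (an32 f) - cr31 (an32 (an41 f))"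
  by (simp_all add: vop_def)

lemma dg_simps:
  "dg lam 1 f i j p q r s = (lam $ 1 - of_nat i - nb p - nb r) * f i j p q r s"
  "dg lam 2 f i j p q r s = (lam $ 2 + of_nat i - nb q - nb s) * f i j p q r s"
  "dg lam 3 f i j p q r s = (lam $ 3 - of_nat j + nb p + nb q) * f i j p q r s"
  "dg lam 4 f i j p q r s = (lam $ 4 + of_nat j + nb r + nb s) * f i j p q r s"
  by (simp_all add: dg_def wt_def)

section \<open>The bracket relations between the operators \<open>vop\<close>\<close>

lemma psign_simps: "psign i j k l = (if (i = 3 \<or> i = 4) \<noteq> (j = 3 \<or> j = 4) \<and> (k = 3 \<or> k = 4) \<noteq> (l = 3 \<or> l = 4) then -1 else 1)"
  by (auto simp: psign_def par_def)

text \<open>One bracket relation as a predicate, so that \<open>vrel_sym\<close> can halve the work: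
  of the 256 ordered pairs of matrix units, 136 unordered ones are computed.\<close>

definition vrel :: "weight \<Rightarrow> 4 \<Rightarrow> 4 \<Rightarrow> 4 \<Rightarrow> 4 \<Rightarrow> bool" where
  "vrel lam k l m n \<longleftrightarrow> (\<forall>f. vop lam k l (vop lam m n f) = vscale (psign k l m n) (vop lam m n (vop lam k l f))
      + (if l = m then vop lam k n f else 0) - vscale (psign k l m n) (if n = k then vop lam m l f else 0))"

lemma vrelI:
  assumes "\<And>f i j p q r s. vop lam k l (vop lam m n f) i j p q r s = (vscale (psign k l m n) (vop lam m n (vop lam k l f))
      + (if l = m then vop lam k n f else 0) - vscale (psign k l m n) (if n = k then vop lam m l f else 0)) i j p q r s"
  shows "vrel lam k l m n"
  unfolding vrel_def using assms by (intro allI ext)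

lemma psign_commute: "psign i j k l = psign k l i j"
  by (simp add: psign_def conj_commute)

text \<open>The sign is symmetric and equal to 1 or -1, so the relation can be solved for the
  product in the other order.\<close>

lemma vrel_sym: "vrel lam k l m n \<Longrightarrow> vrel lam m n k l"
proof -
  have "psign m n k l = psign k l m n" by (rule psign_commute)
  moreover have "psign k l m n = 1 \<or> psign k l m n = -1" by (simp add: psign_def)
  moreover assume "vrel lam k l m n"
  ultimately show ?thesis
    unfolding vrel_def by (elim disjE) (auto simp: fun_eq_iff split: if_splits)
qed

text \<open>Coefficients are compared. Splitting all flags and separating exponent zero from
  successors evaluates the operators; what remains are polynomial identities in the exponents, the
  coordinates of \<open>lam\<close> and the coefficients of \<open>f\<close>. The groups that follow
  are checked in the same way.\<close>

lemma vrel_14: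
  "vrel lam 1 4 1 4"
  "vrel lam 1 4 1 3"
  "vrel lam 1 4 2 4"
  "vrel lam 1 4 2 3"
  "vrel lam 1 4 1 2"
  "vrel lam 1 4 2 1"
  "vrel lam 1 4 3 4"
  "vrel lam 1 4 4 3"
  "vrel lam 1 4 3 1"
  "vrel lam 1 4 3 2"
  "vrel lam 1 4 4 1"
  "vrel lam 1 4 4 2"
  "vrel lam 1 4 1 1"
  "vrel lam 1 4 2 2"
  "vrel lam 1 4 3 3"
  "vrel lam 1 4 4 4"
  by (rule vrelI, case_tac i; case_tac j; case_tac p; case_tac q; case_tac r; case_tac s;
      simp add: vop_simps psign_simps zd_def wd_def dg_simps; simp add: algebra_simps)+

lemma vrel_13:
  "vrel lam 1 3 1 3"
  "vrel lam 1 3 2 4"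
  "vrel lam 1 3 2 3"
  "vrel lam 1 3 1 2"
  "vrel lam 1 3 2 1"
  "vrel lam 1 3 3 4"
  "vrel lam 1 3 4 3"
  "vrel lam 1 3 3 1"
  "vrel lam 1 3 3 2"
  "vrel lam 1 3 4 1"
  "vrel lam 1 3 4 2"
  "vrel lam 1 3 1 1"
  "vrel lam 1 3 2 2"
  "vrel lam 1 3 3 3"
  "vrel lam 1 3 4 4"
  by (rule vrelI, case_tac i; case_tac j; case_tac p; case_tac q; case_tac r; case_tac s;
      simp add: vop_simps psign_simps zd_def wd_def dg_simps; simp add: algebra_simps zm_def wm_def split: nat.split)+

lemma vrel_24:
  "vrel lam 2 4 2 4"
  "vrel lam 2 4 2 3"
  "vrel lam 2 4 1 2"
  "vrel lam 2 4 2 1"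
  "vrel lam 2 4 3 4"
  "vrel lam 2 4 4 3"
  "vrel lam 2 4 3 1"
  "vrel lam 2 4 3 2"
  "vrel lam 2 4 4 1"
  "vrel lam 2 4 4 2"
  "vrel lam 2 4 1 1"
  "vrel lam 2 4 2 2"
  "vrel lam 2 4 3 3"
  "vrel lam 2 4 4 4"
  by (rule vrelI, case_tac i; case_tac j; case_tac p; case_tac q; case_tac r; case_tac s;
      simp add: vop_simps psign_simps zd_def wd_def dg_simps; simp add: algebra_simps zm_def wm_def split: nat.split)+

lemma vrel_23:
  "vrel lam 2 3 2 3"
  "vrel lam 2 3 1 2"
  "vrel lam 2 3 2 1"
  "vrel lam 2 3 3 4"
  "vrel lam 2 3 4 3"
  "vrel lam 2 3 3 1"
  "vrel lam 2 3 3 2"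
  "vrel lam 2 3 4 1"
  "vrel lam 2 3 4 2"
  "vrel lam 2 3 1 1"
  "vrel lam 2 3 2 2"
  "vrel lam 2 3 3 3"
  "vrel lam 2 3 4 4"
  by (rule vrelI, case_tac i; case_tac j; case_tac p; case_tac q; case_tac r; case_tac s;
      simp add: vop_simps psign_simps zd_def wd_def dg_simps; simp add: algebra_simps zm_def wm_def split: nat.split)+

lemma vrel_12:
  "vrel lam 1 2 1 2"
  "vrel lam 1 2 2 1"
  "vrel lam 1 2 3 4"
  "vrel lam 1 2 4 3"
  "vrel lam 1 2 3 1"
  "vrel lam 1 2 3 2"
  "vrel lam 1 2 4 1"
  "vrel lam 1 2 4 2"
  "vrel lam 1 2 1 1"
  "vrel lam 1 2 2 2"
  "vrel lam 1 2 3 3"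
  "vrel lam 1 2 4 4"
  by (rule vrelI, case_tac i; case_tac j; case_tac p; case_tac q; case_tac r; case_tac s;
      simp add: vop_simps psign_simps zd_def wd_def dg_simps; simp add: algebra_simps)+

lemma vrel_21:
  "vrel lam 2 1 2 1"
  "vrel lam 2 1 3 4"
  "vrel lam 2 1 4 3"
  "vrel lam 2 1 3 1"
  "vrel lam 2 1 3 2"
  "vrel lam 2 1 4 1"
  "vrel lam 2 1 4 2"
  "vrel lam 2 1 1 1"
  "vrel lam 2 1 2 2"
  "vrel lam 2 1 3 3"
  "vrel lam 2 1 4 4"
  by (rule vrelI, case_tac i; case_tac j; case_tac p; case_tac q; case_tac r; case_tac s;
      simp add: vop_simps psign_simps zd_def wd_def dg_simps; simp add: algebra_simps)+

lemma vrel_34: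
  "vrel lam 3 4 3 4"
  "vrel lam 3 4 4 3"
  "vrel lam 3 4 3 1"
  "vrel lam 3 4 3 2"
  "vrel lam 3 4 4 1"
  "vrel lam 3 4 4 2"
  "vrel lam 3 4 1 1"
  "vrel lam 3 4 2 2"
  "vrel lam 3 4 3 3"
  "vrel lam 3 4 4 4"
  by (rule vrelI, case_tac i; case_tac j; case_tac p; case_tac q; case_tac r; case_tac s;
      simp add: vop_simps psign_simps zd_def wd_def dg_simps; simp add: algebra_simps)+

lemma vrel_43:
  "vrel lam 4 3 4 3"
  "vrel lam 4 3 3 1"
  "vrel lam 4 3 3 2"
  "vrel lam 4 3 4 1"
  "vrel lam 4 3 4 2"
  "vrel lam 4 3 1 1"
  "vrel lam 4 3 2 2"
  "vrel lam 4 3 3 3"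
  "vrel lam 4 3 4 4"
  by (rule vrelI, case_tac i; case_tac j; case_tac p; case_tac q; case_tac r; case_tac s;
      simp add: vop_simps psign_simps zd_def wd_def dg_simps; simp add: algebra_simps)+

lemma vrel_31:
  "vrel lam 3 1 3 1"
  "vrel lam 3 1 3 2"
  "vrel lam 3 1 4 1"
  "vrel lam 3 1 4 2"
  "vrel lam 3 1 1 1"
  "vrel lam 3 1 2 2"
  "vrel lam 3 1 3 3"
  "vrel lam 3 1 4 4"
  by (rule vrelI, case_tac i; case_tac j; case_tac p; case_tac q; case_tac r; case_tac s;
      simp add: vop_simps psign_simps zd_def wd_def dg_simps; simp add: algebra_simps)+

lemma vrel_32:
  "vrel lam 3 2 3 2"
  "vrel lam 3 2 4 1"
  "vrel lam 3 2 4 2"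
  "vrel lam 3 2 1 1"
  "vrel lam 3 2 2 2"
  "vrel lam 3 2 3 3"
  "vrel lam 3 2 4 4"
  by (rule vrelI, case_tac i; case_tac j; case_tac p; case_tac q; case_tac r; case_tac s;
      simp add: vop_simps psign_simps zd_def wd_def dg_simps; simp add: algebra_simps)+

lemma vrel_41:
  "vrel lam 4 1 4 1"
  "vrel lam 4 1 4 2"
  "vrel lam 4 1 1 1"
  "vrel lam 4 1 2 2"
  "vrel lam 4 1 3 3"
  "vrel lam 4 1 4 4"
  by (rule vrelI, case_tac i; case_tac j; case_tac p; case_tac q; case_tac r; case_tac s;
      simp add: vop_simps psign_simps zd_def wd_def dg_simps; simp add: algebra_simps)+

lemma vrel_42:
  "vrel lam 4 2 4 2"
  "vrel lam 4 2 1 1"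
  "vrel lam 4 2 2 2"
  "vrel lam 4 2 3 3"
  "vrel lam 4 2 4 4"
  by (rule vrelI, case_tac i; case_tac j; case_tac p; case_tac q; case_tac r; case_tac s;
      simp add: vop_simps psign_simps zd_def wd_def dg_simps; simp add: algebra_simps)+

lemma vrel_11:
  "vrel lam 1 1 1 1"
  "vrel lam 1 1 2 2"
  "vrel lam 1 1 3 3"
  "vrel lam 1 1 4 4"
  by (rule vrelI, case_tac i; case_tac j; case_tac p; case_tac q; case_tac r; case_tac s;
      simp add: vop_simps psign_simps zd_def wd_def dg_simps; simp add: algebra_simps)+

lemma vrel_22:
  "vrel lam 2 2 2 2"
  "vrel lam 2 2 3 3"
  "vrel lam 2 2 4 4"
  by (rule vrelI, case_tac i; case_tac j; case_tac p; case_tac q; case_tac r; case_tac s;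
      simp add: vop_simps psign_simps zd_def wd_def dg_simps; simp add: algebra_simps)+

lemma vrel_33:
  "vrel lam 3 3 3 3"
  "vrel lam 3 3 4 4"
  by (rule vrelI, case_tac i; case_tac j; case_tac p; case_tac q; case_tac r; case_tac s;
      simp add: vop_simps psign_simps zd_def wd_def dg_simps; simp add: algebra_simps)+

lemma vrel_44:
  "vrel lam 4 4 4 4"
  by (rule vrelI, case_tac i; case_tac j; case_tac p; case_tac q; case_tac r; case_tac s;
      simp add: vop_simps psign_simps zd_def wd_def dg_simps; simp add: algebra_simps)+

lemma vrel_all: "vrel lam k l m n"
proof -
  note v = vrel_14 vrel_13 vrel_24 vrel_23 vrel_12 vrel_21 vrel_34 vrel_43 vrel_31 vrel_32 vrel_41 vrel_42 vrel_11 vrel_22 vrel_33 vrel_44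
  have "\<forall>k l m n. vrel lam k l m n"
    by (simp only: forall_4 v v[THEN vrel_sym] simp_thms)
  then show ?thesis by blast
qed

lemma vop_bracket:
  "vop lam k l (vop lam m n f) = vscale (psign k l m n) (vop lam m n (vop lam k l f))
      + (if l = m then vop lam k n f else 0) - vscale (psign k l m n) (if n = k then vop lam m l f else 0)"
  using vrel_all[of lam k l m n] unfolding vrel_def by blast

interpretation vs: vector_space vscale
  by unfold_locales (simp_all add: vscale_def fun_eq_iff algebra_simps)

lemma op_add:
  "cr31 (f + g) = cr31 f + cr31 g"
  "an31 (f + g) = an31 f + an31 g"
  "cr32 (f + g) = cr32 f + cr32 g"
  "an32 (f + g) = an32 f + an32 g"
  "cr41 (f + g) = cr41 f + cr41 g"
  "an41 (f + g) = an41 f + an41 g"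
  "cr42 (f + g) = cr42 f + cr42 g"
  "an42 (f + g) = an42 f + an42 g"
  "zm (f + g) = zm f + zm g"
  "wm (f + g) = wm f + wm g"
  "zd lam (f + g) = zd lam f + zd lam g"
  "wd lam (f + g) = wd lam f + wd lam g"
  "dg lam k (f + g) = dg lam k f + dg lam k g"
  by (rule ext, rule ext, rule ext, rule ext, rule ext, rule ext,
    simp add: cr31_def an31_def cr32_def an32_def cr41_def an41_def cr42_def an42_def
      zm_def wm_def zd_def wd_def dg_def algebra_simps split: nat.split)+

lemma op_scale:
  "cr31 (vscale c f) = vscale c (cr31 f)"
  "an31 (vscale c f) = vscale c (an31 f)"
  "cr32 (vscale c f) = vscale c (cr32 f)"
  "an32 (vscale c f) = vscale c (an32 f)"
  "cr41 (vscale c f) = vscale c (cr41 f)"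
  "an41 (vscale c f) = vscale c (an41 f)"
  "cr42 (vscale c f) = vscale c (cr42 f)"
  "an42 (vscale c f) = vscale c (an42 f)"
  "zm (vscale c f) = vscale c (zm f)"
  "wm (vscale c f) = vscale c (wm f)"
  "zd lam (vscale c f) = vscale c (zd lam f)"
  "wd lam (vscale c f) = vscale c (wd lam f)"
  "dg lam k (vscale c f) = vscale c (dg lam k f)"
  by (rule ext, rule ext, rule ext, rule ext, rule ext, rule ext,
    simp add: cr31_def an31_def cr32_def an32_def cr41_def an41_def cr42_def an42_def
      zm_def wm_def zd_def wd_def dg_def split: nat.split)+

lemma vop_add: "vop lam k l (f + g) = vop lam k l f + vop lam k l g"
  by (simp add: vop_def op_add)

lemma vop_scale: "vop lam k l (vscale c f) = vscale c (vop lam k l f)"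
  by (simp add: vop_def op_scale vs.scale_right_distrib vs.scale_right_diff_distrib)

lemma vop_zero: "vop lam k l 0 = 0"
  using vop_add[of lam k l 0 0] by simp

lemma vop_sum: "vop lam k l (sum f A) = (\<Sum>a\<in>A. vop lam k l (f a))"
  by (induction A rule: infinite_finite_induct) (simp_all only: sum.infinite sum.empty sum.insert vop_zero vop_add not_False_eq_True)

section \<open>The action of arbitrary matrices on the model\<close>

definition vact :: "weight \<Rightarrow> gl22 \<Rightarrow> vfun \<Rightarrow> vfun" where
  "vact lam x f = (\<Sum>i\<in>UNIV. \<Sum>j\<in>UNIV. vscale (x $ i $ j) (vop lam i j f))"

lemma vact_munit [simp]: "vact lam (munit k l) f = vop lam k l f"
proof -
  have "vact lam (munit k l) f = (\<Sum>i\<in>UNIV. \<Sum>j\<in>UNIV. if l = j then if k = i then vop lam k l f else 0 else 0)"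
    unfolding vact_def by (intro sum.cong refl) simp
  then show ?thesis by simp
qed

lemma vact_smul: "vact lam (smul c x) f = vscale c (vact lam x f)"
  by (simp add: vact_def vs.scale_sum_right)

lemma vact_diff: "vact lam (x - y) f = vact lam x f - vact lam y f"
  by (simp add: vact_def sum_subtractf vs.scale_left_diff_distrib)

lemma vact_vact: 
  "vact lam x (vact lam y f) = (\<Sum>i\<in>UNIV. \<Sum>j\<in>UNIV. \<Sum>k\<in>UNIV. \<Sum>l\<in>UNIV. 
     vscale (x $ i $ j * y $ k $ l) (vop lam i j (vop lam k l f)))"
  by (simp add: vact_def vop_sum vop_scale vs.scale_sum_right)

lemma vact_mult:
  "vact lam (x ** y) f = (\<Sum>i\<in>UNIV. \<Sum>j\<in>UNIV. \<Sum>k\<in>UNIV. \<Sum>l\<in>UNIV. 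
     vscale (x $ i $ j * y $ k $ l) (if j = k then vop lam i l f else 0))"
proof -
  have "(\<Sum>j\<in>UNIV. \<Sum>k\<in>UNIV. \<Sum>l\<in>UNIV. vscale (x $ i $ j * y $ k $ l) (if j = k then vop lam i l f else 0))
     = (\<Sum>l\<in>UNIV. vscale ((x ** y) $ i $ l) (vop lam i l f))" for i
  proof -
    have "(\<Sum>j\<in>UNIV. \<Sum>k\<in>UNIV. \<Sum>l\<in>UNIV. vscale (x $ i $ j * y $ k $ l) (if j = k then vop lam i l f else 0))
      = (\<Sum>j\<in>UNIV. \<Sum>k\<in>UNIV. if j = k then (\<Sum>l\<in>UNIV. vscale (x $ i $ j * y $ k $ l) (vop lam i l f)) else 0)"
      by (intro sum.cong refl) simp
    also have "\<dots> = (\<Sum>j\<in>UNIV. \<Sum>l\<in>UNIV. vscale (x $ i $ j * y $ j $ l) (vop lam i l f))" by simp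
    also have "\<dots> = (\<Sum>l\<in>UNIV. \<Sum>j\<in>UNIV. vscale (x $ i $ j * y $ j $ l) (vop lam i l f))" by (rule sum.swap)
    finally show ?thesis by (simp add: matrix_matrix_mult_def vs.scale_sum_left)
  qed
  then show ?thesis by (simp add: vact_def)
qed

lemma sum3_swap:
  "(\<Sum>j\<in>B. \<Sum>k\<in>C. \<Sum>l\<in>D. g j k l) = (\<Sum>k\<in>C. \<Sum>l\<in>D. \<Sum>j\<in>B. (g j k l :: 'a::comm_monoid_add))"
  by (subst sum.swap) (intro sum.cong refl sum.swap)

lemma sum4_swap:
  "(\<Sum>i\<in>A. \<Sum>j\<in>B. \<Sum>k\<in>C. \<Sum>l\<in>D. h i j k l) = (\<Sum>k\<in>C. \<Sum>l\<in>D. \<Sum>i\<in>A. \<Sum>j\<in>B. (h i j k l :: 'a::comm_monoid_add))"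
  by (simp only: sum3_swap[of _ D C B] sum3_swap[of _ D C A])

lemma vact_bracket:
  assumes "x \<in> gl_part p" "y \<in> gl_part q" "p < 2" "q < 2"
  shows "vact lam x (vact lam y f) = vscale ((-1) ^ (p * q)) (vact lam y (vact lam x f)) + vact lam (sbracket x y) f"
proof -
  let ?s = "(-1) ^ (p * q) :: complex"
  let ?D = "\<lambda>i j k l. vscale (x $ i $ j * y $ k $ l)"
  \<comment> \<open>Homogeneity enters here: where the product of entries is nonzero, the two matrix
    units have the parities of \<open>x\<close> and \<open>y\<close>, so a single sign serves all
    terms.\<close>
  have sgn: "x $ i $ j * y $ k $ l = 0 \<or> psign i j k l = ?s" for i j k l
  proof (cases "x $ i $ j = 0 \<or> y $ k $ l = 0")
    case False
    then have "p = (par i + par j) mod 2" "q = (par k + par l) mod 2"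
      using assms(1,2) by (auto simp: gl_part_def)
    then have "psign i j k l = ?s" by (auto simp: psign_def par_def)
    then show ?thesis ..
  qed auto
  have "?D i j k l (vop lam i j (vop lam k l f)) = 
      vscale ?s (?D i j k l (vop lam k l (vop lam i j f))) + ?D i j k l (if j = k then vop lam i l f else 0)
      - vscale ?s (?D i j k l (if l = i then vop lam k j f else 0))" for i j k l
    using sgn[of i j k l]
  proof
    assume "x $ i $ j * y $ k $ l = 0"
    then show ?thesis by (simp only: vs.scale_zero_left vs.scale_zero_right add_0 diff_self)
  next
    assume h: "psign i j k l = ?s"
    show ?thesis
      by (simp only: vop_bracket[of lam i j k l] h vs.scale_right_distrib vs.scale_right_diff_distrib
          vs.scale_left_commute[of ?s])
  qed
  then have "vact lam x (vact lam y f) = vscale ?s (\<Sum>i\<in>UNIV. \<Sum>j\<in>UNIV. \<Sum>k\<in>UNIV. \<Sum>l\<in>UNIV. ?D i j k l (vop lam k l (vop lam i j f)))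
     + vact lam (x ** y) f - vscale ?s (\<Sum>i\<in>UNIV. \<Sum>j\<in>UNIV. \<Sum>k\<in>UNIV. \<Sum>l\<in>UNIV. ?D i j k l (if l = i then vop lam k j f else 0))"
    unfolding vact_vact vact_mult by (simp only: sum.distrib sum_subtractf vs.scale_sum_right)
  also have "(\<Sum>i\<in>UNIV. \<Sum>j\<in>UNIV. \<Sum>k\<in>UNIV. \<Sum>l\<in>UNIV. ?D i j k l (vop lam k l (vop lam i j f))) = vact lam y (vact lam x f)"
    unfolding vact_vact by (subst sum4_swap) (simp only: mult.commute)
  also have "(\<Sum>i\<in>UNIV. \<Sum>j\<in>UNIV. \<Sum>k\<in>UNIV. \<Sum>l\<in>UNIV. ?D i j k l (if l = i then vop lam k j f else 0)) = vact lam (y ** x) f"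
    unfolding vact_mult by (subst sum4_swap) (simp only: mult.commute)
  finally show ?thesis
    unfolding sbracket_homogeneous[OF assms] vact_diff vact_smul by (simp only: add_diff_eq)
qed

lemma vact_add: "vact lam x (f + g) = vact lam x f + vact lam x g"
  by (simp only: vact_def vop_add vs.scale_right_distrib sum.distrib)

lemma vact_scale: "vact lam x (vscale c f) = vscale c (vact lam x f)"
  by (simp only: vact_def vop_scale vs.scale_sum_right vs.scale_left_commute[of c])

lemma vact_expand: "vact lam x f = (\<Sum>i\<in>UNIV. \<Sum>j\<in>UNIV. vscale (x $ i $ j) (vact lam (munit i j) f))"
  by (simp only: vact_munit) (simp only: vact_def)

interpretation v: gl_rep vscale "vact lam" for lam
  by unfold_locales (rule vact_add vact_scale vact_expand vact_bracket; assumption?)+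

section \<open>The highest weight vector and the map from the enveloping algebra to the
  model\<close>

type_synonym vidx = "nat \<times> nat \<times> bool \<times> bool \<times> bool \<times> bool"

definition vb :: "vidx \<Rightarrow> vfun" where
  "vb t i j p q r s = (if t = (i, j, p, q, r, s) then 1 else 0)"

abbreviation v0 :: vfun where "v0 \<equiv> vb (0, 0, False, False, False, False)"

lemma axis_diff_eq_iff:
  assumes "i \<noteq> j"
  shows "axis i (1::complex) - axis j 1 = axis k 1 - axis l 1 \<longleftrightarrow> i = k \<and> j = l"
proof
  assume *: "axis i (1::complex) - axis j 1 = axis k 1 - axis l 1"
  from arg_cong[OF this, of "\<lambda>v. v $ i"] arg_cong[OF this, of "\<lambda>v. v $ j"] assms
  show "i = k \<and> j = l" by (auto simp: axis_def split: if_splits)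
qed auto

lemma borel_sub_iff:
  "b \<in> borel_sub \<longleftrightarrow> b $ 2 $ 1 = 0 \<and> b $ 3 $ 1 = 0 \<and> b $ 3 $ 2 = 0 \<and> b $ 4 $ 1 = 0 \<and> b $ 4 $ 2 = 0 \<and> b $ 4 $ 3 = 0"
proof -
  have "i \<noteq> j \<and> axis i 1 - axis j 1 \<notin> pos_even_roots \<union> pos_odd_roots \<longleftrightarrow>
      (i, j) \<in> {(2,1), (3,1), (3,2), (4,1), (4,2), (4,3)}" for i j :: 4
  proof (cases "i = j")
    case False
    have "axis i (1::complex) - axis j 1 \<in> pos_even_roots \<union> pos_odd_roots \<longleftrightarrow>
      (i, j) \<in> {(1,2), (3,4), (1,3), (1,4), (2,3), (2,4)}"
      by (simp only: pos_even_roots_def pos_odd_roots_def axis_diff_eq_iff[OF False] Un_iff insert_iff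
        empty_iff prod.inject) blast
    then show ?thesis
      using False exhaust_4[of i] exhaust_4[of j] by (elim disjE) simp_all
  qed auto
  then show ?thesis
    unfolding borel_sub_def by simp blast
qed

lemma op_zero:
  "cr31 0 = 0"
  "an31 0 = 0"
  "cr32 0 = 0"
  "an32 0 = 0"
  "cr41 0 = 0"
  "an41 0 = 0"
  "cr42 0 = 0"
  "an42 0 = 0"
  "zm 0 = 0"
  "wm 0 = 0"
  "zd lam 0 = 0"
  "wd lam 0 = 0"
  "dg lam k 0 = 0"
  by (rule ext, rule ext, rule ext, rule ext, rule ext, rule ext,
    simp add: cr31_def an31_def cr32_def an32_def cr41_def an41_def cr42_def an42_def
      zm_def wm_def zd_def wd_def dg_def split: nat.split)+

lemma op_vb_zero:
  "an31 (vb (i, j, False, q, r, s)) = 0" "an32 (vb (i, j, p, False, r, s)) = 0"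
  "an41 (vb (i, j, p, q, False, s)) = 0" "an42 (vb (i, j, p, q, r, False)) = 0"
  "zd lam (vb (0, j, p, q, r, s)) = 0" "wd lam (vb (i, 0, p, q, r, s)) = 0"
  by (rule ext, rule ext, rule ext, rule ext, rule ext, rule ext,
    simp add: an31_def an32_def an41_def an42_def zd_def wd_def vb_def)+

lemma op_vb:
  "zm (vb (i, j, p, q, r, s)) = vb (Suc i, j, p, q, r, s)"
  "wm (vb (i, j, p, q, r, s)) = vb (i, Suc j, p, q, r, s)"
  "cr42 (vb (i, j, False, False, False, False)) = vb (i, j, False, False, False, True)"
  "cr41 (vb (i, j, False, False, False, s)) = vb (i, j, False, False, True, s)"
  "cr32 (vb (i, j, False, False, r, s)) = vb (i, j, False, True, r, s)"
  "cr31 (vb (i, j, False, q, r, s)) = vb (i, j, True, q, r, s)"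
  by (rule ext, rule ext, rule ext, rule ext, rule ext, rule ext,
    simp add: cr31_def cr32_def cr41_def cr42_def zm_def wm_def vb_def sg_def split: nat.split)+

lemma dg_vb: "dg lam k (vb (i, j, p, q, r, s)) = vscale (wt lam k i j p q r s) (vb (i, j, p, q, r, s))"
  by (rule ext, rule ext, rule ext, rule ext, rule ext, rule ext, simp add: dg_def vb_def)

lemma vop_v0:
  "vop lam k k v0 = vscale (lam $ k) v0" 
  "vop lam 1 2 v0 = 0" "vop lam 3 4 v0 = 0" "vop lam 1 3 v0 = 0"
  "vop lam 1 4 v0 = 0" "vop lam 2 3 v0 = 0" "vop lam 2 4 v0 = 0"
  using exhaust_4[of k] by (auto simp only: vop_simps dg_vb op_vb_zero op_zero add_0 diff_self wt_def of_nat_0 nb_simps diff_0_right add_0_right if_True if_False zero_neq_one) simp_all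

lemma vact_v0: "b \<in> borel_sub \<Longrightarrow> vact lam b v0 = vscale (weight_at lam b) v0"
  by (simp add: vact_def sum_4 borel_sub_iff vop_v0 weight_at_def vs.scale_left_distrib mult.commute)

text \<open>This map kills \<open>verma_rel lam\<close>. With \<open>vmap_eq_zero_iff\<close> and
  \<open>vfin_eq_range\<close> it identifies the Verma module with \<open>vfin\<close>.\<close>

definition vmap :: "weight \<Rightarrow> env_gl22 \<Rightarrow> vfun" where
  "vmap lam u = v.env_act lam u v0"

lemma vmap_verma_rel: "u \<in> verma_rel lam \<Longrightarrow> vmap lam u = 0"
  unfolding vmap_def by (rule v.env_act_verma_rel[OF vact_v0])

lemma vmap_simps:
  "vmap lam (u + u') = vmap lam u + vmap lam u'"
  "vmap lam (u - u') = vmap lam u - vmap lam u'"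
  "vmap lam (env_of x * u) = vact lam x (vmap lam u)"
  "vmap lam (env_scalar c * u) = vscale c (vmap lam u)"
  "vmap lam 1 = v0"
  by (simp_all add: vmap_def v.env_act_plus v.env_act_minus v.env_act_times v.env_act_env_of v.env_act_scalar)

lemma vmap_zero: "vmap lam 0 = 0"
  by (simp add: vmap_def v.env_act_zero)

definition opt :: "bool \<Rightarrow> env_gl22 \<Rightarrow> env_gl22 \<Rightarrow> env_gl22" where
  "opt b x u = (if b then x * u else u)"

lemma opt_simps [simp]: "opt True x u = x * u" "opt False x u = u"
  by (simp_all add: opt_def)

text \<open>The ordered Poincare-Birkhoff-Witt monomials. The odd factors stand in the order that
  fixes the signs of \<open>cr31\<close> to \<open>cr42\<close>, so that \<open>vmap_mon\<close>
  holds without signs.\<close>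

fun mon :: "vidx \<Rightarrow> env_gl22" where
  "mon (i, j, p, q, r, s) = opt p (eu 3 1) (opt q (eu 3 2) (opt r (eu 4 1) (opt s (eu 4 2) (eu 2 1 ^ i * eu 4 3 ^ j))))"

lemma vop_vb:
  "vop lam 4 3 (vb (0, j, False, False, False, False)) = vb (0, Suc j, False, False, False, False)"
  "vop lam 2 1 (vb (i, j, False, False, False, False)) = vb (Suc i, j, False, False, False, False)"
  "vop lam 4 2 (vb (i, j, False, False, False, False)) = vb (i, j, False, False, False, True)"
  "vop lam 4 1 (vb (i, j, False, False, False, s)) = vb (i, j, False, False, True, s)"
  "vop lam 3 2 (vb (i, j, False, False, r, s)) = vb (i, j, False, True, r, s)"
  "vop lam 3 1 (vb (i, j, False, q, r, s)) = vb (i, j, True, q, r, s)"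
  by (simp_all only: vop_simps op_vb op_vb_zero op_zero diff_self diff_0_right add_0_right)

lemma vmap_mon: "vmap lam (mon t) = vb t"
proof -
  have w: "vmap lam (eu 4 3 ^ j) = vb (0, j, False, False, False, False)" for j
    by (induction j) (simp_all add: vmap_simps vop_vb)
  have zw: "vmap lam (eu 2 1 ^ i * eu 4 3 ^ j) = vb (i, j, False, False, False, False)" for i j
    by (induction i) (simp_all add: vmap_simps vop_vb w mult.assoc)
  have o: "vmap lam (opt b (env_of x) u) = (if b then vact lam x (vmap lam u) else vmap lam u)" for b x u
    by (simp add: opt_def vmap_simps)
  show ?thesis
    by (cases t) (simp add: o zw vop_vb)
qed

text \<open>Finite support: bounding the two exponents suffices because the flags take finitely many
  values.\<close>

definition vfin :: "vfun set" where
  "vfin = {f. \<exists>n. \<forall>i j p q r s. n \<le> i \<or> n \<le> j \<longrightarrow> f i j p q r s = 0}"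

definition vbox :: "nat \<Rightarrow> vidx set" where
  "vbox n = {..<n} \<times> {..<n} \<times> UNIV \<times> UNIV \<times> UNIV \<times> UNIV"

lemma finite_vbox [simp]: "finite (vbox n)" by (simp add: vbox_def)

text \<open>The candidate inverse of \<open>vmap\<close>. The sum needs a finite range, hence the
  box of size \<open>n\<close>; all boxes containing the support give the same element.\<close>

definition psi :: "nat \<Rightarrow> vfun \<Rightarrow> env_gl22" where
  "psi n f = (\<Sum>(i, j, p, q, r, s)\<in>vbox n. env_scalar (f i j p q r s) * mon (i, j, p, q, r, s))"

lemma psi_add: "psi n (f + g) = psi n f + psi n g"
  by (simp add: psi_def split_def env_scalar_add distrib_right sum.distrib)

lemma psi_zero [simp]: "psi n 0 = 0"
  by (simp add: psi_def split_def)

lemma psi_aux: "(case t' of (i, j, p, q, r, s) \<Rightarrow> env_scalar (vscale c (vb t) i j p q r s) * mon (i, j, p, q, r, s)) =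
    (if t = t' then env_scalar c * mon t else 0)"
  by (cases t') (simp add: vb_def del: mon.simps)

lemma psi_vb:
  assumes "t \<in> vbox n"
  shows "psi n (vscale c (vb t)) = env_scalar c * mon t"
proof -
  have "psi n (vscale c (vb t)) = (\<Sum>t'\<in>vbox n. if t = t' then env_scalar c * mon t else 0)"
    unfolding psi_def by (intro sum.cong refl) (rule psi_aux)
  then show ?thesis using assms by simp
qed

lemma vmap_sum: "vmap lam (sum f A) = (\<Sum>a\<in>A. vmap lam (f a))"
  by (induction A rule: infinite_finite_induct) (simp_all only: sum.infinite sum.empty sum.insert vmap_simps vmap_zero not_False_eq_True)

lemma sum_vfun_apply: "(sum f A :: vfun) i j p q r s = (\<Sum>a\<in>A. f a i j p q r s)"
  by (induction A rule: infinite_finite_induct) auto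

lemma vmap_psi:
  assumes "\<And>i j p q r s. n \<le> i \<or> n \<le> j \<Longrightarrow> f i j p q r s = 0"
  shows "vmap lam (psi n f) = f"
proof -
  have "vmap lam (psi n f) = (\<Sum>(i, j, p, q, r, s)\<in>vbox n. vscale (f i j p q r s) (vb (i, j, p, q, r, s)))"
    by (simp only: psi_def vmap_sum split_def vmap_simps vmap_mon)
  also have "\<dots> = f"
  proof (intro ext)
    fix i j p q r s
    have "(\<Sum>(i, j, p, q, r, s)\<in>vbox n. vscale (f i j p q r s) (vb (i, j, p, q, r, s))) i j p q r s =
      (\<Sum>t\<in>vbox n. if t = (i, j, p, q, r, s) then f i j p q r s else 0)"
      unfolding sum_vfun_apply by (intro sum.cong refl) (auto simp: vb_def split: prod.splits)
    also have "\<dots> = f i j p q r s" using assms[of i j] by (auto simp: vbox_def not_less)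
    finally show "(\<Sum>(i, j, p, q, r, s)\<in>vbox n. vscale (f i j p q r s) (vb (i, j, p, q, r, s))) i j p q r s = f i j p q r s" .
  qed
  finally show ?thesis .
qed

section \<open>The Poincare-Birkhoff-Witt basis of the Verma module\<close>

text \<open>The first of two spanning statements: modulo the relations, words in the lowering matrix
  units suffice, in any order. Putting the words in order is left to \<open>pbw\<close>.\<close>

inductive_set lspan :: "weight \<Rightarrow> env_gl22 set" for lam where
  rel: "u \<in> verma_rel lam \<Longrightarrow> u \<in> lspan lam"
| one: "1 \<in> lspan lam"
| add: "u \<in> lspan lam \<Longrightarrow> v \<in> lspan lam \<Longrightarrow> u + v \<in> lspan lam"
| scalar: "u \<in> lspan lam \<Longrightarrow> env_scalar c * u \<in> lspan lam"
| lower: "u \<in> lspan lam \<Longrightarrow> (k, l) \<in> {(2,1), (4,3), (3,1), (3,2), (4,1), (4,2)} \<Longrightarrow> eu k l * u \<in> lspan lam"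

lemma lspan_uminus: "u \<in> lspan lam \<Longrightarrow> - u \<in> lspan lam"
  using lspan.scalar[of u lam "-1"] by (simp add: env_scalar_minus)

lemma lspan_diff: "u \<in> lspan lam \<Longrightarrow> v \<in> lspan lam \<Longrightarrow> u - v \<in> lspan lam"
  using lspan.add[of u lam "- v"] lspan_uminus by simp

lemma lspan_zero: "0 \<in> lspan lam"
  by (simp add: lspan.rel verma_rel.zero)

text \<open>Commuting a raising or diagonal matrix unit past a lowering one leaves a single matrix unit
  acting on a shorter word.\<close>

lemma eu_mult_lspan: "u \<in> lspan lam \<Longrightarrow> eu i j * u \<in> lspan lam"
proof (induction arbitrary: i j rule: lspan.induct)
  case (rel u)
  then show ?case by (intro lspan.rel verma_rel_mult_left)
next
  case one
  show ?case
  proof (cases "(i, j) \<in> {(2,1), (4,3), (3,1), (3,2), (4,1), (4,2)}")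
    case True
    then show ?thesis by (intro lspan.lower lspan.one)
  next
    case False
    \<comment> \<open>A matrix unit that is not lowering is upper triangular, so it acts on the
      generator by a scalar.\<close>
    then have "munit i j \<in> borel_sub"
      using exhaust_4[of i] exhaust_4[of j] by (elim disjE) (simp_all add: borel_sub_iff)
    from verma_rel.rel[OF this, of 1 lam]
    have "eu i j - env_scalar (weight_at lam (munit i j)) \<in> lspan lam"
      by (simp add: lspan.rel)
    from lspan.add[OF this lspan.scalar[OF lspan.one, of "weight_at lam (munit i j)"]]
    show ?thesis by simp
  qed
next
  case (add u v)
  then show ?case by (simp add: distrib_left lspan.add)
next
  case (scalar u c)
  then show ?case by (subst env_scalar_left_commute) (rule lspan.scalar)
next
  case (lower u k l)
  let ?s = "if par i \<noteq> par j \<and> par k \<noteq> par l then -1 else 1 :: env_gl22"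
  have s: "?s * v \<in> lspan lam" if "v \<in> lspan lam" for v
    using that by (simp add: lspan_uminus)
  have "eu i j * (eu k l * u) = ?s * (eu k l * (eu i j * u)) + (if j = k then eu i l else 0) * u
      - ?s * ((if l = i then eu k j else 0) * u)"
    unfolding mult.assoc[of "eu i j" "eu k l" u, symmetric] by (subst eu_bracket) (simp only: distrib_right left_diff_distrib mult.assoc)
  also have "\<dots> \<in> lspan lam"
    by (intro lspan_diff lspan.add s lspan.lower lower) (simp_all add: lower lspan_zero)
  finally show ?case .
qed

lemma lspan_UNIV: "u \<in> lspan lam"
  by (induction u rule: env_induct)
    (use lspan.scalar[OF lspan.one] in \<open>auto intro: lspan.add eu_mult_lspan\<close>)

inductive_set pbw :: "weight \<Rightarrow> env_gl22 set" for lam where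
  rel: "u \<in> verma_rel lam \<Longrightarrow> u \<in> pbw lam"
| mon: "env_scalar c * mon t \<in> pbw lam"
| add: "u \<in> pbw lam \<Longrightarrow> v \<in> pbw lam \<Longrightarrow> u + v \<in> pbw lam"

lemma pbw_scalar: "u \<in> pbw lam \<Longrightarrow> env_scalar c * u \<in> pbw lam"
  by (induction rule: pbw.induct)
    (auto intro: pbw.intros verma_rel_mult_left simp: distrib_left env_scalar_mult[symmetric] mult.assoc[symmetric]
      simp del: mon.simps)

lemma pbw_uminus: "u \<in> pbw lam \<Longrightarrow> - u \<in> pbw lam"
  using pbw_scalar[of u lam "-1"] by (simp add: env_scalar_minus)

lemma pbw_diff: "u \<in> pbw lam \<Longrightarrow> v \<in> pbw lam \<Longrightarrow> u - v \<in> pbw lam"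
  using pbw.add[of u lam "- v"] pbw_uminus by simp

text \<open>The bracket of an odd element with itself is twice its square, and it vanishes here
  because \<open>i \<noteq> j\<close>. Multiplication by the scalar 1/2 removes the factor.\<close>

lemma eu_odd_square:
  assumes "par i \<noteq> par j"
  shows "eu i j * eu i j = 0"
proof -
  have "i \<noteq> j" using assms by auto
  then have "eu i j * eu i j = - (eu i j * eu i j)"
    using eu_bracket[of i j i j] assms by simp
  then have "eu i j * eu i j + eu i j * eu i j = 0" by (metis add.left_inverse)
  then have "env_scalar 2 * (eu i j * eu i j) = 0"
    using env_scalar_add[of 1 1] by (simp add: mult_2)
  then have "env_scalar (1/2 * 2) * (eu i j * eu i j) = 0"
    by (simp only: env_scalar_mult mult.assoc mult_zero_right)
  then show ?thesis by simp
qed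

text \<open>A rewriting system that moves factors into the order \<open>31\<close>,
  \<open>32\<close>, \<open>41\<close>, \<open>42\<close>, \<open>21\<close>, \<open>43\<close>. The
  primed rules carry a trailing factor and so apply inside products nested to the right.\<close>

lemma eu_lower_rules:
  "eu 3 1 * eu 3 1 = 0" "eu 3 2 * eu 3 2 = 0" "eu 4 1 * eu 4 1 = 0" "eu 4 2 * eu 4 2 = 0"
  "eu 3 2 * eu 3 1 = - (eu 3 1 * eu 3 2)" "eu 4 1 * eu 3 1 = - (eu 3 1 * eu 4 1)"
  "eu 4 2 * eu 3 1 = - (eu 3 1 * eu 4 2)" "eu 4 1 * eu 3 2 = - (eu 3 2 * eu 4 1)"
  "eu 4 2 * eu 3 2 = - (eu 3 2 * eu 4 2)" "eu 4 2 * eu 4 1 = - (eu 4 1 * eu 4 2)"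
  "eu 2 1 * eu 3 1 = eu 3 1 * eu 2 1" "eu 2 1 * eu 3 2 = eu 3 2 * eu 2 1 - eu 3 1"
  "eu 2 1 * eu 4 1 = eu 4 1 * eu 2 1" "eu 2 1 * eu 4 2 = eu 4 2 * eu 2 1 - eu 4 1"
  "eu 4 3 * eu 3 1 = eu 3 1 * eu 4 3 + eu 4 1" "eu 4 3 * eu 3 2 = eu 3 2 * eu 4 3 + eu 4 2"
  "eu 4 3 * eu 4 1 = eu 4 1 * eu 4 3" "eu 4 3 * eu 4 2 = eu 4 2 * eu 4 3"
  "eu 4 3 * eu 2 1 = eu 2 1 * eu 4 3"
  by (simp_all add: eu_odd_square par_def) (subst eu_bracket, simp add: par_def)+

lemma eu_lower_rules':
  "eu 3 1 * (eu 3 1 * u) = 0" "eu 3 2 * (eu 3 2 * u) = 0" "eu 4 1 * (eu 4 1 * u) = 0" "eu 4 2 * (eu 4 2 * u) = 0"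
  "eu 3 2 * (eu 3 1 * u) = - (eu 3 1 * (eu 3 2 * u))" "eu 4 1 * (eu 3 1 * u) = - (eu 3 1 * (eu 4 1 * u))"
  "eu 4 2 * (eu 3 1 * u) = - (eu 3 1 * (eu 4 2 * u))" "eu 4 1 * (eu 3 2 * u) = - (eu 3 2 * (eu 4 1 * u))"
  "eu 4 2 * (eu 3 2 * u) = - (eu 3 2 * (eu 4 2 * u))" "eu 4 2 * (eu 4 1 * u) = - (eu 4 1 * (eu 4 2 * u))"
  "eu 2 1 * (eu 3 1 * u) = eu 3 1 * (eu 2 1 * u)" "eu 2 1 * (eu 3 2 * u) = eu 3 2 * (eu 2 1 * u) - eu 3 1 * u"
  "eu 2 1 * (eu 4 1 * u) = eu 4 1 * (eu 2 1 * u)" "eu 2 1 * (eu 4 2 * u) = eu 4 2 * (eu 2 1 * u) - eu 4 1 * u"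
  "eu 4 3 * (eu 3 1 * u) = eu 3 1 * (eu 4 3 * u) + eu 4 1 * u" "eu 4 3 * (eu 3 2 * u) = eu 3 2 * (eu 4 3 * u) + eu 4 2 * u"
  "eu 4 3 * (eu 4 1 * u) = eu 4 1 * (eu 4 3 * u)" "eu 4 3 * (eu 4 2 * u) = eu 4 2 * (eu 4 3 * u)"
  unfolding mult.assoc[symmetric] eu_lower_rules by (simp_all add: algebra_simps)

lemma eu_even_mon:
  "eu 2 1 * (eu 2 1 ^ i * eu 4 3 ^ j) = eu 2 1 ^ Suc i * eu 4 3 ^ j"
  "eu 4 3 * (eu 2 1 ^ i * eu 4 3 ^ j) = eu 2 1 ^ i * eu 4 3 ^ Suc j"
proof -
  have "eu 4 3 * eu 2 1 ^ i = eu 2 1 ^ i * eu 4 3"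
  proof (induction i)
    case (Suc i)
    have "eu 4 3 * eu 2 1 ^ Suc i = eu 4 3 * eu 2 1 * eu 2 1 ^ i" by (simp add: mult.assoc)
    also have "\<dots> = eu 2 1 * (eu 4 3 * eu 2 1 ^ i)" by (simp add: eu_lower_rules mult.assoc)
    finally show ?case by (simp add: Suc mult.assoc)
  qed simp
  then have "eu 4 3 * eu 2 1 ^ i * eu 4 3 ^ j = eu 2 1 ^ i * eu 4 3 * eu 4 3 ^ j" by simp
  then show "eu 4 3 * (eu 2 1 ^ i * eu 4 3 ^ j) = eu 2 1 ^ i * eu 4 3 ^ Suc j"
    by (simp add: mult.assoc)
qed (simp add: mult.assoc)

lemma pbw_mon: "mon t \<in> pbw lam"
  using pbw.mon[of 1 t lam] by simp

lemma lower_mon_pbw: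
  assumes "(k, l) \<in> {(2,1), (4,3), (3,1), (3,2), (4,1), (4,2)}"
  shows "eu k l * mon t \<in> pbw lam"
proof -
  obtain i j p q r s where t: "t = (i, j, p, q, r, s)" by (cases t)
  have neg: "- u \<in> pbw lam \<longleftrightarrow> u \<in> pbw lam" for u
    using pbw_uminus[of u lam] pbw_uminus[of "- u" lam] by auto
  have 0: "0 \<in> pbw lam" by (simp add: pbw.rel verma_rel.zero)
  have M: "opt p (eu 3 1) (opt q (eu 3 2) (opt r (eu 4 1) (opt s (eu 4 2) (eu 2 1 ^ i * eu 4 3 ^ j)))) \<in> pbw lam"
    for i j p q r s using pbw_mon[of "(i, j, p, q, r, s)" lam] by simp
  \<comment> \<open>The sixteen choices of flags are written out so that, once \<open>opt\<close> is
    removed, rewritten products match these facts literally.\<close>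
  note Ms = M[of True True True True] M[of True True True False] M[of True True False True] M[of True True False False]
    M[of True False True True] M[of True False True False] M[of True False False True] M[of True False False False]
    M[of False True True True] M[of False True True False] M[of False True False True] M[of False True False False]
    M[of False False True True] M[of False False True False] M[of False False False True] M[of False False False False]
  note Ms' = Ms[unfolded opt_simps]
  show ?thesis
    using assms unfolding t mon.simps
    by (cases p; cases q; cases r; cases s; simp only: insert_iff empty_iff prod.inject; elim disjE conjE; 
      simp add: eu_lower_rules' eu_even_mon right_diff_distrib distrib_left neg 0 Ms' del: power_Suc;
      (intro pbw.add pbw_diff)?; simp add: neg 0 Ms' del: power_Suc)
qed

lemma lower_pbw:
  assumes "u \<in> pbw lam" "(k, l) \<in> {(2,1), (4,3), (3,1), (3,2), (4,1), (4,2)}"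
  shows "eu k l * u \<in> pbw lam"
  using assms(1)
proof induction
  case (rel u)
  then show ?case by (intro pbw.rel verma_rel_mult_left)
next
  case (mon c t)
  show ?case by (subst env_scalar_left_commute) (intro pbw_scalar lower_mon_pbw assms)
next
  case (add u v)
  then show ?case by (simp add: distrib_left pbw.add)
qed

lemma pbw_UNIV: "u \<in> pbw lam"
  using lspan_UNIV[of u lam]
proof induction
  case one
  show ?case using pbw_mon[of "(0, 0, False, False, False, False)" lam] by simp
qed (auto intro: pbw.rel pbw.add pbw_scalar lower_pbw)

text \<open>Membership is demanded for all larger boxes, so that the bounds of two summands can be
  merged into their maximum.\<close>

lemma psi_vmap:
  "\<exists>n. \<forall>m\<ge>n. u - psi m (vmap lam u) \<in> verma_rel lam"
  using pbw_UNIV[of u lam]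
proof induction
  case (rel u)
  then show ?case by (simp only: vmap_verma_rel psi_zero diff_0_right simp_thms)
next
  case (mon c t)
  obtain i j p q r s where t: "t = (i, j, p, q, r, s)" by (cases t)
  have "env_scalar c * mon t - psi m (vmap lam (env_scalar c * mon t)) \<in> verma_rel lam" if "m \<ge> Suc (i + j)" for m
  proof -
    have "t \<in> vbox m" using that by (auto simp: t vbox_def)
    then show ?thesis by (simp only: vmap_simps vmap_mon psi_vb diff_self verma_rel.zero)
  qed
  then show ?case by blast
next
  case (add u v)
  then obtain n n' where n: "\<forall>m\<ge>n. u - psi m (vmap lam u) \<in> verma_rel lam"
    and n': "\<forall>m\<ge>n'. v - psi m (vmap lam v) \<in> verma_rel lam" by auto
  have "u + v - psi m (vmap lam (u + v)) \<in> verma_rel lam" if "m \<ge> max n n'" for m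
    using verma_rel.add[of "u - psi m (vmap lam u)" lam "v - psi m (vmap lam v)"] n n' that
    by (simp add: vmap_simps psi_add algebra_simps)
  then show ?case by blast
qed

text \<open>If \<open>vmap lam u\<close> is zero, then so is its \<open>psi\<close>, and
  \<open>psi_vmap\<close> leaves \<open>u\<close> itself among the relations. Thus
  \<open>vmap\<close> is injective on the Verma module.\<close>

lemma vmap_eq_zero_iff: "vmap lam u = 0 \<longleftrightarrow> u \<in> verma_rel lam"
  using psi_vmap[of u lam] by (auto simp: vmap_verma_rel)

lemma vfinI: "(\<And>i j p q r s. n \<le> i \<or> n \<le> j \<Longrightarrow> f i j p q r s = 0) \<Longrightarrow> f \<in> vfin"
  unfolding vfin_def by blast

lemma vfinE:
  assumes "f \<in> vfin"
  obtains n where "\<And>i j p q r s. n \<le> i \<or> n \<le> j \<Longrightarrow> f i j p q r s = 0"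
  using assms unfolding vfin_def by blast

lemma vfin_add: "f \<in> vfin \<Longrightarrow> g \<in> vfin \<Longrightarrow> f + g \<in> vfin"
proof (elim vfinE)
  fix m n
  assume "\<And>i j p q r s. m \<le> i \<or> m \<le> j \<Longrightarrow> f i j p q r s = 0" "\<And>i j p q r s. n \<le> i \<or> n \<le> j \<Longrightarrow> g i j p q r s = 0"
  then show "f + g \<in> vfin" by (intro vfinI[of "m + n"]) (auto simp: le_diff_conv)
qed

lemma vfin_scale: "f \<in> vfin \<Longrightarrow> vscale c f \<in> vfin"
  unfolding vfin_def by fastforce

lemma vfin_vb: "vb t \<in> vfin"
proof -
  obtain i j p q r s where t: "t = (i, j, p, q, r, s)" by (cases t)
  show ?thesis by (rule vfinI[of "Suc (i + j)"]) (auto simp: vb_def t)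
qed

lemma vmap_vfin: "vmap lam u \<in> vfin"
  using pbw_UNIV[of u lam]
proof induction
  case (rel u)
  then show ?case by (simp add: vmap_verma_rel vfin_def)
next
  case (mon c t)
  then show ?case by (simp only: vmap_simps vmap_mon vfin_scale vfin_vb)
next
  case (add u v)
  then show ?case by (simp only: vmap_simps vfin_add)
qed

lemma vmap_surj: "f \<in> vfin \<Longrightarrow> \<exists>u. vmap lam u = f"
  by (elim vfinE) (metis vmap_psi)

section \<open>Kernel and image of the odd matrix units\<close>

definition za :: "weight \<Rightarrow> nat \<Rightarrow> complex" where
  "za lam i = (of_nat i + 1) * (lam $ 1 - lam $ 2 - of_nat i)"
definition wa :: "weight \<Rightarrow> nat \<Rightarrow> complex" where
  "wa lam j = (of_nat j + 1) * (lam $ 3 - lam $ 4 - of_nat j)"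

text \<open>Pseudo-inverses: \<open>zd_inv\<close> and \<open>wd_inv\<close> vanish where the
  coefficient does, since division by zero gives zero; \<open>zm_inv\<close> and
  \<open>wm_inv\<close> divide by the variable and drop the constant term.\<close>

definition zd_inv :: "weight \<Rightarrow> vfun \<Rightarrow> vfun" where
  "zd_inv lam f i j p q r s = (case i of 0 \<Rightarrow> 0 | Suc k \<Rightarrow> f k j p q r s / za lam k)"
definition wd_inv :: "weight \<Rightarrow> vfun \<Rightarrow> vfun" where
  "wd_inv lam f i j p q r s = (case j of 0 \<Rightarrow> 0 | Suc k \<Rightarrow> f i k p q r s / wa lam k)"
definition zm_inv :: "vfun \<Rightarrow> vfun" where
  "zm_inv f i j p q r s = f (Suc i) j p q r s"
definition wm_inv :: "vfun \<Rightarrow> vfun" where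
  "wm_inv f i j p q r s = f i (Suc j) p q r s"

text \<open>The monomials carrying the homology of the two-term complex of \<open>zd\<close>, whose
  differential empties the flag. With the flag set, \<open>z^i\<close> must lie in the kernel; with
  the flag unset, outside the image. For multiplication by the variable the constant with unset flag
  survives, which is \<open>mharm\<close>.\<close>

definition zharm :: "weight \<Rightarrow> nat \<Rightarrow> bool \<Rightarrow> bool" where
  "zharm lam i b \<longleftrightarrow> (if b then i = 0 \<or> za lam (i - 1) = 0 else za lam i = 0)"
definition wharm :: "weight \<Rightarrow> nat \<Rightarrow> bool \<Rightarrow> bool" where
  "wharm lam j b \<longleftrightarrow> (if b then j = 0 \<or> wa lam (j - 1) = 0 else wa lam j = 0)"
definition mharm :: "nat \<Rightarrow> bool \<Rightarrow> bool" where
  "mharm i b \<longleftrightarrow> i = 0 \<and> \<not> b"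

lemma harm_simps [simp]:
  "zharm lam 0 True" "zharm lam (Suc i) True \<longleftrightarrow> za lam i = 0" "zharm lam i False \<longleftrightarrow> za lam i = 0"
  "wharm lam 0 True" "wharm lam (Suc j) True \<longleftrightarrow> wa lam j = 0" "wharm lam j False \<longleftrightarrow> wa lam j = 0"
  "mharm 0 False" "\<not> mharm (Suc i) b" "\<not> mharm i True"
  by (simp_all add: zharm_def wharm_def mharm_def)

lemma inv_simps [simp]:
  "zd_inv lam f 0 j p q r s = 0" "zd_inv lam f (Suc i) j p q r s = f i j p q r s / za lam i"
  "wd_inv lam f i 0 p q r s = 0" "wd_inv lam f i (Suc j) p q r s = f i j p q r s / wa lam j"
  "zm_inv f i j p q r s = f (Suc i) j p q r s" "wm_inv f i j p q r s = f i (Suc j) p q r s"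
  "zd lam f i j p q r s = za lam i * f (Suc i) j p q r s" 
  "wd lam f i j p q r s = wa lam j * f i (Suc j) p q r s"
  by (simp_all add: zd_inv_def wd_inv_def zm_inv_def wm_inv_def zd_def wd_def za_def wa_def)

text \<open>The kernel lies in the image; the opposite inclusion is automatic for self-commuting
  matrices by \<open>vact_self_commuting\<close>.\<close>

definition acyclic_on :: "weight \<Rightarrow> gl22 \<Rightarrow> bool" where
  "acyclic_on lam x \<longleftrightarrow> (\<forall>f\<in>vfin. vact lam x f = 0 \<longrightarrow> (\<exists>g\<in>vfin. f = vact lam x g))"

text \<open>Every \<open>f\<close> in \<open>vfin\<close> comes from the enveloping algebra, where
  multiplication by \<open>env_of x\<close> stays inside, so the formulas for the operators need not
  be inspected.\<close>

lemma vact_vfin: "f \<in> vfin \<Longrightarrow> vact lam x f \<in> vfin"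
  using vmap_surj[of f lam] vmap_vfin[of lam "env_of x * u" for u] by (auto simp only: vmap_simps)

lemma vop_vfin: "f \<in> vfin \<Longrightarrow> vop lam k l f \<in> vfin"
  using vact_vfin[of f lam "munit k l"] by (simp only: vact_munit)

lemma vfin_diff: "f \<in> vfin \<Longrightarrow> g \<in> vfin \<Longrightarrow> f - g \<in> vfin"
  using vfin_add[of f "vscale (-1) g"] vfin_scale[of g "-1"]
  by (simp only: vs.scale_minus_left vs.scale_one add_uminus_conv_diff)

lemma vop_odd_square:
  assumes "par k \<noteq> par l"
  shows "vop lam k l (vop lam k l f) = 0"
proof -
  have "k \<noteq> l" using assms by auto
  then have "vop lam k l (vop lam k l f) = vscale (-1) (vop lam k l (vop lam k l f))"
    using vop_bracket[of lam k l k l f] assms by (simp only: psign_def) simp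
  then have "vop lam k l (vop lam k l f) i j p q r s = - vop lam k l (vop lam k l f) i j p q r s" for i j p q r s
    by (metis vscale_apply mult_minus1)
  then show ?thesis by (intro ext) simp
qed

text \<open>The operator \<open>x s + s x\<close> commutes with \<open>x\<close>; it is the identity up to an operator with image in
  a subspace \<open>D\<close> on which it is the identity.\<close>

lemma acyclic_on_homotopy:
  assumes odd: "par k \<noteq> par l"
    and fin: "\<And>f. f \<in> vfin \<Longrightarrow> s f \<in> vfin"
    and s0: "s 0 = 0"
    and 1: "\<And>f. D (f - (vop lam k l (s f) + s (vop lam k l f)))"
    and 2: "\<And>f. D f \<Longrightarrow> vop lam k l (s f) + s (vop lam k l f) = f"
  shows "acyclic_on lam (munit k l)"
  unfolding acyclic_on_def vact_munit
proof (intro ballI impI)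
  fix f assume f: "f \<in> vfin" "vop lam k l f = 0"
  \<comment> \<open>As \<open>f\<close> is in the kernel, this is \<open>f\<close> minus the
    homotopy operator applied to \<open>f\<close>, so it lies in \<open>D\<close>. It is in the
    kernel too, so \<open>s\<close> contracts it exactly, and the two preimages add up.\<close>
  define f' where "f' = f - vop lam k l (s f)"
  have "D f'" using 1[of f] by (simp only: f s0 add_0_right f'_def)
  have "vop lam k l f' + vop lam k l (vop lam k l (s f)) = 0"
    unfolding vop_add[symmetric] f'_def by (simp only: diff_add_cancel f)
  then have "vop lam k l f' = 0" by (simp only: vop_odd_square[OF odd] add_0_right)
  then have "vop lam k l (s f') = f'" using 2[OF \<open>D f'\<close>] by (simp only: s0 add_0_right)
  then have "f = vop lam k l (s f + s f')"
    by (simp only: vop_add f'_def) (simp only: add_diff_eq add_diff_cancel_left')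
  moreover have "s f + s f' \<in> vfin"
    unfolding f'_def by (intro vfin_add fin vfin_diff f vop_vfin)
  ultimately show "\<exists>g\<in>vfin. f = vop lam k l g" by blast
qed

text \<open>The coefficient functional at this basis vector kills the whole image but not the vector
  itself.\<close>

lemma not_acyclic_on_witness:
  assumes "vop lam k l (vb (i, j, p, q, r, s)) = 0" "\<And>f. vop lam k l f i j p q r s = 0"
  shows "\<not> acyclic_on lam (munit k l)"
proof
  assume "acyclic_on lam (munit k l)"
  then obtain g where "vb (i, j, p, q, r, s) = vop lam k l g"
    using assms(1) vfin_vb unfolding acyclic_on_def vact_munit by blast
  then have "vb (i, j, p, q, r, s) i j p q r s = 0" by (simp only: assms(2))
  then show False by (simp add: vb_def)
qed

text \<open>For an odd root with root vector \<open>E\<^sub>k\<^sub>l\<close> let \<open>h\<close> be the action of its coroot. Off the kernel of \<open>h\<close>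
  the contraction is \<open>h\<^sup>-\<^sup>1\<close> times the creation operator of \<open>E\<^sub>l\<^sub>k\<close>. On the kernel \<open>E\<^sub>k\<^sub>l\<close> is, up to a
  nilpotent term, a Koszul differential built from one operator on polynomials in \<open>E\<^sub>2\<^sub>1\<close> and one on
  polynomials in \<open>E\<^sub>4\<^sub>3\<close>, which is contracted by pseudo-inverses (recall \<open>x / 0 = 0\<close>) except on the
  harmonic monomials.\<close>

definition h14 :: "weight \<Rightarrow> nat \<Rightarrow> nat \<Rightarrow> bool \<Rightarrow> bool \<Rightarrow> complex" where
  "h14 lam i j p s = lam $ 1 + lam $ 4 - of_nat i + of_nat j - nb p + nb s"

text \<open>Passing along \<open>zd\<close> or \<open>wd\<close> lowers an exponent and empties a
  flag, and the two effects cancel. So the coroot commutes with the Koszul differential.\<close>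

lemma h14_shift [simp]:
  "h14 lam (Suc i) j p True = h14 lam i j p False"
  "h14 lam i (Suc j) True s = h14 lam i j False s"
  by (simp_all add: h14_def)

lemma vop_14_apply: "vop lam 1 4 f i j p q r s =
   h14 lam i j p s * an41 f i j p q r s + zd lam (an42 f) i j p q r s + wd lam (an31 f) i j p q r s
   - cr32 (an31 (an42 f)) i j p q r s"
  by (cases r) (simp_all add: vop_simps dg_simps h14_def algebra_simps)

text \<open>On the kernel of the coroot this is the usual contraction of a tensor product of
  complexes: contract in the first variable, and in the second on the part that is harmonic for the
  first.\<close>

definition hom14 :: "weight \<Rightarrow> vfun \<Rightarrow> vfun" where
  "hom14 lam f i j p q r s = cr41 f i j p q r s / h14 lam i j p s +
     (if h14 lam i j p s = 0 then zd_inv lam (cr42 f) i j p q r s +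
        (if zharm lam i s then wd_inv lam (cr31 f) i j p q r s else 0) else 0)"

text \<open>The cubic term creates \<open>E_32\<close>, so it is invisible in coefficients with
  \<open>q\<close> unset, and there the homotopy identity is exact.\<close>

lemma hom14_False:
  assumes "\<And>i j p s. h14 lam i j p s = 0 \<Longrightarrow> \<not> (zharm lam i s \<and> wharm lam j p)"
  shows "(vop lam 1 4 (hom14 lam f) + hom14 lam (vop lam 1 4 f)) i j p False r s = f i j p False r s"
  using assms[of i j p s]
  by (cases p; cases r; cases s; cases i; cases j; simp add: vop_14_apply hom14_def; auto simp: field_simps split: if_splits)

text \<open>Such an \<open>f\<close> is divisible by \<open>E_32\<close>, which the cubic term would
  create a second time. That term therefore vanishes and the identity holds at every
  coefficient.\<close>

lemma hom14_True:
  assumes "\<And>i j p s. h14 lam i j p s = 0 \<Longrightarrow> \<not> (zharm lam i s \<and> wharm lam j p)"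
    and "\<And>i j p r s. f i j p False r s = 0"
  shows "(vop lam 1 4 (hom14 lam f) + hom14 lam (vop lam 1 4 f)) i j p q r s = f i j p q r s"
  using assms(1)[of i j p s]
  by (cases p; cases q; cases r; cases s; cases i; cases j; simp add: vop_14_apply hom14_def assms(2);
    auto simp: field_simps split: if_splits)

lemma hom14_vfin: "f \<in> vfin \<Longrightarrow> hom14 lam f \<in> vfin"
proof (elim vfinE)
  fix n assume n: "\<And>i j p q r s. n \<le> i \<or> n \<le> j \<Longrightarrow> f i j p q r s = 0"
  \<comment> \<open>The bound grows by one because \<open>zd_inv\<close> and \<open>wd_inv\<close>
    raise an exponent.\<close>
  show "hom14 lam f \<in> vfin"
  proof (rule vfinI[of "Suc n"])
    fix i j p q r s assume "Suc n \<le> i \<or> Suc n \<le> j"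
    then show "hom14 lam f i j p q r s = 0"
      by (cases i; cases j) (auto simp: hom14_def cr41_def cr42_def cr31_def n)
  qed
qed

lemma acyclic_on_14:
  assumes "\<And>i j p s. h14 lam i j p s = 0 \<Longrightarrow> \<not> (zharm lam i s \<and> wharm lam j p)"
  shows "acyclic_on lam (munit 1 4)"
proof (rule acyclic_on_homotopy[where s = "hom14 lam" and D = "\<lambda>f. \<forall>i j p r s. f i j p False r s = 0"])
  show "hom14 lam 0 = 0"
    by (intro ext, case_tac x; case_tac xa)
      (simp_all add: hom14_def cr41_def cr42_def cr31_def)
  show "\<forall>i j p r s. (f - (vop lam 1 4 (hom14 lam f) + hom14 lam (vop lam 1 4 f))) i j p False r s = 0" for f
    using hom14_False[OF assms, where f = f] by simp
  show "vop lam 1 4 (hom14 lam f) + hom14 lam (vop lam 1 4 f) = f" if "\<forall>i j p r s. f i j p False r s = 0" for f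
    by (intro ext hom14_True assms) (use that in simp_all)
qed (simp_all add: par_def hom14_vfin)

lemma not_acyclic_on_14:
  assumes "h14 lam i j p s = 0" "zharm lam i s" "wharm lam j p"
  shows "\<not> acyclic_on lam (munit 1 4)"
proof (rule not_acyclic_on_witness)
  \<comment> \<open>The flag \<open>q\<close> is chosen as \<open>s \<and> p\<close>: if
    \<open>E_31\<close> and \<open>E_42\<close> are both present, adding \<open>E_32\<close>
    switches the cubic term off; otherwise that term vanishes by itself.\<close>
  show "vop lam 1 4 f i j p (s \<and> p) False s = 0" for f
    using assms
    by (cases s; cases p; cases i; cases j; simp add: vop_14_apply)
  show "vop lam 1 4 (vb (i, j, p, s \<and> p, False, s)) = 0"
  proof (intro ext)
    fix i' j' p' q' r' s'
    show "vop lam 1 4 (vb (i, j, p, s \<and> p, False, s)) i' j' p' q' r' s' = 0 i' j' p' q' r' s'"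
      using assms
      by (cases s; cases p; auto simp: vop_14_apply vb_def an31_def an32_def an41_def an42_def
        cr31_def cr32_def cr41_def cr42_def zharm_def wharm_def mharm_def zm_def wm_def split: nat.split)
  qed
qed

section \<open>The root vector \<open>munit 1 3\<close>: \<open>zd\<close> paired with
  multiplication by \<open>E_43\<close>\<close>

definition h13 :: "weight \<Rightarrow> nat \<Rightarrow> nat \<Rightarrow> bool \<Rightarrow> bool \<Rightarrow> complex" where
  "h13 lam i j q r = lam $ 1 + lam $ 3 - of_nat i - of_nat j + nb q - nb r"

lemma h13_shift [simp]:
  "h13 lam (Suc i) j True r = h13 lam i j False r"
  "h13 lam i j q True = h13 lam i (Suc j) q False"
  by (simp_all add: h13_def)

lemma vop_13_apply: "vop lam 1 3 f i j p q r s =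
   h13 lam i j q r * an31 f i j p q r s + zd lam (an32 f) i j p q r s + wm (an41 f) i j p q r s
   - cr42 (an41 (an32 f)) i j p q r s"
  by (cases p) (simp_all add: vop_simps dg_simps h13_def algebra_simps)

definition hom13 :: "weight \<Rightarrow> vfun \<Rightarrow> vfun" where
  "hom13 lam f i j p q r s = cr31 f i j p q r s / h13 lam i j q r +
     (if h13 lam i j q r = 0 then zd_inv lam (cr32 f) i j p q r s +
        (if zharm lam i q then wm_inv (cr41 f) i j p q r s else 0) else 0)"

text \<open>The cubic term now creates \<open>E_42\<close>, so the coefficients with
  \<open>s\<close> unset do not see it.\<close>

lemma hom13_False:
  assumes "\<And>i j q r. h13 lam i j q r = 0 \<Longrightarrow> \<not> (zharm lam i q \<and> mharm j r)"
  shows "(vop lam 1 3 (hom13 lam f) + hom13 lam (vop lam 1 3 f)) i j p q r False = f i j p q r False"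
  using assms[of i j q r]
  by (cases p; cases q; cases r; cases i; cases j; simp add: vop_13_apply hom13_def; auto simp: field_simps split: if_splits)

lemma hom13_True:
  assumes "\<And>i j q r. h13 lam i j q r = 0 \<Longrightarrow> \<not> (zharm lam i q \<and> mharm j r)"
    and "\<And>i j p q r. f i j p q r False = 0"
  shows "(vop lam 1 3 (hom13 lam f) + hom13 lam (vop lam 1 3 f)) i j p q r s = f i j p q r s"
  using assms(1)[of i j q r]
  by (cases p; cases q; cases r; cases s; cases i; cases j; simp add: vop_13_apply hom13_def assms(2);
    auto simp: field_simps split: if_splits)

lemma hom13_vfin: "f \<in> vfin \<Longrightarrow> hom13 lam f \<in> vfin"
proof (elim vfinE)
  fix n assume n: "\<And>i j p q r s. n \<le> i \<or> n \<le> j \<Longrightarrow> f i j p q r s = 0"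
  show "hom13 lam f \<in> vfin"
  proof (rule vfinI[of "Suc n"])
    fix i j p q r s assume "Suc n \<le> i \<or> Suc n \<le> j"
    then show "hom13 lam f i j p q r s = 0"
      by (cases i; cases j) (auto simp: hom13_def cr31_def cr32_def cr41_def n)
  qed
qed

lemma acyclic_on_13:
  assumes "\<And>i j q r. h13 lam i j q r = 0 \<Longrightarrow> \<not> (zharm lam i q \<and> mharm j r)"
  shows "acyclic_on lam (munit 1 3)"
proof (rule acyclic_on_homotopy[where s = "hom13 lam" and D = "\<lambda>f. \<forall>i j p q r. f i j p q r False = 0"])
  show "hom13 lam 0 = 0"
    by (intro ext, case_tac x; case_tac xa)
      (simp_all add: hom13_def cr31_def cr32_def cr41_def)
  show "\<forall>i j p q r. (f - (vop lam 1 3 (hom13 lam f) + hom13 lam (vop lam 1 3 f))) i j p q r False = 0" for f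
    using hom13_False[OF assms, where f = f] by simp
  show "vop lam 1 3 (hom13 lam f) + hom13 lam (vop lam 1 3 f) = f" if "\<forall>i j p q r. f i j p q r False = 0" for f
    by (intro ext hom13_True assms) (use that in simp_all)
qed (simp_all add: par_def hom13_vfin)

lemma not_acyclic_on_13:
  assumes "h13 lam i j q r = 0" "zharm lam i q" "mharm j r"
  shows "\<not> acyclic_on lam (munit 1 3)"
proof (rule not_acyclic_on_witness)
  show "vop lam 1 3 f i j False q r (q \<and> r) = 0" for f
    using assms
    by (cases q; cases r; cases i; cases j; simp add: vop_13_apply)
  show "vop lam 1 3 (vb (i, j, False, q, r, q \<and> r)) = 0"
  proof (intro ext)
    fix i' j' p' q' r' s'
    show "vop lam 1 3 (vb (i, j, False, q, r, q \<and> r)) i' j' p' q' r' s' = 0 i' j' p' q' r' s'"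
      using assms
      by (cases q; cases r; auto simp: vop_13_apply vb_def an31_def an32_def an41_def an42_def
        cr31_def cr32_def cr41_def cr42_def zharm_def wharm_def mharm_def zm_def wm_def split: nat.split)
  qed
qed

section \<open>The root vector \<open>munit 2 4\<close>: \<open>wd\<close> paired with
  multiplication by \<open>E_21\<close>\<close>

definition h24 :: "weight \<Rightarrow> nat \<Rightarrow> nat \<Rightarrow> bool \<Rightarrow> bool \<Rightarrow> complex" where
  "h24 lam i j q r = lam $ 2 + lam $ 4 + of_nat i + of_nat j - nb q + nb r"

lemma h24_shift [simp]:
  "h24 lam i (Suc j) True r = h24 lam i j False r"
  "h24 lam i j q True = h24 lam (Suc i) j q False"
  by (simp_all add: h24_def)

lemma vop_24_apply: "vop lam 2 4 f i j p q r s =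
   h24 lam i j q r * an42 f i j p q r s + wd lam (an32 f) i j p q r s + zm (an41 f) i j p q r s
   - cr31 (an32 (an41 f)) i j p q r s"
  by (cases s) (simp_all add: vop_simps dg_simps h24_def algebra_simps)

definition hom24 :: "weight \<Rightarrow> vfun \<Rightarrow> vfun" where
  "hom24 lam f i j p q r s = cr42 f i j p q r s / h24 lam i j q r +
     (if h24 lam i j q r = 0 then wd_inv lam (cr32 f) i j p q r s +
        (if wharm lam j q then zm_inv (cr41 f) i j p q r s else 0) else 0)"

text \<open>The cubic term creates \<open>E_31\<close>, so the coefficients with \<open>p\<close>
  unset do not see it.\<close>

lemma hom24_False:
  assumes "\<And>i j q r. h24 lam i j q r = 0 \<Longrightarrow> \<not> (wharm lam j q \<and> mharm i r)"
  shows "(vop lam 2 4 (hom24 lam f) + hom24 lam (vop lam 2 4 f)) i j False q r s = f i j False q r s"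
  using assms[of i j q r]
  by (cases q; cases r; cases s; cases i; cases j; simp add: vop_24_apply hom24_def; auto simp: field_simps split: if_splits)

lemma hom24_True:
  assumes "\<And>i j q r. h24 lam i j q r = 0 \<Longrightarrow> \<not> (wharm lam j q \<and> mharm i r)"
    and "\<And>i j q r s. f i j False q r s = 0"
  shows "(vop lam 2 4 (hom24 lam f) + hom24 lam (vop lam 2 4 f)) i j p q r s = f i j p q r s"
  using assms(1)[of i j q r]
  by (cases p; cases q; cases r; cases s; cases i; cases j; simp add: vop_24_apply hom24_def assms(2);
    auto simp: field_simps split: if_splits)

lemma hom24_vfin: "f \<in> vfin \<Longrightarrow> hom24 lam f \<in> vfin"
proof (elim vfinE)
  fix n assume n: "\<And>i j p q r s. n \<le> i \<or> n \<le> j \<Longrightarrow> f i j p q r s = 0"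
  show "hom24 lam f \<in> vfin"
  proof (rule vfinI[of "Suc n"])
    fix i j p q r s assume "Suc n \<le> i \<or> Suc n \<le> j"
    then show "hom24 lam f i j p q r s = 0"
      by (cases i; cases j) (auto simp: hom24_def cr42_def cr32_def cr41_def n)
  qed
qed

lemma acyclic_on_24:
  assumes "\<And>i j q r. h24 lam i j q r = 0 \<Longrightarrow> \<not> (wharm lam j q \<and> mharm i r)"
  shows "acyclic_on lam (munit 2 4)"
proof (rule acyclic_on_homotopy[where s = "hom24 lam" and D = "\<lambda>f. \<forall>i j q r s. f i j False q r s = 0"])
  show "hom24 lam 0 = 0"
    by (intro ext, case_tac x; case_tac xa)
      (simp_all add: hom24_def cr42_def cr32_def cr41_def)
  show "\<forall>i j q r s. (f - (vop lam 2 4 (hom24 lam f) + hom24 lam (vop lam 2 4 f))) i j False q r s = 0" for f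
    using hom24_False[OF assms, where f = f] by simp
  show "vop lam 2 4 (hom24 lam f) + hom24 lam (vop lam 2 4 f) = f" if "\<forall>i j q r s. f i j False q r s = 0" for f
    by (intro ext hom24_True assms) (use that in simp_all)
qed (simp_all add: par_def hom24_vfin)

lemma not_acyclic_on_24:
  assumes "h24 lam i j q r = 0" "wharm lam j q" "mharm i r"
  shows "\<not> acyclic_on lam (munit 2 4)"
proof (rule not_acyclic_on_witness)
  show "vop lam 2 4 f i j (q \<and> r) q r False = 0" for f
    using assms
    by (cases q; cases r; cases i; cases j; simp add: vop_24_apply)
  show "vop lam 2 4 (vb (i, j, q \<and> r, q, r, False)) = 0"
  proof (intro ext)
    fix i' j' p' q' r' s'
    show "vop lam 2 4 (vb (i, j, q \<and> r, q, r, False)) i' j' p' q' r' s' = 0 i' j' p' q' r' s'"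
      using assms
      by (cases q; cases r; auto simp: vop_24_apply vb_def an31_def an32_def an41_def an42_def
        cr31_def cr32_def cr41_def cr42_def zharm_def wharm_def mharm_def zm_def wm_def split: nat.split)
  qed
qed

section \<open>The root vector \<open>munit 2 3\<close>: multiplication by both \<open>E_21\<close>
  and \<open>E_43\<close>\<close>

definition h23 :: "weight \<Rightarrow> nat \<Rightarrow> nat \<Rightarrow> bool \<Rightarrow> bool \<Rightarrow> complex" where
  "h23 lam i j p s = lam $ 2 + lam $ 3 + of_nat i - of_nat j + nb p - nb s"

lemma h23_shift [simp]:
  "h23 lam i j True s = h23 lam (Suc i) j False s"
  "h23 lam i j p True = h23 lam i (Suc j) p False"
  by (simp_all add: h23_def)

lemma vop_23_apply: "vop lam 2 3 f i j p q r s =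
   h23 lam i j p s * an32 f i j p q r s + zm (an31 f) i j p q r s + wm (an42 f) i j p q r s
   - cr41 (an42 (an31 f)) i j p q r s"
  by (cases q) (simp_all add: vop_simps dg_simps h23_def algebra_simps)

definition hom23 :: "weight \<Rightarrow> vfun \<Rightarrow> vfun" where
  "hom23 lam f i j p q r s = cr32 f i j p q r s / h23 lam i j p s +
     (if h23 lam i j p s = 0 then zm_inv (cr31 f) i j p q r s +
        (if mharm i p then wm_inv (cr42 f) i j p q r s else 0) else 0)"

text \<open>The cubic term creates \<open>E_41\<close>, so the coefficients with \<open>r\<close>
  unset do not see it.\<close>

lemma hom23_False:
  assumes "\<And>i j p s. h23 lam i j p s = 0 \<Longrightarrow> \<not> (mharm i p \<and> mharm j s)"
  shows "(vop lam 2 3 (hom23 lam f) + hom23 lam (vop lam 2 3 f)) i j p q False s = f i j p q False s"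
  using assms[of i j p s]
  by (cases p; cases q; cases s; cases i; cases j; simp add: vop_23_apply hom23_def; auto simp: field_simps split: if_splits)

lemma hom23_True:
  assumes "\<And>i j p s. h23 lam i j p s = 0 \<Longrightarrow> \<not> (mharm i p \<and> mharm j s)"
    and "\<And>i j p q s. f i j p q False s = 0"
  shows "(vop lam 2 3 (hom23 lam f) + hom23 lam (vop lam 2 3 f)) i j p q r s = f i j p q r s"
  using assms(1)[of i j p s]
  by (cases p; cases q; cases r; cases s; cases i; cases j; simp add: vop_23_apply hom23_def assms(2);
    auto simp: field_simps split: if_splits)

lemma hom23_vfin: "f \<in> vfin \<Longrightarrow> hom23 lam f \<in> vfin"
proof (elim vfinE)
  fix n assume n: "\<And>i j p q r s. n \<le> i \<or> n \<le> j \<Longrightarrow> f i j p q r s = 0"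
  show "hom23 lam f \<in> vfin"
  proof (rule vfinI[of "Suc n"])
    fix i j p q r s assume "Suc n \<le> i \<or> Suc n \<le> j"
    then show "hom23 lam f i j p q r s = 0"
      by (cases i; cases j) (auto simp: hom23_def cr32_def cr31_def cr42_def n)
  qed
qed

lemma acyclic_on_23:
  assumes "\<And>i j p s. h23 lam i j p s = 0 \<Longrightarrow> \<not> (mharm i p \<and> mharm j s)"
  shows "acyclic_on lam (munit 2 3)"
proof (rule acyclic_on_homotopy[where s = "hom23 lam" and D = "\<lambda>f. \<forall>i j p q s. f i j p q False s = 0"])
  show "hom23 lam 0 = 0"
    by (intro ext, case_tac x; case_tac xa)
      (simp_all add: hom23_def cr32_def cr31_def cr42_def)
  show "\<forall>i j p q s. (f - (vop lam 2 3 (hom23 lam f) + hom23 lam (vop lam 2 3 f))) i j p q False s = 0" for f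
    using hom23_False[OF assms, where f = f] by simp
  show "vop lam 2 3 (hom23 lam f) + hom23 lam (vop lam 2 3 f) = f" if "\<forall>i j p q s. f i j p q False s = 0" for f
    by (intro ext hom23_True assms) (use that in simp_all)
qed (simp_all add: par_def hom23_vfin)

lemma not_acyclic_on_23:
  assumes "h23 lam i j p s = 0" "mharm i p" "mharm j s"
  shows "\<not> acyclic_on lam (munit 2 3)"
proof (rule not_acyclic_on_witness)
  show "vop lam 2 3 f i j p False (p \<and> s) s = 0" for f
    using assms
    by (cases p; cases s; cases i; cases j; simp add: vop_23_apply)
  show "vop lam 2 3 (vb (i, j, p, False, p \<and> s, s)) = 0"
  proof (intro ext)
    fix i' j' p' q' r' s'
    show "vop lam 2 3 (vb (i, j, p, False, p \<and> s, s)) i' j' p' q' r' s' = 0 i' j' p' q' r' s'"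
      using assms
      by (cases p; cases s; auto simp: vop_23_apply vb_def an31_def an32_def an41_def an42_def
        cr31_def cr32_def cr41_def cr42_def zharm_def wharm_def mharm_def zm_def wm_def split: nat.split)
  qed
qed

section \<open>Contractions for the negative odd roots\<close>

lemma acyclic_on_31: "acyclic_on lam (munit 3 1)"
proof (rule acyclic_on_homotopy[where s = "an31" and D = "\<lambda>f. f = 0"])
  \<comment> \<open>Creation and annihilation of one generator anticommute to the identity, so the
    correction space \<open>D\<close> can be zero.\<close>
  have *: "cr31 (an31 f) + an31 (cr31 f) = f" for f
    by (intro ext, case_tac xb; case_tac xc; case_tac xd; case_tac xe; simp)
  show "f - (vop lam 3 1 (an31 f) + an31 (vop lam 3 1 f)) = 0" for f
    by (simp only: vop_simps * diff_self)
  show "vop lam 3 1 (an31 f) + an31 (vop lam 3 1 f) = f" for f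
    by (simp only: vop_simps *)
  show "an31 f \<in> vfin" if "f \<in> vfin" for f
    using that
  proof (elim vfinE)
    fix n assume n: "\<And>i j p q r s. n \<le> i \<or> n \<le> j \<Longrightarrow> f i j p q r s = 0"
    show "an31 f \<in> vfin" by (rule vfinI[of n]) (simp add: an31_def n)
  qed
qed (simp_all add: par_def op_zero)

lemma acyclic_on_32: "acyclic_on lam (munit 3 2)"
proof (rule acyclic_on_homotopy[where s = "an32" and D = "\<lambda>f. f = 0"])
  have *: "cr32 (an32 f) + an32 (cr32 f) = f" for f
    by (intro ext, case_tac xb; case_tac xc; case_tac xd; case_tac xe; simp)
  show "f - (vop lam 3 2 (an32 f) + an32 (vop lam 3 2 f)) = 0" for f
    by (simp only: vop_simps * diff_self)
  show "vop lam 3 2 (an32 f) + an32 (vop lam 3 2 f) = f" for f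
    by (simp only: vop_simps *)
  show "an32 f \<in> vfin" if "f \<in> vfin" for f
    using that
  proof (elim vfinE)
    fix n assume n: "\<And>i j p q r s. n \<le> i \<or> n \<le> j \<Longrightarrow> f i j p q r s = 0"
    show "an32 f \<in> vfin" by (rule vfinI[of n]) (simp add: an32_def n)
  qed
qed (simp_all add: par_def op_zero)

lemma acyclic_on_41: "acyclic_on lam (munit 4 1)"
proof (rule acyclic_on_homotopy[where s = "an41" and D = "\<lambda>f. f = 0"])
  have *: "cr41 (an41 f) + an41 (cr41 f) = f" for f
    by (intro ext, case_tac xb; case_tac xc; case_tac xd; case_tac xe; simp)
  show "f - (vop lam 4 1 (an41 f) + an41 (vop lam 4 1 f)) = 0" for f
    by (simp only: vop_simps * diff_self)
  show "vop lam 4 1 (an41 f) + an41 (vop lam 4 1 f) = f" for f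
    by (simp only: vop_simps *)
  show "an41 f \<in> vfin" if "f \<in> vfin" for f
    using that
  proof (elim vfinE)
    fix n assume n: "\<And>i j p q r s. n \<le> i \<or> n \<le> j \<Longrightarrow> f i j p q r s = 0"
    show "an41 f \<in> vfin" by (rule vfinI[of n]) (simp add: an41_def n)
  qed
qed (simp_all add: par_def op_zero)

lemma acyclic_on_42: "acyclic_on lam (munit 4 2)"
proof (rule acyclic_on_homotopy[where s = "an42" and D = "\<lambda>f. f = 0"])
  have *: "cr42 (an42 f) + an42 (cr42 f) = f" for f
    by (intro ext, case_tac xb; case_tac xc; case_tac xd; case_tac xe; simp)
  show "f - (vop lam 4 2 (an42 f) + an42 (vop lam 4 2 f)) = 0" for f
    by (simp only: vop_simps * diff_self)
  show "vop lam 4 2 (an42 f) + an42 (vop lam 4 2 f) = f" for f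
    by (simp only: vop_simps *)
  show "an42 f \<in> vfin" if "f \<in> vfin" for f
    using that
  proof (elim vfinE)
    fix n assume n: "\<And>i j p q r s. n \<le> i \<or> n \<le> j \<Longrightarrow> f i j p q r s = 0"
    show "an42 f \<in> vfin" by (rule vfinI[of n]) (simp add: an42_def n)
  qed
qed (simp_all add: par_def op_zero)

section \<open>Associated variety and conjugation\<close>

lemma verma_class_eq_iff: "verma_eq lam `` {u} = verma_eq lam `` {v} \<longleftrightarrow> vmap lam u = vmap lam v"
proof -
  have "verma_eq lam `` {u} = verma_eq lam `` {v} \<longleftrightarrow> (u, v) \<in> verma_eq lam"
    using eq_equiv_class_iff[OF equiv_verma_eq] by simp
  also have "\<dots> \<longleftrightarrow> vmap lam (u - v) = 0"
    by (simp only: vmap_eq_zero_iff verma_eq_def mem_Collect_eq split_conv)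
  finally show ?thesis by (simp only: vmap_simps right_minus_eq)
qed

lemma vact_zero: "vact lam 0 f = 0"
  using vact_smul[of lam 0 0 f] by (simp only: vs.scale_zero_left) simp

lemma vact_self_commuting:
  assumes "x \<in> self_commuting"
  shows "vact lam x (vact lam x f) = 0"
proof -
  have "vact lam x (vact lam x f) = vscale (-1) (vact lam x (vact lam x f))"
    using vact_bracket[of x 1 x 1 lam f] assms
    by (simp only: self_commuting_def mem_Collect_eq vact_zero add_0_right) simp
  then have "vact lam x (vact lam x f) i j p q r s = - vact lam x (vact lam x f) i j p q r s" for i j p q r s
    by (metis vscale_apply mult_minus1)
  then show ?thesis by (intro ext) simp
qed

lemma subset_eq_iff_ball: "A \<subseteq> X \<Longrightarrow> B \<subseteq> X \<Longrightarrow> A = B \<longleftrightarrow> (\<forall>m\<in>X. m \<in> A \<longleftrightarrow> m \<in> B)"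
  by blast

lemma ball_range_iff: "(\<forall>m\<in>range f. P m) \<longleftrightarrow> (\<forall>x. P (f x))"
  by blast

lemma bex_range_iff: "(\<exists>m\<in>range f. P m) \<longleftrightarrow> (\<exists>x. P (f x))"
  by blast

lemma vfin_eq_range: "vfin = range (vmap lam)"
proof (intro subset_antisym subsetI)
  fix f assume "f \<in> vfin"
  then obtain u where "vmap lam u = f" using vmap_surj by blast
  then show "f \<in> range (vmap lam)" by (rule range_eqI[OF sym])
next
  fix f assume "f \<in> range (vmap lam)"
  then show "f \<in> vfin" by (elim rangeE) (simp only: vmap_vfin)
qed

lemma ball_kernel_image_iff:
  assumes "\<And>f. T (T f) = z"
  shows "(\<forall>f\<in>V. (\<exists>g\<in>V. f = T g) \<longleftrightarrow> T f = z) \<longleftrightarrow> (\<forall>f\<in>V. T f = z \<longrightarrow> (\<exists>g\<in>V. f = T g))"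
  using assms by blast

text \<open>Classes are translated into finitely supported functions by \<open>vmap\<close>;
  equality of image and kernel then reduces to one inclusion by
  \<open>vact_self_commuting\<close>.\<close>

lemma assoc_variety_iff:
  assumes "x \<in> self_commuting"
  shows "x \<in> assoc_variety (verma lam) (verma_zero lam) (verma_act lam) \<longleftrightarrow> \<not> acyclic_on lam x"
proof -
  let ?c = "\<lambda>u. verma_eq lam `` {u}"
  have M: "verma lam = range ?c" by (simp only: verma_def quotient_def UNION_singleton_eq_range)
  let ?A = "verma_act lam x ` verma lam" and ?B = "{m \<in> verma lam. verma_act lam x m = verma_zero lam}"
  have A: "?A = range (\<lambda>w. ?c (env_of x * w))"
    by (simp only: M image_image verma_act_class)
  have uA: "?c u \<in> ?A \<longleftrightarrow> (\<exists>w. ?c u = ?c (env_of x * w))" for u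
    by (simp only: A image_iff bex_UNIV)
  have r: "?c u \<in> range ?c" for u
    by (rule rangeI)
  have uB: "?c u \<in> ?B \<longleftrightarrow> ?c (env_of x * u) = ?c 0" for u
    by (simp only: M mem_Collect_eq verma_act_class verma_zero_def r simp_thms)
  have "?A \<subseteq> range ?c" unfolding A by (rule image_subsetI) (rule r)
  moreover have "?B \<subseteq> range ?c" unfolding M by (rule Collect_restrict)
  ultimately have "?A = ?B \<longleftrightarrow> (\<forall>m\<in>range ?c. m \<in> ?A \<longleftrightarrow> m \<in> ?B)" by (rule subset_eq_iff_ball)
  also have "\<dots> \<longleftrightarrow> (\<forall>u. (\<exists>w. ?c u = ?c (env_of x * w)) \<longleftrightarrow> ?c (env_of x * u) = ?c 0)"
    by (simp only: ball_range_iff uA uB)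
  also have "\<dots> \<longleftrightarrow> (\<forall>u. (\<exists>w. vmap lam u = vact lam x (vmap lam w)) \<longleftrightarrow> vact lam x (vmap lam u) = 0)"
    by (simp only: verma_class_eq_iff vmap_simps vmap_zero)
  also have "\<dots> \<longleftrightarrow> (\<forall>f\<in>vfin. (\<exists>g\<in>vfin. f = vact lam x g) \<longleftrightarrow> vact lam x f = 0)"
    by (simp only: vfin_eq_range[of lam] ball_range_iff bex_range_iff)
  also have "\<dots> \<longleftrightarrow> acyclic_on lam x"
    unfolding acyclic_on_def by (rule ball_kernel_image_iff) (rule vact_self_commuting[OF assms])
  finally show ?thesis
    using assms by (simp only: assoc_variety_def mem_Collect_eq simp_thms)
qed

lemma acyclic_on_smul:
  assumes "c \<noteq> 0"
  shows "acyclic_on lam (smul c x) \<longleftrightarrow> acyclic_on lam x"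
proof -
  have *: "acyclic_on lam (smul c x)" if ac: "acyclic_on lam x" and "c \<noteq> 0" for c x
    unfolding acyclic_on_def vact_smul
  proof (intro ballI impI)
    fix f assume f: "f \<in> vfin" "vscale c (vact lam x f) = 0"
    then have "vact lam x f = 0" using \<open>c \<noteq> 0\<close> by (metis vs.scale_eq_0_iff)
    then obtain g where g: "g \<in> vfin" "f = vact lam x g" using ac f unfolding acyclic_on_def by blast
    have "f = vscale c (vact lam x (vscale (1/c) g))"
      using \<open>c \<noteq> 0\<close> by (simp only: vact_scale vs.scale_scale g(2)) simp
    then show "\<exists>g\<in>vfin. f = vscale c (vact lam x g)" using vfin_scale[OF g(1)] by blast
  qed
  have "smul (1/c) (smul c x) = x" using assms by (simp add: vec_eq_iff)
  then show ?thesis using *[of x c] *[of "smul c x" "1/c"] assms by auto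
qed

text \<open>The contraction is \<open>y\<close> divided by the scalar by which the identity matrix acts.\<close>

lemma acyclic_on_identity_bracket:
  assumes "x \<in> gl_part 1" "y \<in> gl_part 1" "sbracket x y = mat 1" "(\<Sum>i\<in>UNIV. lam $ i) \<noteq> 0"
  shows "acyclic_on lam x"
  unfolding acyclic_on_def
proof (intro ballI impI)
  fix f assume f: "f \<in> vfin" "vact lam x f = 0"
  let ?C = "\<Sum>i\<in>UNIV. lam $ i"
  \<comment> \<open>Exponents and flags cancel in the sum of the four diagonal operators, since
    every root has coordinate sum zero.\<close>
  have "vact lam (mat 1) f = vscale ?C f"
    by (simp add: vact_def sum_4 vop_simps mat_def)
      (simp add: fun_eq_iff dg_simps algebra_simps)
  moreover have "vact lam x (vact lam y f) = vscale (-1) (vact lam y (vact lam x f)) + vact lam (mat 1) f"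
    using vact_bracket[OF assms(1,2), of lam f] by (simp only: assms(3)) simp
  ultimately have "vact lam x (vact lam y f) = vscale ?C f"
    by (simp only: f(2) v.act_zero vs.scale_zero_right add_0)
  then have "f = vact lam x (vscale (1 / ?C) (vact lam y f))"
    using assms(4) by (simp only: vact_scale vs.scale_scale) simp
  then show "\<exists>g\<in>vfin. f = vact lam x g"
    using vfin_scale[OF vact_vfin[OF f(1)]] by blast
qed

section \<open>Conjugation by the even Borel group\<close>

lemma gl_part_mult: "x \<in> gl_part p \<Longrightarrow> y \<in> gl_part q \<Longrightarrow> x ** y \<in> gl_part ((p + q) mod 2)"
proof -
  assume x: "x \<in> gl_part p" and y: "y \<in> gl_part q"
  have "x $ i $ k * y $ k $ j = 0" if "(par i + par j) mod 2 \<noteq> (p + q) mod 2" for i j k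
  proof -
    have "(par i + par k) mod 2 \<noteq> p \<or> (par k + par j) mod 2 \<noteq> q"
    proof (rule ccontr)
      assume "\<not> ?thesis"
      then have "(p + q) mod 2 = (par i + par k + (par k + par j)) mod 2" by (auto simp: mod_add_eq)
      also have "\<dots> = (par i + par j) mod 2" by presburger
      finally show False using that by simp
    qed
    then show ?thesis using x y by (auto simp: gl_part_def)
  qed
  then show ?thesis by (auto simp: gl_part_def matrix_matrix_mult_def intro!: sum.neutral)
qed

lemma mat_commute: "g ** mat a = mat a ** (g :: gl22)"
proof -
  have "(g ** mat a) $ i $ j = a * g $ i $ j" for i j
    by (simp add: matrix_matrix_mult_def mat_def if_distrib[of "\<lambda>t. _ * t"] cong: if_cong)
  then show ?thesis by (simp only: vec_eq_iff mat_mult_nth) blast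
qed

lemma conj_smul: "g ** smul a z ** h = smul a (g ** z ** h)"
  by (simp only: matrix_mul_assoc mat_commute)

lemma conj_add: "g ** (x + y) ** h = g ** x ** h + g ** y ** (h :: gl22)"
  by (simp add: vec_eq_iff matrix_matrix_mult_def distrib_left distrib_right sum.distrib)

lemma conj_diff: "g ** (x - y) ** h = g ** x ** h - g ** y ** (h :: gl22)"
  by (simp add: vec_eq_iff matrix_matrix_mult_def right_diff_distrib left_diff_distrib sum_subtractf)

lemma conj_mult:
  assumes "h ** g = mat 1"
  shows "g ** x ** h ** (g ** y ** h) = g ** (x ** y) ** (h :: gl22)"
proof -
  have "h ** (g ** z) = z" for z :: gl22 by (simp only: matrix_mul_assoc assms matrix_mul_lid)
  then show ?thesis by (simp only: matrix_mul_assoc[symmetric])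
qed

lemma conj_gl_part:
  assumes "g \<in> gl_part 0" "h \<in> gl_part 0" "x \<in> gl_part p" "p < 2"
  shows "g ** x ** h \<in> gl_part p"
  using gl_part_mult[OF gl_part_mult[OF assms(1,3)] assms(2)] assms(4) by simp

lemma sbracket_conj:
  assumes g: "g \<in> gl_part 0" "h \<in> gl_part 0" "h ** g = mat 1"
    and x: "x \<in> gl_part p" "y \<in> gl_part q" "p < 2" "q < 2"
  shows "sbracket (g ** x ** h) (g ** y ** h) = g ** sbracket x y ** h"
  by (simp only: sbracket_homogeneous[OF conj_gl_part[OF g(1,2) x(1,3)] conj_gl_part[OF g(1,2) x(2,4)] x(3,4)]
      sbracket_homogeneous[OF x] conj_mult[OF g(3)] conj_diff conj_smul)

lemma munit_expand: "x = (\<Sum>i\<in>UNIV. \<Sum>j\<in>UNIV. smul (x $ i $ j) (munit i j))"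
  by (simp add: vec_eq_iff forall_4 sum_4)

text \<open>By the universal property: left multiplication by conjugated matrices makes the
  enveloping algebra a representation, and the automorphism sends \<open>u\<close> to the action of
  \<open>u\<close> on 1.\<close>

lemma env_conj:
  assumes g: "g \<in> gl_part 0" "h \<in> gl_part 0" "h ** g = mat 1"
  obtains \<tau> :: "env_gl22 \<Rightarrow> env_gl22" where
    "\<And>u v. \<tau> (u + v) = \<tau> u + \<tau> v" "\<And>u v. \<tau> (u - v) = \<tau> u - \<tau> v" "\<And>u v. \<tau> (u * v) = \<tau> u * \<tau> v"
    "\<And>x. \<tau> (env_of x) = env_of (g ** x ** h)" "\<And>c. \<tau> (env_scalar c) = env_scalar c"
proof -
  have sum: "env_of (g ** (sum f A) ** h) = (\<Sum>a\<in>A. env_of (g ** f a ** h))" for f :: "4 \<Rightarrow> gl22" and A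
    by (induction A rule: infinite_finite_induct) (simp_all add: conj_add env_of_add)
  have exp: "env_of (g ** x ** h) = (\<Sum>i\<in>UNIV. \<Sum>j\<in>UNIV. env_scalar (x $ i $ j) * env_of (g ** munit i j ** h))" for x
    by (subst munit_expand[of x]) (simp only: sum conj_smul env_of_smul)
  interpret t: gl_rep "\<lambda>c u. env_scalar c * u" "\<lambda>x u. env_of (g ** x ** h) * u"
  proof unfold_locales
    show "env_scalar a * (env_scalar b * u) = env_scalar (a * b) * u" for a b u
      by (simp add: env_scalar_mult mult.assoc)
    show "env_of (g ** x ** h) * u = (\<Sum>i\<in>UNIV. \<Sum>j\<in>UNIV. env_scalar (x $ i $ j) * (env_of (g ** munit i j ** h) * u))" for x u
      by (subst exp) (simp add: sum_distrib_right mult.assoc)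
    show "env_of (g ** x ** h) * (env_of (g ** y ** h) * v) =
       env_scalar ((- 1) ^ (p * q)) * (env_of (g ** y ** h) * (env_of (g ** x ** h) * v)) +
       env_of (g ** sbracket x y ** h) * v"
      if x: "x \<in> gl_part p" "y \<in> gl_part q" "p < 2" "q < 2" for x p y q v
    proof -
      have "(-1) ^ (p * q) = env_scalar ((-1) ^ (p * q))"
        by (cases "even (p * q)") (simp_all add: env_scalar_minus del: even_mult_iff)
      then show ?thesis
        using env_bracket[OF conj_gl_part[OF g(1,2) x(1,3)] conj_gl_part[OF g(1,2) x(2,4)] x(3,4)] unfolding mult.assoc[symmetric]
        by (simp only: sbracket_conj[OF g x] distrib_right mult.assoc)
    qed
  qed (simp_all add: distrib_left distrib_right env_scalar_add env_scalar_left_commute)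
  \<comment> \<open>The action commutes with right multiplication, so it is determined by its value
    on 1; multiplicativity follows.\<close>
  have mul: "t.env_act u w = t.env_act u 1 * w" for u w
  proof (induction u arbitrary: w rule: env_induct)
    case (letter i j u)
    show ?case
      by (simp only: t.env_act_times t.env_act_env_of mult.assoc letter[of w])
  next
    case (add u v)
    show ?case by (simp only: t.env_act_plus distrib_right add[of w])
  qed (simp only: t.env_act_scalar mult_1_right)
  show thesis
  proof (rule that[of "\<lambda>u. t.env_act u 1"])
    show "t.env_act (u * v) 1 = t.env_act u 1 * t.env_act v 1" for u v
      by (simp only: t.env_act_times) (rule mul)
  qed (simp_all only: t.env_act_plus t.env_act_minus t.env_act_env_of t.env_act_scalar mult_1_right)
qed

lemma borel_group_even_inverse:
  assumes "g \<in> borel_group_even"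
  obtains h where "g ** h = mat 1" "h ** g = mat 1" "matrix_inv g = h" "h \<in> borel_group_even"
proof -
  have g: "g \<in> borel_sub" "g \<in> gl_part 0" "invertible g"
    using assms by (auto simp: borel_group_even_def)
  define h where "h = matrix_inv g"
  have h: "g ** h = mat 1" "h ** g = mat 1"
    using someI_ex[OF g(3)[unfolded invertible_def]] by (auto simp: h_def matrix_inv_def)
  have z: "g $ 1 $ 3 = 0" "g $ 1 $ 4 = 0" "g $ 2 $ 3 = 0" "g $ 2 $ 4 = 0"
    "g $ 2 $ 1 = 0" "g $ 3 $ 1 = 0" "g $ 3 $ 2 = 0" "g $ 4 $ 1 = 0" "g $ 4 $ 2 = 0" "g $ 4 $ 3 = 0"
    using g(1,2) by (simp_all add: borel_sub_iff gl_part_def forall_4 par_def)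
  have L: "(\<Sum>k\<in>UNIV. g $ i $ k * h $ k $ j) = (if i = j then 1 else 0)" for i j
    using arg_cong[OF h(1), of "\<lambda>m. m $ i $ j"] by (simp add: matrix_matrix_mult_def mat_def)
  have R: "(\<Sum>k\<in>UNIV. h $ i $ k * g $ k $ j) = (if i = j then 1 else 0)" for i j
    using arg_cong[OF h(2), of "\<lambda>m. m $ i $ j"] by (simp add: matrix_matrix_mult_def mat_def)
  \<comment> \<open>For each index that one of the two products is used in which a single term
    survives. The zeros of \<open>h\<close> follow similarly; positions \<open>(1, 4)\<close> and
    \<open>(3, 2)\<close> need the other ones first.\<close>
  have d: "g $ 1 $ 1 \<noteq> 0" "g $ 2 $ 2 \<noteq> 0" "g $ 3 $ 3 \<noteq> 0" "g $ 4 $ 4 \<noteq> 0"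
    using R[of 1 1] L[of 2 2] R[of 3 3] L[of 4 4] by (auto simp: sum_4 z)
  have 1: "h $ 2 $ 1 = 0" "h $ 2 $ 3 = 0" "h $ 2 $ 4 = 0" "h $ 3 $ 1 = 0" "h $ 4 $ 1 = 0"
    "h $ 1 $ 3 = 0" "h $ 4 $ 3 = 0" "h $ 4 $ 2 = 0"
    using L[of 2 1] L[of 2 3] L[of 2 4] R[of 3 1] R[of 4 1] R[of 1 3] R[of 4 3] L[of 4 2] d
    by (simp_all add: sum_4 z)
  have 2: "h $ 1 $ 4 = 0" "h $ 3 $ 2 = 0"
    using L[of 1 4] L[of 3 2] d by (simp_all add: sum_4 z 1)
  have "h \<in> borel_sub" "h \<in> gl_part 0"
    by (simp_all add: borel_sub_iff gl_part_def forall_4 par_def 1 2)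
  moreover have "invertible h" using h unfolding invertible_def by blast
  ultimately show thesis using that[OF h] by (simp add: borel_group_even_def h_def)
qed

text \<open>All matrices involved are upper triangular, so their diagonals multiply entrywise and
  those of \<open>g\<close> and \<open>h\<close> cancel.\<close>

lemma conj_borel_sub:
  assumes "g \<in> borel_group_even" "h \<in> borel_group_even" "g ** h = mat 1" "b \<in> borel_sub"
  shows "g ** b ** h \<in> borel_sub" "weight_at lam (g ** b ** h) = weight_at lam b"
proof -
  have z: "m $ 2 $ 1 = 0" "m $ 3 $ 1 = 0" "m $ 3 $ 2 = 0" "m $ 4 $ 1 = 0" "m $ 4 $ 2 = 0" "m $ 4 $ 3 = 0"
    if "m \<in> {g, h, b}" for m
    using assms that by (auto simp: borel_sub_iff borel_group_even_def)
  have d: "g $ i $ i * h $ i $ i = 1" for i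
    using arg_cong[OF assms(3), of "\<lambda>m. m $ i $ i"] exhaust_4[of i]
    by (elim disjE) (simp_all add: matrix_matrix_mult_def mat_def sum_4 z)
  show "g ** b ** h \<in> borel_sub"
    by (simp add: borel_sub_iff matrix_matrix_mult_def sum_4 z)
  have "(g ** b ** h) $ i $ i = (g $ i $ i * h $ i $ i) * b $ i $ i" for i
    using exhaust_4[of i]
    by (elim disjE) (simp_all add: matrix_matrix_mult_def sum_4 z)
  then show "weight_at lam (g ** b ** h) = weight_at lam b"
    by (simp add: weight_at_def d)
qed

text \<open>Acyclicity is moved into the enveloping algebra because the automorphisms of
  \<open>env_conj\<close> live there.\<close>

lemma acyclic_on_env:
  "acyclic_on lam x \<longleftrightarrow> (\<forall>u. env_of x * u \<in> verma_rel lam \<longrightarrow> (\<exists>w. u - env_of x * w \<in> verma_rel lam))"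
  unfolding acyclic_on_def vfin_eq_range[of lam] ball_range_iff bex_range_iff vmap_eq_zero_iff[symmetric]
  by (simp only: vmap_simps right_minus_eq)

text \<open>Conjugation by \<open>g\<close> induces an automorphism of the enveloping algebra that preserves the left
  ideal defining the Verma module.\<close>

lemma acyclic_on_conj:
  assumes "g \<in> borel_group_even" "h \<in> borel_group_even" "g ** h = mat 1" "h ** g = mat 1"
    and "acyclic_on lam (g ** x ** h)"
  shows "acyclic_on lam x"
proof -
  have p: "g \<in> gl_part 0" "h \<in> gl_part 0" using assms by (auto simp: borel_group_even_def)
  obtain \<tau> :: "env_gl22 \<Rightarrow> env_gl22" where \<tau>: "\<And>u v. \<tau> (u + v) = \<tau> u + \<tau> v"
      "\<And>u v. \<tau> (u - v) = \<tau> u - \<tau> v" "\<And>u v. \<tau> (u * v) = \<tau> u * \<tau> v"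
    "\<And>x. \<tau> (env_of x) = env_of (g ** x ** h)" "\<And>c. \<tau> (env_scalar c) = env_scalar c"
    using env_conj[OF p assms(4)] by blast
  obtain \<sigma> :: "env_gl22 \<Rightarrow> env_gl22" where \<sigma>: "\<And>u v. \<sigma> (u + v) = \<sigma> u + \<sigma> v"
      "\<And>u v. \<sigma> (u - v) = \<sigma> u - \<sigma> v" "\<And>u v. \<sigma> (u * v) = \<sigma> u * \<sigma> v"
    "\<And>x. \<sigma> (env_of x) = env_of (h ** x ** g)" "\<And>c. \<sigma> (env_scalar c) = env_scalar c"
    using env_conj[OF p(2,1) assms(3)] by blast
  have inv: "h ** (g ** x ** h) ** g = x" for x :: gl22
  proof -
    have "h ** (g ** x ** h) ** g = (h ** g) ** x ** (h ** g)" by (simp only: matrix_mul_assoc)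
    then show ?thesis by (simp only: assms(4) matrix_mul_lid matrix_mul_rid)
  qed
  have \<sigma>\<tau>: "\<sigma> (\<tau> u) = u" for u
    by (induction u rule: env_induct) (simp_all add: \<tau> \<sigma> inv)
  have \<tau>R: "\<tau> u \<in> verma_rel lam" if "u \<in> verma_rel lam" for u
    using that
  proof induction
    case zero
    show ?case using \<tau>(2)[of 0 0] by (simp add: verma_rel.zero)
  next
    case (rel b u)
    show ?case
      using verma_rel.rel[OF conj_borel_sub(1)[OF assms(1-3) rel], of "\<tau> u" lam]
      by (simp add: \<tau> conj_borel_sub(2)[OF assms(1-3) rel])
  qed (simp add: \<tau>(1) verma_rel.add)
  have \<sigma>R: "\<sigma> u \<in> verma_rel lam" if "u \<in> verma_rel lam" for u
    using that
  proof induction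
    case zero
    show ?case using \<sigma>(2)[of 0 0] by (simp add: verma_rel.zero)
  next
    case (rel b u)
    show ?case
      using verma_rel.rel[OF conj_borel_sub(1)[OF assms(2,1,4) rel], of "\<sigma> u" lam]
      by (simp add: \<sigma> conj_borel_sub(2)[OF assms(2,1,4) rel])
  qed (simp add: \<sigma>(1) verma_rel.add)
  show ?thesis
    unfolding acyclic_on_env
  proof (intro allI impI)
    fix u assume "env_of x * u \<in> verma_rel lam"
    from \<tau>R[OF this] have "env_of (g ** x ** h) * \<tau> u \<in> verma_rel lam" by (simp only: \<tau>)
    then obtain w where "\<tau> u - env_of (g ** x ** h) * w \<in> verma_rel lam"
      using assms(5) unfolding acyclic_on_env by blast
    from \<sigma>R[OF this] have "u - env_of x * \<sigma> w \<in> verma_rel lam"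
      by (simp only: \<sigma> \<sigma>\<tau> inv)
    then show "\<exists>w. u - env_of x * w \<in> verma_rel lam" by blast
  qed
qed

section \<open>Odd roots and their root spaces\<close>

definition rt :: "4 \<Rightarrow> 4 \<Rightarrow> weight" where
  "rt i j = axis i 1 - axis j 1"

lemma rt_nth: "rt i j $ k = (if k = i then 1 else 0) - (if k = j then 1 else 0)"
  by (simp add: rt_def axis_def)

lemma rt_eq_iff: "i \<noteq> j \<Longrightarrow> rt i j = rt k l \<longleftrightarrow> i = k \<and> j = l"
  unfolding rt_def by (rule axis_diff_eq_iff)

lemma gl22_add_mult: "(x + y) ** z = x ** z + y ** (z :: gl22)"
  by (simp add: vec_eq_iff matrix_matrix_mult_def distrib_right sum.distrib)

text \<open>Cartan elements are even, so the bracket is the ordinary commutator with a diagonal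
  matrix.\<close>

lemma sbracket_cartan:
  assumes "h \<in> cartan"
  shows "sbracket h x $ k $ l = (h $ k $ k - h $ l $ l) * x $ k $ l"
proof -
  have "even_proj h = h" "odd_proj h = 0"
    using assms by (auto simp: cartan_def even_proj_def odd_proj_def vec_eq_iff) metis+
  moreover have "even_proj x + odd_proj x = x"
    by (simp add: even_proj_def odd_proj_def vec_eq_iff)
  ultimately have "sbracket h x = h ** x - x ** h"
    by (simp add: sbracket_def flip: gl22_add_mult)
  moreover have "(h ** x) $ k $ l = h $ k $ k * x $ k $ l"
  proof -
    have "(h ** x) $ k $ l = (\<Sum>m\<in>UNIV. if k = m then h $ k $ k * x $ k $ l else 0)"
      unfolding matrix_matrix_mult_def vec_lambda_beta
      by (intro sum.cong refl) (use assms in \<open>auto simp: cartan_def\<close>)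
    then show ?thesis by simp
  qed
  moreover have "(x ** h) $ k $ l = h $ l $ l * x $ k $ l"
  proof -
    have "(x ** h) $ k $ l = (\<Sum>m\<in>UNIV. if l = m then h $ l $ l * x $ k $ l else 0)"
      unfolding matrix_matrix_mult_def vec_lambda_beta
      by (intro sum.cong refl) (use assms in \<open>auto simp: cartan_def\<close>)
    then show ?thesis by simp
  qed
  ultimately show ?thesis by (simp add: left_diff_distrib)
qed

text \<open>Testing the eigenvector equation on the diagonal matrix units reads off the coordinates
  of \<open>r\<close> one at a time.\<close>

lemma root_space_entry:
  assumes "x \<in> root_space r" "x $ k $ l \<noteq> 0"
  shows "r = rt k l"
proof -
  have "r $ m = rt k l $ m" for m
  proof -
    have c: "munit m m \<in> cartan" by (auto simp: cartan_def)
    then have "sbracket (munit m m) x $ k $ l = (smul (weight_at r (munit m m)) x) $ k $ l"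
      using assms(1) by (simp add: root_space_def)
    then have "((if k = m then 1 else 0) - (if l = m then 1 else 0)) * x $ k $ l = weight_at r (munit m m) * x $ k $ l"
      by (simp add: sbracket_cartan[OF c])
    moreover have "weight_at r (munit m m) = (\<Sum>i\<in>UNIV. if i = m then r $ m else 0)"
      unfolding weight_at_def by (intro sum.cong) auto
    ultimately show ?thesis using assms(2) by (auto simp: rt_nth)
  qed
  then show ?thesis by (simp add: vec_eq_iff)
qed

lemma munit_root_space: "munit i j \<in> root_space (rt i j)"
proof -
  have "sbracket h (munit i j) $ k $ l = (smul (weight_at (rt i j) h) (munit i j)) $ k $ l" if "h \<in> cartan" for h k l
  proof -
    have "weight_at (rt i j) h = (\<Sum>m\<in>UNIV. (if m = i then h $ i $ i else 0) - (if m = j then h $ j $ j else 0))"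
      unfolding weight_at_def by (intro sum.cong) (auto simp: rt_nth)
    also have "\<dots> = h $ i $ i - h $ j $ j" by (simp add: sum_subtractf)
    finally show ?thesis by (simp add: sbracket_cartan[OF that])
  qed
  then show ?thesis by (simp add: root_space_def vec_eq_iff)
qed

lemma wform_rt:
  "wform (rt i j) (rt k l) = (-1) ^ par i * rt k l $ i - (-1) ^ par j * rt k l $ j"
proof -
  have "wform (rt i j) (rt k l) = (\<Sum>m\<in>UNIV. (if m = i then (-1) ^ par i * rt k l $ i else 0) - (if m = j then (-1) ^ par j * rt k l $ j else 0))"
    unfolding wform_def by (intro sum.cong) (auto simp: rt_nth[of i j])
  then show ?thesis by (simp add: sum_subtractf)
qed

lemma odd_isotropic_roots_eq: "odd_isotropic_roots = {rt i j | i j. par i \<noteq> par j}"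
proof (intro subset_antisym subsetI)
  fix r assume "r \<in> odd_isotropic_roots"
  then obtain x where x: "x \<in> root_space r" "x \<in> gl_part 1" "x \<noteq> 0"
    by (auto simp: odd_isotropic_roots_def)
  then obtain k l where kl: "x $ k $ l \<noteq> 0" by (auto simp: vec_eq_iff)
  then have "(par k + par l) mod 2 = 1" using x(2) unfolding gl_part_def by blast
  then have "par k \<noteq> par l" by auto
  then show "r \<in> {rt i j | i j. par i \<noteq> par j}" using root_space_entry[OF x(1) kl] by blast
next
  fix r assume "r \<in> {rt i j | i j. par i \<noteq> par j}"
  then obtain i j where r: "r = rt i j" and ij: "par i \<noteq> par j" by blast
  then have "i \<noteq> j" by auto
  then have "r \<noteq> 0" "wform r r = 0" "munit i j \<noteq> 0"
    using ij by (auto simp: r wform_rt rt_nth vec_eq_iff par_def split: if_splits intro: exI[of _ i])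
  moreover have "munit i j \<in> gl_part 1" using ij by (auto simp: gl_part_def par_def)
  ultimately show "r \<in> odd_isotropic_roots"
    using munit_root_space[of i j] by (auto simp: odd_isotropic_roots_def r)
qed

text \<open>The root space is spanned by one matrix unit, so the choice in
  \<open>root_vector\<close> is a choice of nonzero factor.\<close>

lemma root_vector_rt:
  assumes "i \<noteq> j"
  obtains c where "c \<noteq> 0" "root_vector (rt i j) = smul c (munit i j)"
proof -
  have "munit i j \<noteq> 0" by (auto simp: vec_eq_iff intro!: exI[of _ i] exI[of _ j])
  then have x: "root_vector (rt i j) \<in> root_space (rt i j)" "root_vector (rt i j) \<noteq> 0"
    using someI[of "\<lambda>x. x \<in> root_space (rt i j) \<and> x \<noteq> 0", OF conjI[OF munit_root_space]]
    by (auto simp: root_vector_def)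
  have z: "root_vector (rt i j) $ k $ l = 0" if "\<not> (k = i \<and> l = j)" for k l
    using root_space_entry[OF x(1), of k l] rt_eq_iff[OF assms] that by auto
  then have "root_vector (rt i j) = smul (root_vector (rt i j) $ i $ j) (munit i j)"
    by (auto simp: vec_eq_iff)
  moreover have "root_vector (rt i j) $ i $ j \<noteq> 0"
    using x(2) z unfolding vec_eq_iff by (metis zero_index)
  ultimately show thesis using that by blast
qed

section \<open>Sets of roots\<close>

text \<open>Distinct roots sharing an index in the same position leave a single nonzero term in the
  form. Sharing crosswise, \<open>i = l\<close> or \<open>j = k\<close>, must happen in both places
  for the terms to cancel.\<close>

lemma rt_orthogonal_cases:
  assumes "par i \<noteq> par j" "par k \<noteq> par l" "rt i j \<noteq> rt k l" "wform (rt i j) (rt k l) = 0"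
  shows "i = l \<and> j = k \<or> distinct [i, j, k, l]"
proof -
  have s: "(-1) ^ par m \<noteq> (0::complex)" for m by simp
  have ij: "i \<noteq> j" "k \<noteq> l" using assms(1,2) by auto
  have w: "(-1) ^ par i * rt k l $ i = ((-1) ^ par j * rt k l $ j :: complex)"
    using assms(4) by (simp add: wform_rt)
  have "i \<noteq> k"
  proof
    assume "i = k"
    then have "j \<noteq> k" "j \<noteq> l" "i \<noteq> l" using assms(3) ij by auto
    then show False using w \<open>i = k\<close> by (simp add: rt_nth)
  qed
  moreover have "j \<noteq> l"
  proof
    assume "j = l"
    then have "i \<noteq> k" "i \<noteq> l" "j \<noteq> k" using assms(3) ij by auto
    then show False using w \<open>j = l\<close> by (simp add: rt_nth)
  qed
  moreover have "i = l \<longleftrightarrow> j = k"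
    using w ij calculation by (auto simp: rt_nth split: if_splits)
  ultimately show ?thesis using ij by auto
qed

lemma opposite_dependent:
  assumes "rt i j \<in> S" "rt j i \<in> S" "i \<noteq> j"
  shows "\<not> vec.independent S"
proof -
  have "rt j i = (-1) *s rt i j" by (simp add: vec_eq_iff rt_nth)
  moreover have "rt i j \<in> S - {rt j i}" using assms by (simp add: rt_eq_iff)
  ultimately have "rt j i \<in> vec.span (S - {rt j i})"
    by (metis vec.span_base vec.span_scale)
  then show ?thesis using assms(2) unfolding vec.dependent_def by blast
qed

lemma root_sets_cases:
  assumes "S \<in> root_sets"
  obtains "S = {}" | i j where "par i \<noteq> par j" "S = {rt i j}"
  | i j k l where "par i \<noteq> par j" "par k \<noteq> par l" "distinct [i, j, k, l]" "S = {rt i j, rt k l}"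
proof -
  have S: "S \<subseteq> {rt i j | i j. par i \<noteq> par j}" "vec.independent S"
    and o: "\<And>r s. r \<in> S \<Longrightarrow> s \<in> S \<Longrightarrow> r \<noteq> s \<Longrightarrow> wform r s = 0"
    using assms by (auto simp: root_sets_def odd_isotropic_roots_eq mutually_orthogonal_def)
  have d: "distinct [i, j, k, l]"
    if "rt i j \<in> S" "rt k l \<in> S" "rt i j \<noteq> rt k l" "par i \<noteq> par j" "par k \<noteq> par l" for i j k l
    using rt_orthogonal_cases[OF that(4,5,3) o[OF that(1-3)]] opposite_dependent[of i j S] that S(2) by blast
  consider "S = {}" | r where "S = {r}" | r s where "r \<in> S" "s \<in> S" "r \<noteq> s" by blast
  then show thesis
  proof cases
    case 1
    then show thesis by (rule that)
  next
    case (2 r)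
    then show thesis using S(1) that(2) by blast
  next
    case (3 r s)
    obtain i j where r: "r = rt i j" "par i \<noteq> par j" using 3 S(1) by blast
    obtain k l where s: "s = rt k l" "par k \<noteq> par l" using 3 S(1) by blast
    have ijkl: "distinct [i, j, k, l]" using d 3 r s by blast
    have "card {i, j, k, l} = 4" using ijkl by simp
    \<comment> \<open>Two orthogonal independent roots use up all four indices, so no index is left
      for a third root.\<close>
    then have U: "{i, j, k, l} = UNIV" by (intro card_subset_eq) simp_all
    have "t \<in> {r, s}" if "t \<in> S" for t
    proof (rule ccontr)
      assume "t \<notin> {r, s}"
      obtain m n where t: "t = rt m n" "par m \<noteq> par n" using \<open>t \<in> S\<close> S(1) by blast
      have "distinct [m, n, i, j]" "distinct [m, n, k, l]"
        using d \<open>t \<in> S\<close> \<open>t \<notin> {r, s}\<close> 3 r s t by blast+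
      then have "m \<notin> {i, j, k, l}" by auto
      then show False using U by blast
    qed
    then have "S = {rt i j, rt k l}" using 3 r s by blast
    then show thesis using that(3) r s ijkl by blast
  qed
qed

lemma mat_1_borel_group: "mat 1 \<in> borel_group_even"
proof -
  have "invertible (mat 1 :: gl22)"
    unfolding invertible_def by (rule exI[of _ "mat 1"]) simp
  then show ?thesis
    by (auto simp: borel_group_even_def borel_sub_iff gl_part_def mat_def)
qed

lemma gl22_mult_add: "x ** (y + z) = x ** y + x ** (z :: gl22)"
  by (simp add: vec_eq_iff matrix_matrix_mult_def distrib_left sum.distrib)

lemma smul_mult_smul: "smul a x ** smul b y = smul (a * b) (x ** (y :: gl22))"
proof -
  have "smul a x ** smul b y = mat a ** (x ** mat b) ** y" by (simp only: matrix_mul_assoc)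
  also have "\<dots> = (mat a ** mat b) ** (x ** y)" by (simp only: mat_commute[of x] matrix_mul_assoc)
  also have "mat a ** mat b = (mat (a * b) :: gl22)" by (simp add: vec_eq_iff) (simp add: mat_def)
  finally show ?thesis .
qed

lemma sum_root_vectors_acyclic:
  assumes ij: "par i \<noteq> par j" "par k \<noteq> par l" "distinct [i, j, k, l]"
    and c: "a \<noteq> 0" "b \<noteq> 0" and lam: "(\<Sum>i\<in>UNIV. lam $ i) \<noteq> 0"
  shows "acyclic_on lam (smul a (munit i j) + smul b (munit k l))"
proof (rule acyclic_on_identity_bracket[OF _ _ _ lam])
  \<comment> \<open>\<open>?y\<close> combines the opposite root vectors with inverse coefficients;
    the anticommutator is then the sum of the four diagonal matrix units.\<close>
  let ?x = "smul a (munit i j) + smul b (munit k l)" and ?y = "smul (1/a) (munit j i) + smul (1/b) (munit l k)"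
  show x: "?x \<in> gl_part 1" using ij(1,2) by (auto simp: gl_part_def par_def)
  show y: "?y \<in> gl_part 1" using ij(1,2) by (auto simp: gl_part_def par_def)
  have "card {i, j, k, l} = 4" using ij(3) by simp
  then have "{i, j, k, l} = UNIV" by (intro card_subset_eq) simp_all
  have m1: "(mat 1 :: gl22) $ m $ n = (if m = n then 1 else 0)" for m n
    by (simp add: mat_def)
  from \<open>{i, j, k, l} = UNIV\<close> have U: "m = i \<or> m = j \<or> m = k \<or> m = l" for m by blast
  have 1: "smul 1 z = z" "smul c 0 = 0" for z :: gl22 and c by (simp_all add: vec_eq_iff)
  have "?x ** ?y = munit i i + munit k k"
    using ij(3) c by (auto simp add: gl22_add_mult gl22_mult_add smul_mult_smul munit_mult 1)
  moreover have "?y ** ?x = munit j j + munit l l"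
    using ij(3) c by (auto simp add: gl22_add_mult gl22_mult_add smul_mult_smul munit_mult 1)
  ultimately have "sbracket ?x ?y = munit i i + munit k k - smul (-1) (munit j j + munit l l)"
    by (simp add: sbracket_homogeneous[OF x y])
  also have "\<dots> $ m $ n = mat 1 $ m $ n" for m n
    using U[of m] ij(3) by (auto simp: m1)
  then have "munit i i + munit k k - smul (-1) (munit j j + munit l l) = mat 1"
    by (simp only: vec_eq_iff) blast
  finally show "sbracket ?x ?y = mat 1" .
qed

lemma orbit_of_base: "(\<Sum>r\<in>S. root_vector r) \<in> orbit_of S"
proof -
  obtain h where h: "mat 1 ** h = (mat 1 :: gl22)" "matrix_inv (mat 1) = h"
    using borel_group_even_inverse[OF mat_1_borel_group] by blast
  then have "matrix_inv (mat 1) = (mat 1 :: gl22)" by simp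
  then have "(\<Sum>r\<in>S. root_vector r) = mat 1 ** (\<Sum>r\<in>S. root_vector r) ** matrix_inv (mat 1)" by simp
  then show ?thesis unfolding orbit_of_def using mat_1_borel_group by blast
qed

lemma singleton_root_sets:
  assumes "par i \<noteq> par j"
  shows "{rt i j} \<in> root_sets"
proof -
  have "rt i j \<noteq> 0" using assms by (auto simp: vec_eq_iff rt_nth intro!: exI[of _ i])
  then show ?thesis using assms
    by (auto simp: root_sets_def odd_isotropic_roots_eq mutually_orthogonal_def)
qed

text \<open>The base point of the orbit is a nonzero multiple of a matrix unit, and failure of
  acyclicity spreads from it over the orbit by \<open>acyclic_on_conj\<close>.\<close>

lemma singleton_root_sets_of_iff:
  assumes ij: "par i \<noteq> par j"
  shows "{rt i j} \<in> root_sets_of lam \<longleftrightarrow> \<not> acyclic_on lam (munit i j)"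
proof -
  let ?V = "assoc_variety (verma lam) (verma_zero lam) (verma_act lam)"
  have "i \<noteq> j" using ij by auto
  then obtain c where c: "c \<noteq> 0" "root_vector (rt i j) = smul c (munit i j)" by (rule root_vector_rt)
  let ?x = "smul c (munit i j)"
  have x: "?x \<in> gl_part 1" using ij by (auto simp: gl_part_def par_def)
  have "sbracket ?x ?x = 0"
    using \<open>i \<noteq> j\<close> by (simp add: sbracket_homogeneous[OF x x] smul_mult_smul munit_mult)
  then have "g ** ?x ** h \<in> self_commuting" if "g \<in> gl_part 0" "h \<in> gl_part 0" "h ** g = mat 1" for g h
    using conj_gl_part[OF that(1,2) x] sbracket_conj[OF that x x]
    by (simp add: self_commuting_def)
  then have V: "g ** ?x ** h \<in> ?V \<longleftrightarrow> \<not> acyclic_on lam (g ** ?x ** h)"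
    if "g \<in> borel_group_even" "h \<in> borel_group_even" "h ** g = mat 1" for g h
    using assoc_variety_iff that by (auto simp: borel_group_even_def)
  show ?thesis
  proof
    assume "{rt i j} \<in> root_sets_of lam"
    then have "?x \<in> ?V"
      using orbit_of_base[of "{rt i j}"] by (auto simp: root_sets_of_def c(2))
    then have "\<not> acyclic_on lam ?x"
      using V[OF mat_1_borel_group mat_1_borel_group] by simp
    then show "\<not> acyclic_on lam (munit i j)" using acyclic_on_smul[OF c(1)] by blast
  next
    assume *: "\<not> acyclic_on lam (munit i j)"
    have "orbit_of {rt i j} \<subseteq> ?V"
    proof
      fix y assume "y \<in> orbit_of {rt i j}"
      then obtain g where g: "g \<in> borel_group_even" "y = g ** ?x ** matrix_inv g"
        by (auto simp: orbit_of_def c(2))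
      obtain h where h: "g ** h = mat 1" "h ** g = mat 1" "matrix_inv g = h" "h \<in> borel_group_even"
        using borel_group_even_inverse[OF g(1)] .
      have "\<not> acyclic_on lam (g ** ?x ** h)"
        using acyclic_on_conj[OF g(1) h(4,1,2)] acyclic_on_smul[OF c(1)] * by blast
      then show "y \<in> ?V" using V[OF g(1) h(4,2)] by (simp add: g(2) h(3))
    qed
    then show "{rt i j} \<in> root_sets_of lam"
      using singleton_root_sets[OF ij] by (simp add: root_sets_of_def)
  qed
qed

text \<open>The orbit consists of the zero matrix, with zero image and the whole module as kernel;
  \<open>v0\<close> shows that the module is nonzero.\<close>

lemma empty_root_sets_of: "{} \<in> root_sets_of lam"
proof -
  have z: "0 \<in> self_commuting"
    by (simp add: self_commuting_def gl_part_def sbracket_def even_proj_def odd_proj_def vec_eq_iff matrix_matrix_mult_def cong: if_cong)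
  have "\<not> acyclic_on lam 0"
  proof
    assume "acyclic_on lam 0"
    then have "v0 = 0" using vfin_vb[of "(0, 0, False, False, False, False)"]
      unfolding acyclic_on_def vact_zero by blast
    then have "v0 0 0 False False False False = 0" by (simp only: zero_fun_apply)
    then show False by (simp add: vb_def)
  qed
  then have "0 \<in> assoc_variety (verma lam) (verma_zero lam) (verma_act lam)"
    using assoc_variety_iff[OF z] by blast
  moreover have "orbit_of {} \<subseteq> {0}"
    by (auto simp: orbit_of_def vec_eq_iff matrix_matrix_mult_def)
  moreover have "{} \<in> root_sets"
    by (simp add: root_sets_def mutually_orthogonal_def vec.independent_empty)
  ultimately show ?thesis by (auto simp: root_sets_of_def)
qed

text \<open>Negative roots drop out by their contractions, and pairs of roots by
  \<open>sum_root_vectors_acyclic\<close>, which is where the hypothesis on \<open>lam\<close>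
  enters.\<close>

lemma root_sets_of_iff:
  assumes lam: "(\<Sum>i\<in>UNIV. lam $ i) \<noteq> 0"
  shows "S \<in> root_sets_of lam \<longleftrightarrow> S = {} \<or>
    S = {rt 2 3} \<and> \<not> acyclic_on lam (munit 2 3) \<or> S = {rt 1 3} \<and> \<not> acyclic_on lam (munit 1 3) \<or>
    S = {rt 2 4} \<and> \<not> acyclic_on lam (munit 2 4) \<or> S = {rt 1 4} \<and> \<not> acyclic_on lam (munit 1 4)"
    (is "_ \<longleftrightarrow> ?R S")
proof
  assume S: "S \<in> root_sets_of lam"
  then have "S \<in> root_sets" by (simp add: root_sets_of_def)
  then show "?R S"
  proof (cases rule: root_sets_cases)
    case (2 i j)
    then have "\<not> acyclic_on lam (munit i j)" using S singleton_root_sets_of_iff by blast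
    then show ?thesis
      using exhaust_4[of i] exhaust_4[of j] 2 acyclic_on_31 acyclic_on_32 acyclic_on_41 acyclic_on_42
      by (elim disjE) (simp_all add: par_def)
  next
    case (3 i j k l)
    then have "i \<noteq> j" "k \<noteq> l" "rt i j \<noteq> rt k l" by (auto simp: rt_eq_iff)
    obtain a where a: "a \<noteq> 0" "root_vector (rt i j) = smul a (munit i j)"
      using root_vector_rt[OF \<open>i \<noteq> j\<close>] .
    obtain b where b: "b \<noteq> 0" "root_vector (rt k l) = smul b (munit k l)"
      using root_vector_rt[OF \<open>k \<noteq> l\<close>] .
    have "smul a (munit i j) + smul b (munit k l) \<in> orbit_of S"
      using orbit_of_base[of S] \<open>rt i j \<noteq> rt k l\<close> by (simp add: 3(4) a b)
    then have "smul a (munit i j) + smul b (munit k l) \<in> assoc_variety (verma lam) (verma_zero lam) (verma_act lam)"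
      using S by (auto simp: root_sets_of_def)
    moreover from this have "smul a (munit i j) + smul b (munit k l) \<in> self_commuting"
      by (simp add: assoc_variety_def)
    ultimately have "\<not> acyclic_on lam (smul a (munit i j) + smul b (munit k l))"
      using assoc_variety_iff by blast
    then show ?thesis using sum_root_vectors_acyclic[OF 3(1-3) a(1) b(1) lam] by blast
  qed blast
next
  assume "?R S"
  then show "S \<in> root_sets_of lam"
    using empty_root_sets_of singleton_root_sets_of_iff[of 2 3] singleton_root_sets_of_iff[of 1 3]
      singleton_root_sets_of_iff[of 2 4] singleton_root_sets_of_iff[of 1 4]
    by (auto simp: par_def)
qed

section \<open>Weights of atypicality one\<close>

lemma vector_4 [simp]:
  "(vector [x, y, z, w] :: 'a::zero^4) $ 1 = x" "(vector [x, y, z, w] :: 'a^4) $ 2 = y"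
  "(vector [x, y, z, w] :: 'a^4) $ 3 = z" "(vector [x, y, z, w] :: 'a^4) $ 4 = w"
  by (simp_all add: vector_def)

lemma mu_nth:
  "mu lam $ 1 = lam $ 1 - 1" "mu lam $ 2 = lam $ 2 - 2" "mu lam $ 3 = - lam $ 3 - 2" "mu lam $ 4 = - lam $ 4 - 1"
  by (simp_all add: mu_def wform_def dshift_def sum_4 par_def axis_def)

text \<open>Positive integers: the values of a coordinate difference at which some coefficient of
  \<open>zd\<close> or \<open>wd\<close> vanishes.\<close>

abbreviation pos_nat :: "complex \<Rightarrow> bool" where
  "pos_nat z \<equiv> \<exists>n. z = of_nat (Suc n)"

lemma za_eq_0_iff: "za lam i = 0 \<longleftrightarrow> mu lam $ 1 - mu lam $ 2 = of_nat (Suc i)"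
proof -
  have "of_nat i + 1 \<noteq> (0::complex)" by (metis of_nat_Suc of_nat_neq_0 add.commute)
  then have "za lam i = 0 \<longleftrightarrow> lam $ 1 - lam $ 2 - of_nat i = 0"
    unfolding za_def by (simp only: mult_eq_0_iff simp_thms)
  then show ?thesis by (auto simp: mu_nth algebra_simps)
qed

lemma wa_eq_0_iff: "wa lam i = 0 \<longleftrightarrow> mu lam $ 4 - mu lam $ 3 = of_nat (Suc i)"
proof -
  have "of_nat i + 1 \<noteq> (0::complex)" by (metis of_nat_Suc of_nat_neq_0 add.commute)
  then have "wa lam i = 0 \<longleftrightarrow> lam $ 3 - lam $ 4 - of_nat i = 0"
    unfolding wa_def by (simp only: mult_eq_0_iff simp_thms)
  then show ?thesis by (auto simp: mu_nth algebra_simps)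
qed

lemma h_mu:
  "h13 lam i j q r = mu lam $ 1 - mu lam $ 3 - 1 - of_nat i - of_nat j + nb q - nb r"
  "h24 lam i j q r = mu lam $ 2 - mu lam $ 4 + 1 + of_nat i + of_nat j - nb q + nb r"
  "h14 lam i j p s = mu lam $ 1 - mu lam $ 4 - of_nat i + of_nat j - nb p + nb s"
  "h23 lam i j p s = mu lam $ 2 - mu lam $ 3 + of_nat i - of_nat j + nb p - nb s"
  by (simp_all add: h13_def h24_def h14_def h23_def mu_nth)

lemma acyclic_on_23_iff: "acyclic_on lam (munit 2 3) \<longleftrightarrow> mu lam $ 2 \<noteq> mu lam $ 3"
proof
  assume "mu lam $ 2 \<noteq> mu lam $ 3"
  then show "acyclic_on lam (munit 2 3)"
    by (intro acyclic_on_23 notI) (auto simp: h_mu mharm_def)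
next
  assume *: "acyclic_on lam (munit 2 3)"
  show "mu lam $ 2 \<noteq> mu lam $ 3"
    using not_acyclic_on_23[of lam 0 0 False False] * by (auto simp: h_mu)
qed

lemma zharm_cases:
  assumes "zharm lam i b"
  obtains "i = 0" "b" | n where "mu lam $ 1 - mu lam $ 2 = of_nat (Suc n)" "i = n" "\<not> b"
  | n where "mu lam $ 1 - mu lam $ 2 = of_nat (Suc n)" "i = Suc n" "b"
  using assms by (cases b; cases i) (auto simp: za_eq_0_iff simp del: of_nat_Suc)

lemma wharm_cases:
  assumes "wharm lam i b"
  obtains "i = 0" "b" | n where "mu lam $ 4 - mu lam $ 3 = of_nat (Suc n)" "i = n" "\<not> b"
  | n where "mu lam $ 4 - mu lam $ 3 = of_nat (Suc n)" "i = Suc n" "b"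
  using assms by (cases b; cases i) (auto simp: wa_eq_0_iff simp del: of_nat_Suc)

lemma acyclic_on_13_iff:
  "\<not> acyclic_on lam (munit 1 3) \<longleftrightarrow>
    mu lam $ 1 = mu lam $ 3 \<or> mu lam $ 2 = mu lam $ 3 \<and> pos_nat (mu lam $ 1 - mu lam $ 2)"
  (is "_ \<longleftrightarrow> ?R")
proof
  assume "\<not> acyclic_on lam (munit 1 3)"
  then obtain i j q r where h: "h13 lam i j q r = 0" "zharm lam i q" "mharm j r"
    using acyclic_on_13 by blast
  from h(2) h(1,3) show ?R
    by (cases rule: zharm_cases) (auto simp: h_mu mharm_def algebra_simps)
next
  assume ?R
  then show "\<not> acyclic_on lam (munit 1 3)"
  proof (elim disjE conjE exE)
    assume "mu lam $ 1 = mu lam $ 3"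
    \<comment> \<open>\<open>z^0\<close> is killed by \<open>zd\<close>, and the set flag cancels
      the constant -1 in the coroot eigenvalue. In the second case the witness is
      \<open>z^n\<close>, a monomial that the image of \<open>zd\<close> misses.\<close>
    then show ?thesis by (intro not_acyclic_on_13[of lam 0 0 True False]) (auto simp: h_mu)
  next
    fix n assume "mu lam $ 2 = mu lam $ 3" "mu lam $ 1 - mu lam $ 2 = of_nat (Suc n)"
    then show ?thesis
      by (intro not_acyclic_on_13[of lam n 0 False False]) (auto simp: h_mu za_eq_0_iff)
  qed
qed

lemma acyclic_on_24_iff:
  "\<not> acyclic_on lam (munit 2 4) \<longleftrightarrow>
    mu lam $ 2 = mu lam $ 4 \<or> mu lam $ 2 = mu lam $ 3 \<and> pos_nat (mu lam $ 4 - mu lam $ 3)"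
  (is "_ \<longleftrightarrow> ?R")
proof
  assume "\<not> acyclic_on lam (munit 2 4)"
  then obtain i j q r where h: "h24 lam i j q r = 0" "wharm lam j q" "mharm i r"
    using acyclic_on_24 by blast
  from h(2) h(1,3) show ?R
    by (cases rule: wharm_cases) (auto simp: h_mu mharm_def algebra_simps)
next
  assume ?R
  then show "\<not> acyclic_on lam (munit 2 4)"
  proof (elim disjE conjE exE)
    assume "mu lam $ 2 = mu lam $ 4"
    then show ?thesis by (intro not_acyclic_on_24[of lam 0 0 True False]) (auto simp: h_mu)
  next
    fix n assume "mu lam $ 2 = mu lam $ 3" "mu lam $ 4 - mu lam $ 3 = of_nat (Suc n)"
    then show ?thesis
      by (intro not_acyclic_on_24[of lam 0 n False False]) (auto simp: h_mu wa_eq_0_iff algebra_simps)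
  qed
qed

lemma acyclic_on_14_iff:
  "\<not> acyclic_on lam (munit 1 4) \<longleftrightarrow>
    mu lam $ 1 = mu lam $ 4 \<or>
    mu lam $ 1 = mu lam $ 3 \<and> pos_nat (mu lam $ 4 - mu lam $ 3) \<or>
    mu lam $ 2 = mu lam $ 4 \<and> pos_nat (mu lam $ 1 - mu lam $ 2) \<or>
    mu lam $ 2 = mu lam $ 3 \<and> pos_nat (mu lam $ 1 - mu lam $ 2) \<and> pos_nat (mu lam $ 4 - mu lam $ 3)"
  (is "_ \<longleftrightarrow> ?R")
proof
  assume "\<not> acyclic_on lam (munit 1 4)"
  then obtain i j p s where h: "h14 lam i j p s = 0" "zharm lam i s" "wharm lam j p"
    using acyclic_on_14 by blast
  \<comment> \<open>The contributions of the two variables to the coroot eigenvalue. Harmonicity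
    leaves two values for each, as kernel and cokernel at a zero of the coefficient contribute
    equally; the four combinations are the four alternatives of the claim.\<close>
  define X Y where "X = nb s - of_nat i" and "Y = of_nat j - nb p"
  have XY: "mu lam $ 1 - mu lam $ 4 + X + Y = 0"
    using h(1) by (simp add: h_mu X_def Y_def algebra_simps)
  have X: "X = 1 \<or> pos_nat (mu lam $ 1 - mu lam $ 2) \<and> X = 1 - (mu lam $ 1 - mu lam $ 2)"
    using h(2) unfolding X_def by (cases rule: zharm_cases) auto
  have Y: "Y = -1 \<or> pos_nat (mu lam $ 4 - mu lam $ 3) \<and> Y = mu lam $ 4 - mu lam $ 3 - 1"
    using h(3) unfolding Y_def by (cases rule: wharm_cases) auto
  from X Y show ?R
  proof (elim disjE conjE)
    assume "X = 1" "Y = -1"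
    then show ?thesis using XY by simp
  next
    assume "X = 1" "Y = mu lam $ 4 - mu lam $ 3 - 1" "pos_nat (mu lam $ 4 - mu lam $ 3)"
    moreover from this have "mu lam $ 1 = mu lam $ 3" using XY by simp
    ultimately show ?thesis by blast
  next
    assume "X = 1 - (mu lam $ 1 - mu lam $ 2)" "Y = -1" "pos_nat (mu lam $ 1 - mu lam $ 2)"
    moreover from this have "mu lam $ 2 = mu lam $ 4" using XY by simp
    ultimately show ?thesis by blast
  next
    assume "X = 1 - (mu lam $ 1 - mu lam $ 2)" "Y = mu lam $ 4 - mu lam $ 3 - 1"
      "pos_nat (mu lam $ 1 - mu lam $ 2)" "pos_nat (mu lam $ 4 - mu lam $ 3)"
    moreover from this have "mu lam $ 2 = mu lam $ 3" using XY by simp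
    ultimately show ?thesis by blast
  qed
next
  assume ?R
  then show "\<not> acyclic_on lam (munit 1 4)"
  proof (elim disjE conjE exE)
    assume "mu lam $ 1 = mu lam $ 4"
    then show ?thesis by (intro not_acyclic_on_14[of lam 0 0 True True]) (auto simp: h_mu)
  next
    fix n assume "mu lam $ 1 = mu lam $ 3" "mu lam $ 4 - mu lam $ 3 = of_nat (Suc n)"
    then show ?thesis
      by (intro not_acyclic_on_14[of lam 0 n False True]) (auto simp: h_mu wa_eq_0_iff algebra_simps)
  next
    fix n assume "mu lam $ 2 = mu lam $ 4" "mu lam $ 1 - mu lam $ 2 = of_nat (Suc n)"
    then show ?thesis
      by (intro not_acyclic_on_14[of lam n 0 True False]) (auto simp: h_mu za_eq_0_iff algebra_simps)
  next
    fix m n assume "mu lam $ 2 = mu lam $ 3" "mu lam $ 1 - mu lam $ 2 = of_nat (Suc m)" "mu lam $ 4 - mu lam $ 3 = of_nat (Suc n)"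
    then show ?thesis
      by (intro not_acyclic_on_14[of lam m n False False]) (auto simp: h_mu za_eq_0_iff wa_eq_0_iff algebra_simps)
  qed
qed

lemma sum_weight: "(\<Sum>i\<in>UNIV. lam $ i) = mu lam $ 1 + mu lam $ 2 - mu lam $ 3 - mu lam $ 4"
  by (simp add: sum_4 mu_nth)

lemma rho_eq: "rho = vector [-1/2, -3/2, 3/2, 1/2]"
proof -
  have "eps1 - eps2 \<noteq> del1 - del2" "eps1 - del1 \<noteq> eps1 - del2" "eps1 - del1 \<noteq> eps2 - del1"
    "eps1 - del1 \<noteq> eps2 - del2" "eps1 - del2 \<noteq> eps2 - del1" "eps1 - del2 \<noteq> eps2 - del2" "eps2 - del1 \<noteq> eps2 - del2"
    by (simp_all add: axis_diff_eq_iff)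
  then have "(\<Sum>r\<in>pos_even_roots. r) = (eps1 - eps2) + (del1 - del2)"
    "(\<Sum>r\<in>pos_odd_roots. r) = (eps1 - del1) + ((eps1 - del2) + ((eps2 - del1) + (eps2 - del2)))"
    by (simp_all add: pos_even_roots_def pos_odd_roots_def)
  then show ?thesis
    by (simp add: rho_def vec_eq_iff forall_4 axis_def)
qed

lemma wform_rho_rt:
  "wform (lam + rho) (rt 1 3) = mu lam $ 1 - mu lam $ 3" "wform (lam + rho) (rt 1 4) = mu lam $ 1 - mu lam $ 4"
  "wform (lam + rho) (rt 2 3) = mu lam $ 2 - mu lam $ 3" "wform (lam + rho) (rt 2 4) = mu lam $ 2 - mu lam $ 4"
  by (simp_all add: wform_def sum_4 par_def rt_nth mu_nth rho_eq)

lemma pos_odd_roots_eq: "pos_odd_roots = {rt 1 3, rt 1 4, rt 2 3, rt 2 4}"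
  by (simp add: pos_odd_roots_def rt_def)

text \<open>The pairings of \<open>lam + rho\<close> with the odd roots are differences of
  coordinates of \<open>mu lam\<close>. Two simultaneous equalities are excluded because they would
  provide an orthogonal pair of roots.\<close>

lemma atypicality_1:
  assumes "atypicality lam = 1"
  shows "mu lam $ 1 = mu lam $ 3 \<or> mu lam $ 1 = mu lam $ 4 \<or> mu lam $ 2 = mu lam $ 3 \<or> mu lam $ 2 = mu lam $ 4"
    "\<not> (mu lam $ 1 = mu lam $ 3 \<and> mu lam $ 2 = mu lam $ 4)" "\<not> (mu lam $ 1 = mu lam $ 4 \<and> mu lam $ 2 = mu lam $ 3)"
proof -
  let ?P = "\<lambda>A. A \<subseteq> pos_odd_roots \<and> mutually_orthogonal A \<and> (\<forall>r\<in>A. wform (lam + rho) r = 0)"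
  \<comment> \<open>\<open>Max\<close> has its usual meaning on finite nonempty sets.\<close>
  have fin: "finite {card A | A. ?P A}"
    by (rule finite_surj[of "Pow pos_odd_roots" _ card]) (auto simp: pos_odd_roots_def)
  have "?P {}" by (simp add: mutually_orthogonal_def)
  then have ne: "{card A | A. ?P A} \<noteq> {}" by blast
  have M: "Max {card A | A. ?P A} = 1" using assms by (simp add: atypicality_def)
  then have "1 \<in> {card A | A. ?P A}" using Max_in[OF fin ne] by simp
  then obtain A where A: "?P A" "card A = 1" by auto
  then obtain r where "A = {r}" by (auto simp: card_1_singleton_iff)
  then have "r \<in> {rt 1 3, rt 1 4, rt 2 3, rt 2 4}" "wform (lam + rho) r = 0"
    using A(1) by (auto simp: pos_odd_roots_eq)
  then show "mu lam $ 1 = mu lam $ 3 \<or> mu lam $ 1 = mu lam $ 4 \<or> mu lam $ 2 = mu lam $ 3 \<or> mu lam $ 2 = mu lam $ 4"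
    by (auto simp: wform_rho_rt)
  have le: "card A \<le> 1" if "?P A" for A
    using Max_ge[OF fin, of "card A"] that M by auto
  show "\<not> (mu lam $ 1 = mu lam $ 3 \<and> mu lam $ 2 = mu lam $ 4)"
  proof
    assume *: "mu lam $ 1 = mu lam $ 3 \<and> mu lam $ 2 = mu lam $ 4"
    have o: "wform (rt 1 3) (rt 2 4) = 0" "wform (rt 2 4) (rt 1 3) = 0"
      by (simp_all add: wform_rt rt_nth)
    have "?P {rt 1 3, rt 2 4}"
      using * by (simp add: pos_odd_roots_eq mutually_orthogonal_def wform_rho_rt o)
    moreover have "card {rt 1 3, rt 2 4} = 2" by (simp add: rt_eq_iff)
    ultimately show False using le[of "{rt 1 3, rt 2 4}"] by linarith
  qed
  show "\<not> (mu lam $ 1 = mu lam $ 4 \<and> mu lam $ 2 = mu lam $ 3)"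
  proof
    assume *: "mu lam $ 1 = mu lam $ 4 \<and> mu lam $ 2 = mu lam $ 3"
    have o: "wform (rt 1 4) (rt 2 3) = 0" "wform (rt 2 3) (rt 1 4) = 0"
      by (simp_all add: wform_rt rt_nth)
    have "?P {rt 1 4, rt 2 3}"
      using * by (simp add: pos_odd_roots_eq mutually_orthogonal_def wform_rho_rt o)
    moreover have "card {rt 1 4, rt 2 3} = 2" by (simp add: rt_eq_iff)
    ultimately show False using le[of "{rt 1 4, rt 2 3}"] by linarith
  qed
qed

text \<open>Zero is split off because it enters differently: it makes further coordinates of the
  weight coincide, whereas a positive value makes a coefficient of \<open>zd\<close> or
  \<open>wd\<close> vanish.\<close>

lemma Nats_iff_pos_nat: "z \<in> \<nat> \<longleftrightarrow> z = 0 \<or> pos_nat z"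
proof
  assume "z \<in> \<nat>"
  then obtain n where "z = of_nat n" by (rule Nats_cases)
  then show "z = 0 \<or> pos_nat z" by (cases n) auto
qed (auto simp del: of_nat_Suc)

lemma root_sets_of_iff_mu:
  assumes "mu lam $ 1 + mu lam $ 2 \<noteq> mu lam $ 3 + mu lam $ 4"
  shows "S \<in> root_sets_of lam \<longleftrightarrow> S = {} \<or>
    S = {rt 2 3} \<and> mu lam $ 2 = mu lam $ 3 \<or>
    S = {rt 1 3} \<and> (mu lam $ 1 = mu lam $ 3 \<or> mu lam $ 2 = mu lam $ 3 \<and> pos_nat (mu lam $ 1 - mu lam $ 2)) \<or>
    S = {rt 2 4} \<and> (mu lam $ 2 = mu lam $ 4 \<or> mu lam $ 2 = mu lam $ 3 \<and> pos_nat (mu lam $ 4 - mu lam $ 3)) \<or>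
    S = {rt 1 4} \<and> (mu lam $ 1 = mu lam $ 4 \<or>
      mu lam $ 1 = mu lam $ 3 \<and> pos_nat (mu lam $ 4 - mu lam $ 3) \<or>
      mu lam $ 2 = mu lam $ 4 \<and> pos_nat (mu lam $ 1 - mu lam $ 2) \<or>
      mu lam $ 2 = mu lam $ 3 \<and> pos_nat (mu lam $ 1 - mu lam $ 2) \<and> pos_nat (mu lam $ 4 - mu lam $ 3))"
proof -
  have "(\<Sum>i\<in>UNIV. lam $ i) \<noteq> 0" using assms by (simp add: sum_weight algebra_simps)
  from root_sets_of_iff[OF this, of S] show ?thesis
    by (simp only: acyclic_on_23_iff acyclic_on_13_iff acyclic_on_24_iff acyclic_on_14_iff not_not)
qed

lemma vec4_eq_iff: "(m :: 'a::zero^4) = vector [a, b, c, d] \<longleftrightarrow> m $ 1 = a \<and> m $ 2 = b \<and> m $ 3 = c \<and> m $ 4 = d"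
  by (simp add: vec_eq_iff forall_4)

lemma exists_shift:
  assumes "atypicality lam = 1"
  shows "\<exists>t a b. let m = mu lam + vector [t, t, t, t] in
        (m = vector [0, a, b, 0] \<and> a \<noteq> b \<and> a * b \<noteq> 0) \<or>
        (m = vector [0, a, 0, b] \<and> a \<noteq> b \<and> a \<noteq> 0) \<or>
        (m = vector [a, 0, b, 0] \<and> a \<noteq> b \<and> b \<noteq> 0) \<or>
        (m = vector [a, 0, 0, b] \<and> a \<noteq> b)"
proof -
  note at = atypicality_1[OF assms]
  let ?m = "mu lam"
  \<comment> \<open>Testing the equalities in this order collects the inequalities that become the
    side conditions of the normal forms.\<close>
  consider "?m $ 2 = ?m $ 3" "?m $ 1 \<noteq> ?m $ 4"
    | "?m $ 1 = ?m $ 3" "?m $ 2 \<noteq> ?m $ 3" "?m $ 2 \<noteq> ?m $ 4"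
    | "?m $ 2 = ?m $ 4" "?m $ 2 \<noteq> ?m $ 3" "?m $ 1 \<noteq> ?m $ 3"
    | "?m $ 1 = ?m $ 4" "?m $ 2 \<noteq> ?m $ 3" "?m $ 1 \<noteq> ?m $ 3" "?m $ 2 \<noteq> ?m $ 4"
    using at by metis
  then show ?thesis
  proof cases
    case 1
    then show ?thesis
      by (intro exI[of _ "- ?m $ 2"] exI[of _ "?m $ 1 - ?m $ 2"] exI[of _ "?m $ 4 - ?m $ 2"])
        (simp add: Let_def vec4_eq_iff)
  next
    case 2
    then show ?thesis
      by (intro exI[of _ "- ?m $ 1"] exI[of _ "?m $ 2 - ?m $ 1"] exI[of _ "?m $ 4 - ?m $ 1"])
        (simp add: Let_def vec4_eq_iff)
  next
    case 3
    then show ?thesis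
      by (intro exI[of _ "- ?m $ 2"] exI[of _ "?m $ 1 - ?m $ 2"] exI[of _ "?m $ 3 - ?m $ 2"])
        (simp add: Let_def vec4_eq_iff)
  next
    case 4
    then show ?thesis
      by (intro exI[of _ "- ?m $ 1"] exI[of _ "?m $ 2 - ?m $ 1"] exI[of _ "?m $ 3 - ?m $ 1"])
        (simp add: Let_def vec4_eq_iff)
  qed
qed

text \<open>Differences of coordinates and the inequality of the two sums are unchanged by the
  shift.\<close>

lemma root_sets_of_shift:
  assumes "mu lam + vector [t, t, t, t] = vector [a, b, c, d]" "a + b \<noteq> c + d"
  shows "S \<in> root_sets_of lam \<longleftrightarrow> S = {} \<or>
    S = {rt 2 3} \<and> b = c \<or>
    S = {rt 1 3} \<and> (a = c \<or> b = c \<and> pos_nat (a - b)) \<or>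
    S = {rt 2 4} \<and> (b = d \<or> b = c \<and> pos_nat (d - c)) \<or>
    S = {rt 1 4} \<and> (a = d \<or> a = c \<and> pos_nat (d - c) \<or> b = d \<and> pos_nat (a - b) \<or>
      b = c \<and> pos_nat (a - b) \<and> pos_nat (d - c))"
proof -
  have m: "mu lam $ 1 = a - t" "mu lam $ 2 = b - t" "mu lam $ 3 = c - t" "mu lam $ 4 = d - t"
    using assms(1) by (auto simp: vec4_eq_iff algebra_simps)
  have "mu lam $ 1 + mu lam $ 2 \<noteq> mu lam $ 3 + mu lam $ 4"
    using assms(2) by (auto simp: m algebra_simps)
  from root_sets_of_iff_mu[OF this, of S] show ?thesis by (simp add: m)
qed

theorem lemma5p18:
  fixes lam :: weight and \<alpha> \<beta> \<gamma> \<delta> :: weight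
  assumes "\<alpha> = eps2 - del1" and "\<beta> = eps1 - del1"
    and "\<gamma> = eps2 - del2" and "\<delta> = eps1 - del2"
    and "atypicality lam = 1"
  shows
    "(\<exists>t a b. let m = mu lam + vector [t, t, t, t] in
        (m = vector [0, a, b, 0] \<and> a \<noteq> b \<and> a * b \<noteq> 0) \<or>
        (m = vector [0, a, 0, b] \<and> a \<noteq> b \<and> a \<noteq> 0) \<or>
        (m = vector [a, 0, b, 0] \<and> a \<noteq> b \<and> b \<noteq> 0) \<or>
        (m = vector [a, 0, 0, b] \<and> a \<noteq> b))
     \<and>
     (\<forall>t a b. let m = mu lam + vector [t, t, t, t] in
        (m = vector [0, a, b, 0] \<and> a \<noteq> b \<and> a * b \<noteq> 0 \<longrightarrow>
           root_sets_of lam = {{\<delta>}, {}}) \<and>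
        (m = vector [0, a, 0, b] \<and> a \<noteq> b \<and> a \<noteq> 0 \<longrightarrow>
           (b \<notin> \<nat> \<longrightarrow> root_sets_of lam = {{\<beta>}, {}}) \<and>
           (b \<in> \<nat> \<longrightarrow> root_sets_of lam = {{\<beta>}, {\<delta>}, {}})) \<and>
        (m = vector [a, 0, b, 0] \<and> a \<noteq> b \<and> b \<noteq> 0 \<longrightarrow>
           (a \<notin> \<nat> \<longrightarrow> root_sets_of lam = {{\<gamma>}, {}}) \<and>
           (a \<in> \<nat> \<longrightarrow> root_sets_of lam = {{\<gamma>}, {\<delta>}, {}})) \<and>
        (m = vector [a, 0, 0, b] \<and> a \<noteq> b \<longrightarrow>
           (b \<notin> \<nat> \<and> a \<notin> \<nat> \<longrightarrow> root_sets_of lam = {{\<alpha>}, {}}) \<and>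
           (b \<in> \<nat> \<and> a \<notin> \<nat> \<longrightarrow> root_sets_of lam = {{\<gamma>}, {\<alpha>}, {}}) \<and>
           (a \<in> \<nat> \<and> b \<notin> \<nat> \<longrightarrow> root_sets_of lam = {{\<beta>}, {\<alpha>}, {}}) \<and>
           (a \<in> \<nat> \<and> b \<in> \<nat> \<longrightarrow>
              root_sets_of lam = {{\<delta>}, {\<gamma>}, {\<beta>}, {\<alpha>}, {}})))"
proof -
  have r: "\<alpha> = rt 2 3" "\<beta> = rt 1 3" "\<gamma> = rt 2 4" "\<delta> = rt 1 4"
    by (simp_all add: assms rt_def)
  \<comment> \<open>In each of the four normal forms the hypothesis
    \<open>a + b \<noteq> c + d\<close> of \<open>root_sets_of_shift\<close> becomes
    \<open>a \<noteq> b\<close>.\<close>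
  have 1: "S \<in> root_sets_of lam \<longleftrightarrow> S = {\<delta>} \<or> S = {}"
    if "mu lam + vector [t, t, t, t] = vector [0, a, b, 0]" "a \<noteq> b" "a * b \<noteq> 0" for t a b S
    using root_sets_of_shift[OF that(1), of S] that(2,3) by (auto simp: r)
  have 2: "S \<in> root_sets_of lam \<longleftrightarrow> S = {\<beta>} \<or> S = {\<delta>} \<and> b \<in> \<nat> \<or> S = {}"
    if "mu lam + vector [t, t, t, t] = vector [0, a, 0, b]" "a \<noteq> b" "a \<noteq> 0" for t a b S
    using root_sets_of_shift[OF that(1), of S] that(2,3) by (auto simp: r Nats_iff_pos_nat)
  have 3: "S \<in> root_sets_of lam \<longleftrightarrow> S = {\<gamma>} \<or> S = {\<delta>} \<and> a \<in> \<nat> \<or> S = {}"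
    if "mu lam + vector [t, t, t, t] = vector [a, 0, b, 0]" "a \<noteq> b" "b \<noteq> 0" for t a b S
    using root_sets_of_shift[OF that(1), of S] that(2,3) by (auto simp: r Nats_iff_pos_nat)
  have 4: "S \<in> root_sets_of lam \<longleftrightarrow> S = {\<delta>} \<and> a \<in> \<nat> \<and> b \<in> \<nat> \<or> S = {\<gamma>} \<and> b \<in> \<nat> \<or>
      S = {\<beta>} \<and> a \<in> \<nat> \<or> S = {\<alpha>} \<or> S = {}"
    if "mu lam + vector [t, t, t, t] = vector [a, 0, 0, b]" "a \<noteq> b" for t a b S
    using root_sets_of_shift[OF that(1), of S] that(2) by (auto simp: r Nats_iff_pos_nat)
  show ?thesis
    unfolding Let_def
    by (intro conjI allI impI exists_shift[OF assms(5), unfolded Let_def] set_eqI; elim conjE)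
      (simp_all add: 1 2 3 4)
qed

end
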